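(* Let $m>1$ be an integer, let $\ell$ be an odd integer, and let $J$, $A$, $B$, $C$, $s$, $u$ be as defined in the context. The assignments $$A\mapsto AB^{2s},\ B\mapsto B^{1-4s}A^{2s}\qquad\text{and}\qquad A\mapsto A,\ B\mapsto BA^u$$ extend to automorphisms, say $\Delta_1$ and $\Delta_2$, respectively, of $J$. Moreover, $$\mathrm{Inn}(J)\mathrm{Aut}_3(J)=\langle\Delta_1,\Delta_2\rangle\mathrm{Inn}(J)\mathrm{Aut}_2(J),\qquad \mathrm{Aut}_3(J)=\langle\Delta_1,\Delta_2,C\delta\rangle\mathrm{Aut}_2(J),$$ $$\mathrm{Aut}_3(J)/\mathrm{Aut}_2(J)\cong(\mathbb{Z}/2^{m-1}\mathbb{Z})^2\times\mathbb{Z}/2\mathbb{Z},\qquad \mathrm{Inn}(J)\mathrm{Aut}_3(J)/\mathrm{Aut}_3(J)\cong(\mathbb{Z}/2^{m-1}\mathbb{Z})^2,$$ $$|\mathrm{Aut}_3(J)|=2^{6m-1},\qquad |\mathrm{Inn}(J)\mathrm{Aut}_3(J)|=2^{8m-3}.$$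
   Context: Notation: $[a,b]=a^{-1}b^{-1}ab$, $b^a=a^{-1}ba$, $\alpha=1+2^m\ell$, $s=2^{m-1}$, $u=s^2$. The group is $$J=\langle A,B\mid A^{[A,B]}=A^{\alpha},\ B^{[B,A]}=B^{\alpha},\ A^{2^{3m-1}}=B^{2^{3m-1}}=1\rangle,\qquad C=[A,B].$$ For a group $T$, $Z_0(T)=1, Z_1(T),Z_2(T),\dots$ denotes the upper central series, and $\mathrm{Aut}_i(T)$ is the kernel of the canonical map $\mathrm{Aut}(T)\to\mathrm{Aut}(T/Z_i(T))$. $C\delta$ denotes conjugation by $C$, i.e. the inner automorphism $x\mapsto x^C$. *)

theory Defs
  imports "HOL-Algebra.Bij" "HOL-Algebra.Coset" "HOL-Algebra.Generated_Groups"
    "HOL-Algebra.Elementary_Groups"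
begin

section \<open>Commutators, conjugation and the upper central series\<close>

definition gconj :: "('a, 'b) monoid_scheme \<Rightarrow> 'a \<Rightarrow> 'a \<Rightarrow> 'a"
  where "gconj G b a = inv\<^bsub>G\<^esub> a \<otimes>\<^bsub>G\<^esub> b \<otimes>\<^bsub>G\<^esub> a"

definition gcomm :: "('a, 'b) monoid_scheme \<Rightarrow> 'a \<Rightarrow> 'a \<Rightarrow> 'a"
  where "gcomm G a b = inv\<^bsub>G\<^esub> a \<otimes>\<^bsub>G\<^esub> inv\<^bsub>G\<^esub> b \<otimes>\<^bsub>G\<^esub> a \<otimes>\<^bsub>G\<^esub> b"

definition gcenter :: "('a, 'b) monoid_scheme \<Rightarrow> 'a set"
  where "gcenter G = {z \<in> carrier G. \<forall>g \<in> carrier G. z \<otimes>\<^bsub>G\<^esub> g = g \<otimes>\<^bsub>G\<^esub> z}"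

primrec upper_central :: "('a, 'b) monoid_scheme \<Rightarrow> nat \<Rightarrow> 'a set"
  where
    "upper_central G 0 = {\<one>\<^bsub>G\<^esub>}"
  | "upper_central G (Suc i) =
      {x \<in> carrier G. upper_central G i #>\<^bsub>G\<^esub> x \<in> gcenter (G Mod upper_central G i)}"


section \<open>Subgroups of the automorphism group\<close>

text \<open>Automorphisms are extensional functions, see \<^const>\<open>auto\<close>.\<close>

definition inner_aut :: "('a, 'b) monoid_scheme \<Rightarrow> 'a \<Rightarrow> 'a \<Rightarrow> 'a"
  where "inner_aut G g = (\<lambda>x \<in> carrier G. gconj G x g)"

definition Inn :: "('a, 'b) monoid_scheme \<Rightarrow> ('a \<Rightarrow> 'a) set"
  where "Inn G = inner_aut G ` carrier G"

text \<open>For a characteristic subgroup \<open>N\<close>, an automorphism \<open>f\<close> maps the coset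
  \<open>N x\<close> onto the coset \<open>N (f x)\<close>, so its action on \<open>G / N\<close> is given by images of sets.\<close>

definition quot_aut :: "('a, 'b) monoid_scheme \<Rightarrow> 'a set \<Rightarrow> ('a \<Rightarrow> 'a) \<Rightarrow> 'a set \<Rightarrow> 'a set"
  where "quot_aut G N f = (\<lambda>K \<in> carrier (G Mod N). f ` K)"

definition Aut_ker :: "('a, 'b) monoid_scheme \<Rightarrow> nat \<Rightarrow> ('a \<Rightarrow> 'a) set"
  where "Aut_ker G i =
    kernel (AutoGroup G) (AutoGroup (G Mod upper_central G i)) (quot_aut G (upper_central G i))"


section \<open>Free groups and presentations\<close>

text \<open>The letter \<open>(True, x)\<close> stands for the generator \<open>x\<close>, and \<open>(False, x)\<close> for its inverse.\<close>

type_synonym 'g word = "(bool \<times> 'g) list"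

inductive free_eq :: "'g word \<Rightarrow> 'g word \<Rightarrow> bool"
  where
    refl: "free_eq u u"
  | sym: "free_eq u v \<Longrightarrow> free_eq v u"
  | trans: "free_eq u v \<Longrightarrow> free_eq v w \<Longrightarrow> free_eq u w"
  | cancel: "free_eq (u @ [(e, x), (\<not> e, x)] @ v) (u @ v)"

definition free_rel :: "('g word \<times> 'g word) set"
  where "free_rel = {(u, v). free_eq u v}"

definition free_group :: "'g word set monoid"
  where "free_group =
    \<lparr>carrier = UNIV // free_rel,
     mult = \<lambda>U V. free_rel `` {u @ v |u v. u \<in> U \<and> v \<in> V},
     one = free_rel `` {[]}\<rparr>"

definition free_gen :: "'g \<Rightarrow> 'g word set"
  where "free_gen x = free_rel `` {[(True, x)]}"

lemma equiv_free_rel: "equiv UNIV free_rel"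
  by (rule equivI)
    (auto simp: free_rel_def refl_on_def sym_def trans_def intro: free_eq.intros)

lemma free_eq_append_left: "free_eq u v \<Longrightarrow> free_eq (w @ u) (w @ v)"
proof (induction rule: free_eq.induct)
  case (cancel u e x v)
  then show ?case using free_eq.cancel[of "w @ u" e x v] by simp
qed (auto intro: free_eq.intros)

lemma free_eq_append_right: "free_eq u v \<Longrightarrow> free_eq (u @ w) (v @ w)"
proof (induction rule: free_eq.induct)
  case (cancel u e x v)
  then show ?case using free_eq.cancel[of u e x "v @ w"] by simp
qed (auto intro: free_eq.intros)

lemma free_eq_append: "free_eq u u' \<Longrightarrow> free_eq v v' \<Longrightarrow> free_eq (u @ v) (u' @ v')"
  by (meson free_eq.trans free_eq_append_left free_eq_append_right)

lemma free_class_eq_iff: "free_rel `` {u} = free_rel `` {v} \<longleftrightarrow> free_eq u v"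
  using eq_equiv_class_iff[OF equiv_free_rel, of u v] by (simp add: free_rel_def)

lemma carrier_free_group: "carrier free_group = range (\<lambda>w. free_rel `` {w})"
  by (auto simp: free_group_def quotient_def)

lemma mult_free_group:
  "free_rel `` {u} \<otimes>\<^bsub>free_group\<^esub> free_rel `` {v} = free_rel `` {u @ v}"
  by (auto simp: free_group_def free_rel_def
      intro: free_eq.intros free_eq_append)

lemma one_free_group: "\<one>\<^bsub>free_group\<^esub> = free_rel `` {[]}"
  by (simp add: free_group_def)

lemma free_eq_inverse: "free_eq (map (apfst Not) (rev w) @ w) []"
proof (induction w)
  case Nil
  then show ?case by (simp add: free_eq.refl)
next
  case (Cons p w)
  obtain e x where p: "p = (e, x)" by force
  show ?case
    using free_eq.cancel[of "map (apfst Not) (rev w)" "\<not> e" x w] Cons p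
    by (auto intro: free_eq.trans)
qed

lemma group_free_group: "group free_group"
proof (rule groupI)
  fix U assume "U \<in> carrier free_group"
  then obtain w where "U = free_rel `` {w}" by (auto simp: carrier_free_group)
  then show "\<exists>V \<in> carrier free_group. V \<otimes>\<^bsub>free_group\<^esub> U = \<one>\<^bsub>free_group\<^esub>"
    by (intro bexI[of _ "free_rel `` {map (apfst Not) (rev w)}"])
      (auto simp: mult_free_group one_free_group free_class_eq_iff carrier_free_group
        free_eq_inverse)
qed (auto simp: carrier_free_group mult_free_group one_free_group)

lemma free_gen_closed: "free_gen x \<in> carrier free_group"
  by (auto simp: free_gen_def carrier_free_group)

lemma free_class_Cons:
  "free_rel `` {(e, x) # w} =
    (if e then free_gen x else inv\<^bsub>free_group\<^esub> free_gen x) \<otimes>\<^bsub>free_group\<^esub> free_rel `` {w}"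
proof -
  have "inv\<^bsub>free_group\<^esub> free_gen x = free_rel `` {[(False, x)]}"
    using free_eq.cancel[of "[]" False x "[]"]
    by (intro group.inv_equality[OF group_free_group])
      (auto simp: free_gen_def mult_free_group one_free_group free_class_eq_iff carrier_free_group)
  then show ?thesis by (simp add: free_gen_def mult_free_group)
qed

lemma free_group_universal:
  assumes "group H" and f: "\<And>x. f x \<in> carrier H"
  shows "\<exists>h \<in> hom free_group H. \<forall>x. h (free_gen x) = f x"
proof -
  interpret H: group H by fact
  define ev where
    "ev = (\<lambda>w. foldr (\<lambda>(e, x) y. (if e then f x else inv\<^bsub>H\<^esub> f x) \<otimes>\<^bsub>H\<^esub> y) w \<one>\<^bsub>H\<^esub>)"
  have ev_simps: "ev [] = \<one>\<^bsub>H\<^esub>"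
    "ev ((e, x) # w) = (if e then f x else inv\<^bsub>H\<^esub> f x) \<otimes>\<^bsub>H\<^esub> ev w" for e x w
    by (auto simp: ev_def)
  have ev_closed: "ev w \<in> carrier H" for w
    by (induction w) (auto simp: ev_simps f)
  have ev_append: "ev (u @ v) = ev u \<otimes>\<^bsub>H\<^esub> ev v" for u v
    by (induction u) (auto simp: ev_simps f ev_closed H.m_assoc)
  have ev_eq: "free_eq u v \<Longrightarrow> ev u = ev v" for u v
  proof (induction rule: free_eq.induct)
    case (cancel u e x v)
    then show ?case
      by (cases e) (auto simp: ev_append ev_simps f ev_closed H.m_assoc[symmetric])
  qed auto
  define h where "h = (\<lambda>U. ev (SOME w. w \<in> U))"
  have h_class: "h (free_rel `` {w}) = ev w" for w
  proof -
    have "(SOME v. v \<in> free_rel `` {w}) \<in> free_rel `` {w}"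
      by (rule someI[of _ w]) (auto simp: free_rel_def free_eq.refl)
    then show ?thesis by (auto simp: h_def free_rel_def dest: ev_eq)
  qed
  show ?thesis
  proof (intro bexI allI)
    show "h \<in> hom free_group H"
      by (rule homI) (auto simp: carrier_free_group h_class mult_free_group ev_append ev_closed)
    show "h (free_gen x) = f x" for x
      by (simp add: free_gen_def h_class ev_simps f)
  qed
qed

definition normal_closure :: "('a, 'b) monoid_scheme \<Rightarrow> 'a set \<Rightarrow> 'a set"
  where "normal_closure G R = generate G {gconj G r g |r g. r \<in> R \<and> g \<in> carrier G}"

text \<open>The generators of \<open>presented_group R\<close> are all elements of the type \<open>'g\<close>.\<close>

definition presented_group :: "'g word set set \<Rightarrow> 'g word set set monoid"
  where "presented_group R = free_group Mod normal_closure free_group R"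

definition presented_gen :: "'g word set set \<Rightarrow> 'g \<Rightarrow> 'g word set set"
  where "presented_gen R x = normal_closure free_group R #>\<^bsub>free_group\<^esub> free_gen x"

lemma normal_normal_closure:
  assumes "group G" and R: "R \<subseteq> carrier G"
  shows "normal_closure G R \<lhd> G"
proof -
  interpret group G by fact
  let ?S = "{gconj G r g |r g. r \<in> R \<and> g \<in> carrier G}"
  have S: "?S \<subseteq> carrier G" using R by (auto simp: gconj_def)
  have "x \<otimes>\<^bsub>G\<^esub> h \<otimes>\<^bsub>G\<^esub> inv\<^bsub>G\<^esub> x \<in> ?S"
    if x: "x \<in> carrier G" and h: "h \<in> ?S" for x h
  proof -
    obtain r g where rg: "h = gconj G r g" "r \<in> R" "g \<in> carrier G" using h by auto
    then have "x \<otimes>\<^bsub>G\<^esub> h \<otimes>\<^bsub>G\<^esub> inv\<^bsub>G\<^esub> x = gconj G r (g \<otimes>\<^bsub>G\<^esub> inv\<^bsub>G\<^esub> x)"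
      using x R by (auto simp: gconj_def inv_mult_group m_assoc subset_iff)
    then show ?thesis using x rg by auto
  qed
  then show ?thesis
    unfolding normal_closure_def by (intro normal_generateI[OF S])
qed

lemma group_presented_group:
  assumes "R \<subseteq> carrier free_group"
  shows "group (presented_group R)"
  unfolding presented_group_def
  by (rule normal.factorgroup_is_group[OF normal_normal_closure[OF group_free_group assms]])

lemma presented_gen_closed: "presented_gen R x \<in> carrier (presented_group R)"
  by (auto simp: presented_gen_def presented_group_def carrier_FactGroup free_gen_closed)

lemma presented_group_universal:
  assumes "group H" and R: "R \<subseteq> carrier free_group"
    and h: "h \<in> hom free_group H" "\<And>r. r \<in> R \<Longrightarrow> h r = \<one>\<^bsub>H\<^esub>"
  shows "\<exists>k \<in> hom (presented_group R) H. \<forall>x. k (presented_gen R x) = h (free_gen x)"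
proof -
  interpret group_hom free_group H h
    using assms group_free_group by (simp add: group_hom_def group_hom_axioms_def)
  have "normal_closure free_group R \<subseteq> kernel free_group H h"
    unfolding normal_closure_def
  proof (rule G.generate_subgroup_incl[OF _ subgroup_kernel])
    show "{gconj free_group r g |r g. r \<in> R \<and> g \<in> carrier free_group} \<subseteq> kernel free_group H h"
      using R h by (auto simp: kernel_def gconj_def subset_iff)
  qed
  then obtain k where "k \<in> hom (presented_group R) H"
    "\<And>x. x \<in> carrier free_group \<Longrightarrow> k (normal_closure free_group R #>\<^bsub>free_group\<^esub> x) = h x"
    using FactGroup_universal_kernel[OF normal_normal_closure[OF group_free_group R]]
    unfolding presented_group_def by metis
  then show ?thesis by (intro bexI[of _ k]) (auto simp: presented_gen_def free_gen_closed)
qed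


section \<open>The group \<open>J\<close>\<close>

datatype gen = gen_A | gen_B

text \<open>A relation \<open>v = w\<close> is encoded by the relator \<open>v w\<^sup>-\<^sup>1\<close>. The exponent \<open>\<alpha>\<close> may be
  negative, so its powers are integer powers.\<close>

definition J_relators :: "nat \<Rightarrow> int \<Rightarrow> gen word set set"
  where "J_relators m l =
    (let F = free_group; a = free_gen gen_A; b = free_gen gen_B; \<alpha> = 1 + 2 ^ m * l in
      {gconj F a (gcomm F a b) \<otimes>\<^bsub>F\<^esub> inv\<^bsub>F\<^esub> (a [^]\<^bsub>F\<^esub> \<alpha>),
       gconj F b (gcomm F b a) \<otimes>\<^bsub>F\<^esub> inv\<^bsub>F\<^esub> (b [^]\<^bsub>F\<^esub> \<alpha>),
       a [^]\<^bsub>F\<^esub> ((2::nat) ^ (3 * m - 1)),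
       b [^]\<^bsub>F\<^esub> ((2::nat) ^ (3 * m - 1))})"

definition J_group :: "nat \<Rightarrow> int \<Rightarrow> gen word set set monoid"
  where "J_group m l = presented_group (J_relators m l)"

definition J_A :: "nat \<Rightarrow> int \<Rightarrow> gen word set set"
  where "J_A m l = presented_gen (J_relators m l) gen_A"

definition J_B :: "nat \<Rightarrow> int \<Rightarrow> gen word set set"
  where "J_B m l = presented_gen (J_relators m l) gen_B"

lemma J_relators_closed: "J_relators m l \<subseteq> carrier free_group"
proof -
  interpret group free_group by (rule group_free_group)
  show ?thesis by (auto simp: J_relators_def Let_def gconj_def gcomm_def free_gen_closed)
qed

lemma group_J_group: "group (J_group m l)"
  unfolding J_group_def by (rule group_presented_group[OF J_relators_closed])

lemma J_A_closed: "J_A m l \<in> carrier (J_group m l)"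
  and J_B_closed: "J_B m l \<in> carrier (J_group m l)"
  by (simp_all add: J_A_def J_B_def J_group_def presented_gen_closed)

end

theory Submission
  imports Defs "HOL-Number_Theory.Cong" "HOL-Algebra.SndIsomorphismGrp" "HOL.Rat"
begin

text \<open>
  Put \<open>h = s l\<close>, so that \<open>\<alpha> = 1 + 2 h\<close>, and \<open>N = 2 s\<^sup>2\<close>, \<open>D = 4 s\<^sup>3 = 2\<^sup>3\<^sup>m\<^sup>-\<^sup>1\<close>.

  \<^bold>\<open>Normal form.\<close> The relations allow to move \<open>C\<close> past powers of \<open>A\<close> and \<open>B\<close>, and
  \<open>A\<^sup>i B = B C\<^sup>i A\<^sup>n\<close> with \<open>n = \<alpha> + \<dots> + \<alpha>\<^sup>i\<close>, so every element of \<open>J\<close> is some \<open>C\<^sup>k B\<^sup>j A\<^sup>i\<close>. Conjugating the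
  relation for \<open>B\<close> by \<open>A\<close> yields \<open>B\<^sup>N = A\<^sup>-\<^sup>N\<close>, hence \<open>A\<^sup>N\<close> is central, and then \<open>C\<^sup>N = A\<^sup>s\<^sup>N\<close>. There are no further
  coincidences: the formulas for right multiplication define permutations of \<open>\<int>\<^sup>3\<close> modulo the lattice of the
  relations found so far, and these permutations satisfy the defining relations of \<open>J\<close> (\<open>perm_E_unique\<close>). Only the relation
  \<open>C B = B\<^sup>\<alpha> C\<close> takes work here, because it involves the \<open>\<alpha>\<close>-th iterate of right multiplication by \<open>B\<close>. Exponents
  are handled as integer polynomials in \<open>h\<close>, in which \<open>4 h\<^sup>3\<close> counts as zero.

  \<^bold>\<open>Third centre.\<close> The elements \<open>W x y z = A\<^sup>2\<^sup>s\<^sup>x B\<^sup>2\<^sup>s\<^sup>y C\<^sup>s\<^sup>z\<close> form an abelian normal subgroup on which \<open>A\<close>, \<open>B\<close>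
  and \<open>C\<close> act by linear maps of the coordinates (\<open>W_A\<close>, \<open>W_B\<close>, \<open>W_C\<close>). It is the third term of the upper central series;
  the second term consists of the \<open>W (s x) 0 z\<close> and the first one of the \<open>W (s x) 0 0\<close>.

  \<^bold>\<open>Automorphisms.\<close> An element \<open>f\<close> of \<open>Aut\<^sub>3(J)\<close> is given by \<open>f A = A W(a, b, \<dots>)\<close> and \<open>f B = B W(c, d, \<dots>)\<close>. By linearity, the
  relations of \<open>J\<close> for these two elements amount to the congruences \<open>a + d + 2 b = 0\<close> and \<open>a + d + 2 c = 0\<close> modulo \<open>s\<close>
  (\<open>perturbation_J_rel\<close>), and a solution defines an endomorphism, which is bijective because it fixes the centre pointwise. For
  \<open>Aut\<^sub>2(J)\<close> the congruences are void, so \<open>Aut\<^sub>2(J)\<close> is in bijection with the pairs of elements of the second centre and has order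
  \<open>2\<^sup>4\<^sup>m\<close>. Modulo \<open>Aut\<^sub>2(J)\<close> the coordinates add up under composition; \<open>a\<close> and \<open>b\<close> are free modulo \<open>s\<close>, and \<open>c - b\<close> is \<open>0\<close> or
  \<open>s / 2\<close>. The automorphisms \<open>\<Delta>\<^sub>1\<close>, \<open>\<Delta>\<^sub>2\<close> and \<open>C\<delta>\<close> have the coordinates \<open>(0, 1, 0)\<close>, \<open>(0, 0, 1)\<close> and \<open>(l, 0, 0)\<close> in
  \<open>(\<int>/s)\<^sup>2 \<times> \<int>/2\<close>, and these generate.

  \<^bold>\<open>Inner automorphisms.\<close> Modulo the third centre, conjugation by \<open>C\<^sup>k B\<^sup>j A\<^sup>i\<close> maps \<open>A\<close> to \<open>A C\<^sup>j\<close> and \<open>B\<close> to \<open>B C\<^sup>-\<^sup>i\<close>, and there \<open>C\<close>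
  has order \<open>s\<close>. Reading off the exponents of \<open>C\<close> gives a homomorphism of \<open>Inn(J) Aut\<^sub>3(J)\<close> onto \<open>(\<int>/s)\<^sup>2\<close> with kernel
  \<open>Aut\<^sub>3(J)\<close>. The orders follow from Lagrange's theorem.
\<close>

section \<open>Triangular and tetrahedral numbers\<close>

text \<open>These are the binomial coefficients \<open>x + 1\<close> over \<open>2\<close> and \<open>x + 1\<close> over \<open>3\<close>, as polynomial
  functions on all integers, so that they may be used for negative exponents.\<close>

definition tri :: "int \<Rightarrow> int" where "tri x = x * (x + 1) div 2"

definition tet :: "int \<Rightarrow> int" where "tet x = (x - 1) * x * (x + 1) div 6"

lemma tri_double: "2 * tri x = x * (x + 1)"
  by (simp add: tri_def)

lemma tri_Suc: "tri (x + 1) = tri x + x + 1"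
  using tri_double[of x] tri_double[of "x + 1"] by (simp add: algebra_simps)

lemma tet_times_3: "3 * tet x = tri x * (x - 1)"
proof -
  have "x mod 3 = 0 \<or> x mod 3 = 1 \<or> x mod 3 = 2" by presburger
  then have "3 dvd x \<or> 3 dvd (x - 1) \<or> 3 dvd (x + 1)" by presburger
  then have "3 dvd x * (x + 1) * (x - 1)" by auto
  then have "3 dvd 2 * (tri x * (x - 1))"
    using tri_double[of x] by (metis mult.assoc)
  then have 3: "3 dvd tri x * (x - 1)"
    by presburger
  have "tet x = (2 * (tri x * (x - 1))) div (2 * 3)"
    using tri_double[of x] by (simp add: tet_def algebra_simps)
  also have "\<dots> = tri x * (x - 1) div 3"
    by (rule div_mult_mult1) simp
  finally show ?thesis using 3 by simp
qed

lemma tet_Suc: "tet (x + 1) = tet x + tri x"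
proof -
  have "3 * tet (x + 1) = 3 * (tet x + tri x)"
    unfolding distrib_left tet_times_3 tri_Suc using tri_double[of x] by (simp add: algebra_simps)
  then show ?thesis by simp
qed

lemma tri_0 [simp]: "tri 0 = 0" and tri_1 [simp]: "tri 1 = 1" and tri_m1 [simp]: "tri (- 1) = 0"
  and tet_0 [simp]: "tet 0 = 0" and tet_1 [simp]: "tet 1 = 0" and tet_m1 [simp]: "tet (- 1) = 0"
  by (simp_all add: tri_def tet_def)

section \<open>Exponent arithmetic modulo \<open>2\<^sup>3\<^sup>m\<^sup>-\<^sup>1\<close>\<close>

locale scale =
  fixes m :: nat and l :: int
  assumes m_gt_1: "m > 1" and odd_l: "odd l"
begin

text \<open>With \<open>h = s l\<close> one has \<open>\<alpha> = 1 + 2 h\<close>. The number \<open>D\<close> is \<open>2\<^sup>3\<^sup>m\<^sup>-\<^sup>1\<close>, the common exponent of \<open>A\<close>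
  and \<open>B\<close>, and \<open>A\<^sup>N\<close> will turn out to generate the centre.\<close>

definition s :: int where "s = 2 ^ (m - 1)"
definition h :: int where "h = s * l"
definition D :: int where "D = 4 * s ^ 3"
definition N :: int where "N = 2 * s ^ 2"

text \<open>The binomial expansions of \<open>\<alpha>\<^sup>x\<close> and of \<open>\<alpha> + \<alpha>\<^sup>2 + \<dots> + \<alpha>\<^sup>i\<close>, cut off where they vanish modulo \<open>D\<close>.
  Being polynomials, they also make sense for negative arguments.\<close>

definition alpha_pow :: "int \<Rightarrow> int" where "alpha_pow x = 1 + 2 * h * x + 2 * h ^ 2 * (x * (x - 1))"
definition alpha_sum :: "int \<Rightarrow> int" where "alpha_sum i = i + 2 * h * tri i + 4 * h ^ 2 * tet i"

lemma s_even: "even s" and s_pos: "s > 0" and h_even: "even h"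
  using m_gt_1 by (auto simp: s_def h_def)

lemma power_m: "2 ^ m = 2 * s"
  using m_gt_1 unfolding s_def by (cases m) auto

lemma power_D: "2 ^ (3 * m - 1) = D"
proof -
  have "3 * m - 1 = 2 + (m - 1) * 3" using m_gt_1 by simp
  then have "(2::int) ^ (3 * m - 1) = 2 ^ 2 * (2 ^ (m - 1)) ^ 3"
    by (simp only: power_add power_mult)
  then show ?thesis by (simp add: D_def s_def)
qed

lemma D_dvd_h3: "D dvd 4 * h ^ 3"
  by (simp add: D_def h_def power_mult_distrib)

lemma coprime_3_D: "coprime 3 D"
  unfolding power_D[symmetric] by simp

text \<open>As \<open>D\<close> divides \<open>4 h\<^sup>3\<close>, polynomials in \<open>h\<close> may be truncated; the denominator \<open>3\<close> of
  \<open>tet\<close> does no harm, since \<open>D\<close> is a power of two.\<close>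

lemma cong_D_I: "x - y = 4 * h ^ 3 * w \<Longrightarrow> [x = y] (mod D)"
  using D_dvd_h3 by (simp add: cong_iff_dvd_diff)

lemma cong_D_I3: "3 * (x - y) = 4 * h ^ 3 * w \<Longrightarrow> [x = y] (mod D)"
  using D_dvd_h3 coprime_3_D by (metis cong_iff_dvd_diff coprime_commute coprime_dvd_mult_right_iff dvd_mult2)

lemma alpha_pow_0 [simp]: "alpha_pow 0 = 1" and alpha_pow_1 [simp]: "alpha_pow 1 = 1 + 2 * h"
  by (auto simp: alpha_pow_def)

lemma alpha_pow_minus_1: "alpha_pow (- 1) = 1 - 2 * h + 4 * h ^ 2"
  by (simp add: alpha_pow_def)

lemma alpha_pow_add: "[alpha_pow (x + y) = alpha_pow x * alpha_pow y] (mod D)"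
  by (rule cong_D_I[of _ _ "- (x * y * (x - 1) + x * y * (y - 1)) - h * (x * y * (x - 1) * (y - 1))"])
    (simp add: alpha_pow_def algebra_simps power2_eq_square power3_eq_cube)

text \<open>This is \<open>\<alpha> + \<dots> + \<alpha>\<^sup>i\<^sup>+\<^sup>1 = \<alpha> (1 + (\<alpha> + \<dots> + \<alpha>\<^sup>i))\<close>.\<close>

lemma alpha_sum_Suc: "[alpha_sum (i + 1) = (1 + 2 * h) * (alpha_sum i + 1)] (mod D)"
  by (rule cong_D_I[of _ _ "- 2 * tet i"])
    (simp add: alpha_sum_def tri_Suc tet_Suc, simp add: algebra_simps power2_eq_square power3_eq_cube)

lemma alpha_pow_mod_2s: "[alpha_pow x = 1] (mod 2 * s)"
  by (simp add: alpha_pow_def cong_iff_dvd_diff h_def power2_eq_square mult.assoc)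


text \<open>In the group \<open>J\<close>, right multiplication by \<open>B\<^sup>n\<close> sends \<open>C\<^sup>k B\<^sup>j A\<^sup>i\<close> to the element
  with the exponents \<open>k + K n i\<close>, \<open>j alpha_pow (- K n i) + T n i\<close> and \<open>F n i\<close>. The function \<open>Y\<close> only splits a factor
  \<open>2 h\<close> off the difference \<open>F n i - i\<close>.\<close>

definition Y :: "int \<Rightarrow> int \<Rightarrow> int" where
  "Y n i = n * tri i + 2 * h * n * tet i + h * tri (n - 1) * tri i * (2 * i + 1) + h ^ 2 * tri i * tet (n - 1)"

definition F :: "int \<Rightarrow> int \<Rightarrow> int" where "F n i = i + 2 * h * Y n i"

definition K :: "int \<Rightarrow> int \<Rightarrow> int" where
  "K n i = n * i + 2 * h * tri (n - 1) * tri i + 2 * h ^ 2 * tet (n - 1) * tri i * (2 * i + 1)"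

definition T :: "int \<Rightarrow> int \<Rightarrow> int" where
  "T n i = n - 2 * h * i * tri n + 4 * h ^ 2 * tri i * tri n - 4 * h ^ 2 * i * tet n"

text \<open>The Taylor expansion at \<open>i\<close>; the remaining terms are multiples of \<open>4 h\<^sup>3\<close>.\<close>

lemma alpha_sum_shift: "[alpha_sum (i + 2 * h * y) = alpha_sum i + 2 * h * y + 2 * h ^ 2 * y * (2 * i + 1)] (mod D)"
proof -
  define x where "x = i + 2 * h * y"
  have t: "tri x = tri i + h * y * (2 * h * y + 1 + 2 * i)"
    using tri_double[of x] tri_double[of i] unfolding x_def by (simp add: algebra_simps)
  have "3 * (alpha_sum x - (alpha_sum i + 2 * h * y + 2 * h ^ 2 * y * (2 * i + 1)))
    = 3 * (x - i) + 6 * h * (tri x - tri i) + 4 * h ^ 2 * (3 * tet x - 3 * tet i)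
      - 6 * h * y - 6 * h ^ 2 * y * (2 * i + 1)"
    by (simp add: alpha_sum_def algebra_simps)
  also have "\<dots> = 4 * h ^ 3 * (3 * y ^ 2 + y * (2 * h * y + 1 + 2 * i) * (i - 1 + 2 * h * y) + 2 * y * tri i)"
    unfolding tet_times_3 t by (simp add: x_def algebra_simps power2_eq_square power3_eq_cube)
  finally show ?thesis unfolding x_def by (rule cong_D_I3)
qed

text \<open>This recursion and the next ones for \<open>K\<close> and \<open>T\<close> express that right multiplication by
  \<open>B\<^sup>n\<^sup>+\<^sup>1\<close> is right multiplication by \<open>B\<^sup>n\<close> followed by right multiplication by \<open>B\<close>.\<close>

lemma F_step: "[F (n + 1) i = alpha_sum (F n i)] (mod D)"
proof -
  obtain g where g: "h = 2 * g" using h_even by blast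
  have n: "tri n = tri (n - 1) + n" "tet n = tet (n - 1) + tri (n - 1)"
    using tri_Suc[of "n - 1"] tet_Suc[of "n - 1"] by simp_all
  \<comment> \<open>The witness is the quotient of the difference by \<open>4 h\<^sup>3\<close>; \<open>g\<close> supplies one factor \<open>2\<close>.\<close>
  have "[F (n + 1) i = alpha_sum i + 2 * h * Y n i + 2 * h ^ 2 * Y n i * (2 * i + 1)] (mod D)"
    by (rule cong_D_I[of _ _ "- 2 * tri i * tri (n - 1) * (i * (i + 1)) - (2 * i + 1) * n * tet i
          - g * (2 * i + 1) * tri i * tet (n - 1)"])
      (simp add: F_def Y_def alpha_sum_def n, simp add: g algebra_simps power2_eq_square power3_eq_cube)
  then show ?thesis
    unfolding F_def[of n] using alpha_sum_shift[of i "Y n i"] by (meson cong_sym cong_trans)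
qed

lemma K_step: "[K (n + 1) i = K n i + F n i] (mod 2 * N)"
proof -
  obtain g where g: "h = 2 * g" using h_even by blast
  have n: "tri n = tri (n - 1) + n" "tet n = tet (n - 1) + tri (n - 1)"
    using tri_Suc[of "n - 1"] tet_Suc[of "n - 1"] by simp_all
  have "K (n + 1) i - (K n i + F n i) = 4 * h ^ 2 * - (n * tet i + g * tri i * tet (n - 1))"
    by (simp add: F_def Y_def K_def n, simp add: g algebra_simps power2_eq_square)
  moreover have "2 * N dvd 4 * h ^ 2" by (simp add: N_def h_def power_mult_distrib)
  ultimately show ?thesis by (simp add: cong_iff_dvd_diff)
qed

lemma alpha_pow_minus_F: "[alpha_pow (- F n i) = 1 - 2 * h * i + 4 * h ^ 2 * tri i * (1 - n)] (mod D)"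
proof (rule cong_D_I)
  define y where "y = Y n i"
  define r where "r = 2 * n * tet i + tri (n - 1) * tri i * (2 * i + 1) + h * tri i * tet (n - 1)"
  have y: "y = n * tri i + h * r" by (simp add: y_def r_def Y_def algebra_simps power2_eq_square)
  have "alpha_pow (- F n i) = 1 - 2 * h * i - 4 * h ^ 2 * y
      + 2 * h ^ 2 * (i * (i + 1)) + 4 * h ^ 3 * (y * (2 * i + 1) + 2 * h * y ^ 2)"
    by (simp add: alpha_pow_def F_def flip: y_def) (simp add: algebra_simps power2_eq_square power3_eq_cube)
  also have "\<dots> = 1 - 2 * h * i + 4 * h ^ 2 * tri i * (1 - n) + 4 * h ^ 3 * (y * (2 * i + 1) + 2 * h * y ^ 2 - r)"
    unfolding tri_double[symmetric] using y by (simp add: algebra_simps power2_eq_square power3_eq_cube)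
  finally show "alpha_pow (- F n i) - (1 - 2 * h * i + 4 * h ^ 2 * tri i * (1 - n)) = 
    4 * h ^ 3 * (y * (2 * i + 1) + 2 * h * y ^ 2 - r)" by simp
qed

lemma T_step: "[T (n + 1) i = (T n i + 1) * alpha_pow (- F n i)] (mod D)"
proof -
  have sq: "i * i = 2 * tri i - i" "n * n = 2 * tri n - n" "\<And>z. i * (i * z) = 2 * tri i * z - i * z"
    "\<And>z. n * (n * z) = 2 * tri n * z - n * z"
    using tri_double[of i] tri_double[of n] by (simp_all add: algebra_simps)
  have "[(T n i + 1) * (1 - 2 * h * i + 4 * h ^ 2 * tri i * (1 - n)) = T (n + 1) i] (mod D)"
    by (rule cong_D_I[of _ _ "- 2 * i * tri n * tri i * (1 - n) - 2 * tri i * tri n * i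
       + 4 * h * tri i ^ 2 * tri n * (1 - n) + 2 * i ^ 2 * tet n - 4 * h * i * tet n * tri i * (1 - n)"])
      (simp add: T_def tri_Suc tet_Suc, simp add: algebra_simps power2_eq_square power3_eq_cube sq)
  then show ?thesis
    by (meson alpha_pow_minus_F cong_scalar_left cong_sym cong_trans)
qed

text \<open>Over the rationals \<open>tri\<close> and \<open>tet\<close> are polynomials, so an integer identity that contains
  them at several arguments can be verified by expanding both sides.\<close>

lemma tri_rat: "(of_int (tri x) :: rat) = of_int x * (of_int x + 1) / 2"
proof -
  have "(of_int (2 * tri x) :: rat) = of_int (x * (x + 1))" by (simp only: tri_double)
  then show ?thesis by simp
qed

lemma tet_rat: "(of_int (tet x) :: rat) = (of_int x - 1) * of_int x * (of_int x + 1) / 6"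
proof -
  have "(of_int (3 * tet x) :: rat) = of_int (tri x * (x - 1))" by (simp only: tet_times_3)
  then show ?thesis by (simp add: tri_rat mult_ac)
qed

lemma coprime_3_N: "coprime 3 N"
proof -
  have "N dvd D" by (simp add: N_def D_def power2_eq_square power3_eq_cube)
  then show ?thesis using coprime_3_D by (metis coprime_divisors dvd_refl)
qed

lemma K_alpha: "[K (1 + 2 * h) i = (1 + 2 * h) * i] (mod N)"
proof -
  have "(of_int (3 * (K (1 + 2 * h) i - (1 + 2 * h) * i)) :: rat) =
    of_int (2 * h ^ 2 * (tri i * (3 + 5 * h - 2 * h * i + 4 * h ^ 3 + 8 * h ^ 3 * i)))"
    by (simp add: K_def tri_rat tet_rat, simp add: field_simps power2_eq_square power3_eq_cube)
  then have "3 * (K (1 + 2 * h) i - (1 + 2 * h) * i) =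
    2 * h ^ 2 * (tri i * (3 + 5 * h - 2 * h * i + 4 * h ^ 3 + 8 * h ^ 3 * i))"
    by (simp only: of_int_eq_iff)
  moreover have "N dvd 2 * h ^ 2" by (simp add: N_def h_def power_mult_distrib)
  ultimately have "N dvd 3 * (K (1 + 2 * h) i - (1 + 2 * h) * i)" by simp
  then show ?thesis using coprime_3_N
    by (metis cong_iff_dvd_diff coprime_commute coprime_dvd_mult_right_iff)
qed

lemma T_alpha: "[alpha_pow (- 1) * T (1 + 2 * h) i = alpha_pow (- ((1 + 2 * h) * i))] (mod N)"
proof -
  have "(of_int (3 * (alpha_pow (- 1) * T (1 + 2 * h) i - alpha_pow (- ((1 + 2 * h) * i)))) :: rat) =
    of_int (2 * h ^ 2 * (3 * i + 12 * h - 18 * h * tri i + 2 * h * i - 24 * h ^ 2 * tri i - 16 * h ^ 2 * i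
      + 48 * h ^ 3 * tri i - 24 * h ^ 3 * i + 48 * h ^ 4 * tri i - 32 * h ^ 4 * i - 32 * (h ^ 2 * h ^ 3) * i))"
    by (simp add: T_def alpha_pow_def tri_rat tet_rat,
        simp add: field_simps eval_nat_numeral)
  then have "3 * (alpha_pow (- 1) * T (1 + 2 * h) i - alpha_pow (- ((1 + 2 * h) * i))) =
    2 * h ^ 2 * (3 * i + 12 * h - 18 * h * tri i + 2 * h * i - 24 * h ^ 2 * tri i - 16 * h ^ 2 * i
      + 48 * h ^ 3 * tri i - 24 * h ^ 3 * i + 48 * h ^ 4 * tri i - 32 * h ^ 4 * i - 32 * (h ^ 2 * h ^ 3) * i)"
    by (simp only: of_int_eq_iff)
  moreover have "N dvd 2 * h ^ 2" by (simp add: N_def h_def power_mult_distrib)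
  ultimately have "N dvd 3 * (alpha_pow (- 1) * T (1 + 2 * h) i - alpha_pow (- ((1 + 2 * h) * i)))" by simp
  then show ?thesis using coprime_3_N
    by (metis cong_iff_dvd_diff coprime_commute coprime_dvd_mult_right_iff)
qed

text \<open>Here the oddness of \<open>l\<close> enters: \<open>h - s = s (l - 1)\<close> is a multiple of \<open>2 s\<close>.\<close>

lemma N_dvd_s_h: "N dvd x \<Longrightarrow> [h * x = s * x] (mod D)"
proof -
  assume "N dvd x"
  then obtain y where y: "x = 2 * s ^ 2 * y" by (auto simp: N_def)
  obtain k where k: "l - 1 = 2 * k" using odd_l by (auto elim: oddE)
  have "h * x - s * x = 2 * s ^ 3 * y * (l - 1)"
    by (simp add: y h_def algebra_simps power2_eq_square power3_eq_cube)
  also have "\<dots> = 4 * s ^ 3 * (k * y)" by (simp add: k)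
  finally have "h * x - s * x = 4 * s ^ 3 * (k * y)" .
  then show ?thesis by (simp add: D_def cong_iff_dvd_diff)
qed

text \<open>The numerical content of the relation \<open>C B = B\<^sup>\<alpha> C\<close>. Right multiplication of
  \<open>C\<^sup>k B\<^sup>j A\<^sup>i\<close> by the two sides yields triples of exponents that differ in all three places. By \<open>K_alpha\<close> and \<open>T_alpha\<close> the first two differences are
  multiples of \<open>N\<close>, and the present congruence says that the relations \<open>C\<^sup>N = A\<^sup>s\<^sup>N\<close> and
  \<open>B\<^sup>N = A\<^sup>-\<^sup>N\<close> carry them over to the third one.\<close>

lemma B_alpha_shift:
  "[(1 + 2 * h) * F (1 + 2 * h) i - alpha_sum ((1 + 2 * h) * i) =
    alpha_pow (- 1) * T (1 + 2 * h) i - alpha_pow (- ((1 + 2 * h) * i)) + s * (K (1 + 2 * h) i - (1 + 2 * h) * i)] (mod D)"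
proof -
  let ?a = "1 + 2 * h"
  have "(of_int (3 * ((?a * F ?a i - alpha_sum (?a * i)) -
      (alpha_pow (- 1) * T ?a i - alpha_pow (- (?a * i)) + h * (K ?a i - ?a * i)))) :: rat) =
    of_int (4 * h ^ 3 * (- 6 + 11 * tri i + i * tri i + 23 * h * tri i + 2 * h * i
      + 5 * h * i * tri i - 11 * h ^ 2 * tri i + 8 * h ^ 2 * i + 4 * h ^ 2 * i * tri i
      - 24 * h ^ 3 * tri i + 16 * h ^ 3 * i - 4 * h ^ 3 * i * tri i + 4 * h ^ 4 * tri i + 16 * h ^ 4 * i))"
    by (simp add: K_def F_def Y_def T_def alpha_pow_def alpha_sum_def tri_rat tet_rat,
        simp add: field_simps power2_eq_square power3_eq_cube power4_eq_xxxx)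
  then have "[?a * F ?a i - alpha_sum (?a * i) =
      alpha_pow (- 1) * T ?a i - alpha_pow (- (?a * i)) + h * (K ?a i - ?a * i)] (mod D)"
    unfolding of_int_eq_iff by (rule cong_D_I3)
  also have "[alpha_pow (- 1) * T ?a i - alpha_pow (- (?a * i)) + h * (K ?a i - ?a * i) =
      alpha_pow (- 1) * T ?a i - alpha_pow (- (?a * i)) + s * (K ?a i - ?a * i)] (mod D)"
    using N_dvd_s_h[of "K ?a i - ?a * i"] K_alpha[of i]
    by (intro cong_add cong_refl) (simp add: cong_iff_dvd_diff)
  finally show ?thesis .
qed

lemma D_def_s: "D = s * (2 * N)" and N_def_s: "N = s * (2 * s)"
  by (simp_all add: D_def N_def power2_eq_square power3_eq_cube)

lemma alpha_pow_cong_N: assumes "[x = y] (mod N)" shows "[alpha_pow x = alpha_pow y] (mod D)"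
proof -
  obtain t where t: "x = y + 2 * s ^ 2 * t"
    using assms by (metis N_def add.commute cong_iff_lin cong_sym mult.commute)
  have "alpha_pow x - alpha_pow y = 4 * s ^ 3 * (l * t + s * l ^ 2 * t * (2 * y - 1 + 2 * s ^ 2 * t))"
    by (simp add: t alpha_pow_def h_def algebra_simps power2_eq_square power3_eq_cube)
  then show ?thesis by (simp add: D_def cong_iff_dvd_diff)
qed

text \<open>The defect \<open>s w\<close> of periodicity is what forces \<open>C\<^sup>N\<close> to be nontrivial, see \<open>C_pow_N\<close>.\<close>

lemma alpha_sum_cong_N: assumes "N dvd w" shows "[alpha_sum (i + w) = alpha_sum i + w + s * w] (mod D)"
proof -
  obtain t where t: "w = 2 * s ^ 2 * t" using assms by (auto simp: N_def)
  define x where "x = i + w"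
  have tri_x: "tri x = tri i + s ^ 2 * t * (2 * i + 1 + w)"
    using tri_double[of x] tri_double[of i] by (simp add: t x_def algebra_simps)
  have "3 * (alpha_sum x - (alpha_sum i + w + h * w)) =
      6 * h * (tri x - tri i) + 4 * h ^ 2 * (3 * tet x - 3 * tet i) - 3 * h * w"
    by (simp add: alpha_sum_def x_def algebra_simps)
  also have "\<dots> = 4 * s ^ 3 * (l * (3 * t * i + 3 * s ^ 2 * t * t)
     + s * l ^ 2 * t * ((2 * i + 1 + w) * (i - 1 + w) + 2 * tri i))"
    unfolding tet_times_3 tri_x
    by (simp add: x_def t h_def algebra_simps power2_eq_square power3_eq_cube)
  finally have "3 * (alpha_sum (i + w) - (alpha_sum i + w + h * w)) = 4 * s ^ 3 * (l * (3 * t * i + 3 * s ^ 2 * t * t)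
     + s * l ^ 2 * t * ((2 * i + 1 + w) * (i - 1 + w) + 2 * tri i))"
    by (simp only: x_def)
  then have "D dvd 3 * (alpha_sum (i + w) - (alpha_sum i + w + h * w))" by (simp add: D_def)
  then have "[alpha_sum (i + w) = alpha_sum i + w + h * w] (mod D)"
    using coprime_3_D by (metis cong_iff_dvd_diff coprime_commute coprime_dvd_mult_right_iff)
  then show ?thesis
    using N_dvd_s_h[OF assms] by (meson cong_add_lcancel cong_trans)
qed

lemma alpha_pow_minus_sum: "[alpha_pow (1 + 2 * h) - alpha_sum (1 + 2 * h) * alpha_pow (- 1) = 2 * h ^ 2] (mod D)"
proof -
  have "(of_int (3 * (alpha_pow (1 + 2 * h) - alpha_sum (1 + 2 * h) * alpha_pow (- 1) - 2 * h ^ 2)) :: rat) =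
    of_int (4 * h ^ 3 * (- 5 - 8 * h - 12 * h ^ 2 - 16 * h ^ 3 - 16 * h ^ 4))"
    by (simp add: alpha_pow_def alpha_sum_def tri_rat tet_rat,
        simp add: field_simps power2_eq_square power3_eq_cube power4_eq_xxxx)
  then show ?thesis unfolding of_int_eq_iff by (rule cong_D_I3)
qed

lemma alpha_sum_minus_alpha: "[- (1 + 2 * h) - alpha_sum (- (1 + 2 * h)) = - 2 * h ^ 2] (mod D)"
proof -
  have "(of_int (3 * (- (1 + 2 * h) - alpha_sum (- (1 + 2 * h)) - - 2 * h ^ 2)) :: rat) =
    of_int (4 * h ^ 3 * (- 1 + 6 * h + 4 * h ^ 2))"
    by (simp add: alpha_sum_def tri_rat tet_rat, simp add: field_simps power2_eq_square power3_eq_cube)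
  then show ?thesis unfolding of_int_eq_iff by (rule cong_D_I3)
qed

lemma odd_inverse_mod_D: "odd x \<Longrightarrow> \<exists>y. [x * y = 1] (mod D)"
  by (rule cong_solve_coprime_int) (simp flip: power_D)

lemma N_dvd_D: "N dvd D" and two_N_dvd_D: "2 * N dvd D"
  by (simp_all add: N_def D_def power2_eq_square power3_eq_cube)

lemma D_tri_tet: "2 * s ^ 3 dvd tri (D - 1)" "2 * s ^ 3 dvd tet (D - 1)"
proof -
  define Q where "Q = 2 * s ^ 3"
  have DQ: "D = 2 * Q" by (simp add: D_def Q_def)
  have "tri (D - 1) = Q * (D - 1)"
    using tri_double[of "D - 1"] by (simp add: DQ algebra_simps)
  then show 1: "2 * s ^ 3 dvd tri (D - 1)" by (simp add: Q_def)
  then have "Q dvd 3 * tet (D - 1)" unfolding tet_times_3 Q_def by simp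
  then show "2 * s ^ 3 dvd tet (D - 1)"
    using coprime_3_D unfolding DQ Q_def[symmetric]
    by (metis coprime_commute coprime_dvd_mult_right_iff coprime_mult_right_iff)
qed

lemma D_values: "[K D i = 0] (mod 2 * N)" "[T D i = 0] (mod D)" "[F D i = i] (mod D)"
proof -
  define Q where "Q = 2 * s ^ 3"
  have DQ: "D = 2 * Q" by (simp add: D_def Q_def)
  have "tri D = tri (D - 1) + D" "tet D = tet (D - 1) + tri (D - 1)"
    using tri_Suc[of "D - 1"] tet_Suc[of "D - 1"] by simp_all
  then have "Q dvd tri (D - 1)" "Q dvd tri D" "Q dvd tet (D - 1)" "Q dvd tet D"
    using D_tri_tet unfolding DQ Q_def by simp_all
  then obtain a b c d where w: "tri (D - 1) = Q * a" "tri D = Q * b" "tet (D - 1) = Q * c" "tet D = Q * d"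
    by (meson dvdE)
  have "K D i = D * (i + h * (a * tri i) + h ^ 2 * c * tri i * (2 * i + 1))"
    by (simp add: K_def w) (simp add: DQ algebra_simps)
  then show "[K D i = 0] (mod 2 * N)"
    using two_N_dvd_D by (simp add: cong_0_iff)
  have "T D i = D * (1 - h * i * b + 2 * h ^ 2 * tri i * b - 2 * h ^ 2 * i * d)"
    by (simp add: T_def w) (simp add: DQ algebra_simps)
  then show "[T D i = 0] (mod D)" by (simp add: cong_0_iff)
  have "F D i - i = D * (2 * h * tri i + 4 * h ^ 2 * tet i + h ^ 2 * a * tri i * (2 * i + 1) + h ^ 3 * tri i * c)"
    by (simp add: F_def Y_def w) (simp add: DQ algebra_simps power2_eq_square power3_eq_cube)
  then show "[F D i = i] (mod D)" by (simp add: cong_iff_dvd_diff)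
qed

end

section \<open>Groups satisfying the relations of \<open>J\<close>\<close>

text \<open>Cancellation in a group turns an induction step into an equivalence, and then one step
  covers both directions on the integers.\<close>

lemma int_iff_induct:
  assumes "P (0::int)" "\<And>k. P k \<longleftrightarrow> P (k + 1)"
  shows "P k"
proof (induction k rule: int_induct[of _ 0])
  case (step2 i)
  then show ?case using assms(2)[of "i - 1"] by simp
qed (use assms in auto)

lemma (in group) int_pow_commute_through:
  assumes "x \<in> carrier G" "y \<in> carrier G" "z \<in> carrier G" "x \<otimes> y = y \<otimes> z"
  shows "x [^] (n::int) \<otimes> y = y \<otimes> z [^] n"
proof (induction n rule: int_iff_induct)
  case (2 k)
  have "x [^] (k + 1) \<otimes> y = x [^] k \<otimes> (y \<otimes> z)"
    using assms by (simp add: int_pow_mult m_assoc)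
  also have "\<dots> = x [^] k \<otimes> y \<otimes> z" using assms by (simp add: m_assoc)
  finally have *: "x [^] (k + 1) \<otimes> y = x [^] k \<otimes> y \<otimes> z" .
  have **: "y \<otimes> z [^] (k + 1) = y \<otimes> z [^] k \<otimes> z"
    using assms by (simp add: int_pow_mult m_assoc)
  show ?case unfolding * ** using assms by simp
qed (use assms in simp)

lemma (in group) int_pow_commute_closed:
  assumes "x \<in> carrier G" "y \<in> carrier G" "x \<otimes> y = y \<otimes> x"
  shows "x [^] (n::int) \<otimes> y [^] (k::int) = y [^] k \<otimes> x [^] n"
  using int_pow_commute_through[of x "y [^] k" x n] int_pow_commute_through[of y x y k] assms by simp

lemma (in group) int_pow_mult': "x \<in> carrier G \<Longrightarrow> x [^] (i::int) \<otimes> x [^] (j::int) = x [^] (i + j)"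
  by (simp add: int_pow_mult)

lemma (in group) int_pow_mult_left:
  "\<lbrakk>x \<in> carrier G; y \<in> carrier G\<rbrakk> \<Longrightarrow> x [^] (i::int) \<otimes> (x [^] (j::int) \<otimes> y) = x [^] (i + j) \<otimes> y"
  by (simp add: int_pow_mult m_assoc)

text \<open>A group with a marked pair that satisfies the relations. The pair is arbitrary because
  the same facts are needed for \<open>(B, A)\<close>, for pairs of permutations, and for the images of \<open>(A, B)\<close> under
  automorphisms.\<close>

locale J_rel = group G + scale m l for G (structure) and m :: nat and l :: int +
  fixes A B :: 'a
  assumes A_closed [simp]: "A \<in> carrier G" and B_closed [simp]: "B \<in> carrier G"
    and A_rel: "gconj G A (gcomm G A B) = A [^] (1 + 2 ^ m * l)"
    and B_rel: "gconj G B (gcomm G B A) = B [^] (1 + 2 ^ m * l)"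
    and A_ord: "A [^] ((2::nat) ^ (3 * m - 1)) = \<one>"
    and B_ord: "B [^] ((2::nat) ^ (3 * m - 1)) = \<one>"
begin

definition C :: 'a where "C = gcomm G A B"

lemma C_closed [simp]: "C \<in> carrier G"
  by (simp add: C_def gcomm_def)

text \<open>The relations are symmetric in \<open>A\<close> and \<open>B\<close>, with \<open>C\<close> becoming \<open>C\<^sup>-\<^sup>1\<close>. Every fact about
  \<open>A\<close> thus has a mirror image about \<open>B\<close>.\<close>

lemma swap: "J_rel G m l B A"
  by unfold_locales (fact A_closed B_closed A_rel B_rel A_ord B_ord)+

lemma C_swap: "gcomm G B A = inv C"
  by (simp add: C_def gcomm_def inv_mult_group m_assoc)

lemma exponent_alpha: "1 + 2 ^ m * l = 1 + 2 * h"
  by (simp add: power_m h_def)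

lemma A_B: "A \<otimes> B = B \<otimes> (A \<otimes> C)"
  by (simp add: C_def gcomm_def m_assoc inv_solve_left' r_inv inv_solve_left flip: m_assoc)

lemma A_C: "A \<otimes> C = C \<otimes> A [^] (1 + 2 * h)"
  using A_rel unfolding gconj_def C_def[symmetric] exponent_alpha
  by (metis A_closed C_closed inv_solve_left int_pow_closed m_assoc m_closed inv_closed)

lemma A_pow_D: "A [^] D = \<one>"
proof -
  have "D = int (2 ^ (3 * m - 1))" by (simp flip: power_D)
  then show ?thesis by (simp only: int_pow_int A_ord)
qed

lemma A_cong: assumes "[x = y] (mod D)" shows "A [^] x = A [^] y"
proof -
  obtain t where "y = x + D * t" using assms by (auto simp: cong_iff_lin)
  then show ?thesis by (simp add: int_pow_mult int_pow_pow[symmetric] A_pow_D)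
qed

lemma B_cong: "[x = y] (mod D) \<Longrightarrow> B [^] x = B [^] y"
  by (rule J_rel.A_cong[OF swap])

lemma A_pow_C_pow: "A [^] i \<otimes> C [^] k = C [^] k \<otimes> A [^] (i * alpha_pow k)"
proof -
  have "A \<otimes> C [^] k = C [^] k \<otimes> A [^] alpha_pow k"
  proof (induction k rule: int_iff_induct)
    case (2 k)
    have "A [^] alpha_pow k \<otimes> C = C \<otimes> (A [^] (1 + 2 * h)) [^] alpha_pow k"
      by (rule int_pow_commute_through) (simp_all add: A_C)
    also have "(A [^] (1 + 2 * h)) [^] alpha_pow k = A [^] alpha_pow (k + 1)"
      using A_cong[OF alpha_pow_add[of k 1]] by (simp add: int_pow_pow mult.commute)
    finally have "C [^] (k + 1) \<otimes> A [^] alpha_pow (k + 1) = C [^] k \<otimes> A [^] alpha_pow k \<otimes> C"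
      by (simp add: int_pow_mult m_assoc)
    moreover have "A \<otimes> C [^] (k + 1) = A \<otimes> C [^] k \<otimes> C"
      by (simp add: int_pow_mult m_assoc)
    ultimately show ?case by simp
  qed simp
  then show ?thesis
    by (simp add: int_pow_commute_through[of A "C [^] k" "A [^] alpha_pow k" i] int_pow_pow mult.commute)
qed

lemma B_pow_C_pow: "B [^] j \<otimes> C [^] k = C [^] k \<otimes> B [^] (j * alpha_pow (- k))"
proof -
  interpret sw: J_rel G m l B A by (rule swap)
  have "sw.C = inv C" unfolding sw.C_def by (rule C_swap)
  then show ?thesis using sw.A_pow_C_pow[of j "- k"] by (simp add: int_pow_inv int_pow_neg)
qed

lemma AC_pow: "(A \<otimes> C) [^] i = C [^] i \<otimes> A [^] alpha_sum i"
proof (induction i rule: int_iff_induct)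
  case 1
  then show ?case by (simp add: alpha_sum_def)
next
  case (2 i)
  have "C [^] i \<otimes> A [^] alpha_sum i \<otimes> (A \<otimes> C) = C [^] i \<otimes> (A [^] (alpha_sum i + 1) \<otimes> C [^] (1::int))"
    by (simp add: int_pow_mult m_assoc)
  also have "\<dots> = C [^] (i + 1) \<otimes> A [^] ((alpha_sum i + 1) * (1 + 2 * h))"
    unfolding A_pow_C_pow by (simp add: int_pow_mult m_assoc)
  also have "A [^] ((alpha_sum i + 1) * (1 + 2 * h)) = A [^] alpha_sum (i + 1)"
    using alpha_sum_Suc[of i] by (intro A_cong) (simp add: cong_sym_eq mult.commute)
  finally have "C [^] (i + 1) \<otimes> A [^] alpha_sum (i + 1) = C [^] i \<otimes> A [^] alpha_sum i \<otimes> (A \<otimes> C)" ..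
  moreover have "(A \<otimes> C) [^] (i + 1) = (A \<otimes> C) [^] i \<otimes> (A \<otimes> C)"
    by (simp add: int_pow_mult m_assoc)
  ultimately show ?case by simp
qed

text \<open>Conjugation by \<open>B\<close> maps \<open>A\<close> to \<open>A C\<close>, and \<open>C\<close> acts on \<open>A\<close> as raising to the power \<open>\<alpha>\<close>.\<close>

lemma A_pow_B: "A [^] i \<otimes> B = B \<otimes> (C [^] i \<otimes> A [^] alpha_sum i)"
  using int_pow_commute_through[of A B "A \<otimes> C" i] by (simp add: A_B AC_pow)

lemma B_pow_A: "B [^] j \<otimes> A = A \<otimes> (C [^] (- j) \<otimes> B [^] alpha_sum j)"
proof -
  interpret sw: J_rel G m l B A by (rule swap)
  have "sw.C = inv C" unfolding sw.C_def by (rule C_swap)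
  then show ?thesis using sw.A_pow_B[of j] by (simp add: int_pow_inv int_pow_neg)
qed

lemma C_pow_D: "C [^] D = \<one>"
proof -
  have "[alpha_sum (0 + D) = alpha_sum 0 + D + s * D] (mod D)"
    by (rule alpha_sum_cong_N) (simp add: D_def_s)
  then have "A [^] alpha_sum D = \<one>"
    using A_cong[of "alpha_sum D" 0] by (simp add: alpha_sum_def cong_0_iff cong_dvd_iff)
  then show ?thesis using A_pow_B[of D] by (simp add: A_pow_D)
qed

lemma C_cong: assumes "[x = y] (mod D)" shows "C [^] x = C [^] y"
proof -
  obtain t where "y = x + D * t" using assms by (auto simp: cong_iff_lin)
  then show ?thesis by (simp add: int_pow_mult int_pow_pow[symmetric] C_pow_D)
qed

text \<open>Both sides of \<open>C B = B\<^sup>\<alpha> C\<close> are multiplied by \<open>A\<^sup>-\<^sup>1\<close> on the left and rewritten as words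
  in the order \<open>C\<close>, \<open>B\<close>, \<open>A\<close>. The exponents of \<open>C\<close> agree, and what is left relates a power of \<open>B\<close> to a power of \<open>A\<close>.\<close>

lemma B_pow_h: "B [^] (2 * h ^ 2) = A [^] (- 2 * h ^ 2)"
proof -
  define a where "a = 1 + 2 * h"
  have CB: "C \<otimes> B = B [^] a \<otimes> C"
    using B_pow_C_pow[of a 1] B_cong[OF alpha_pow_add[of 1 "- 1"]] by (simp add: a_def mult.commute)
  \<comment> \<open>Moves \<open>A\<^sup>-\<^sup>1\<close> to the right of a power of \<open>B\<close>.\<close>
  have inv_A_B: "A [^] (- 1::int) \<otimes> B [^] j = C [^] (- j) \<otimes> B [^] alpha_sum j \<otimes> A [^] (- 1::int)" for j
  proof -
    have "B [^] j = A \<otimes> (C [^] (- j) \<otimes> B [^] alpha_sum j) \<otimes> inv A"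
      using B_pow_A[of j] by (simp add: inv_solve_right)
    then show ?thesis by (simp add: int_pow_neg m_assoc flip: m_assoc[of "inv A" A])
  qed
  have "A [^] (- 1::int) \<otimes> (C \<otimes> B) = A [^] (- 1::int) \<otimes> C [^] (1::int) \<otimes> B"
    by (simp add: m_assoc)
  also have "\<dots> = C \<otimes> (A [^] (- a) \<otimes> B)"
    unfolding A_pow_C_pow by (simp add: m_assoc a_def)
  also have "\<dots> = C \<otimes> (B [^] (1::int) \<otimes> C [^] (- a)) \<otimes> A [^] alpha_sum (- a)"
    unfolding A_pow_B by (simp add: m_assoc)
  also have "\<dots> = C [^] (1 - a) \<otimes> (B [^] alpha_pow a \<otimes> A [^] alpha_sum (- a))"
    unfolding B_pow_C_pow by (simp add: m_assoc int_pow_diff int_pow_neg)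
  finally have l: "A [^] (- 1::int) \<otimes> (C \<otimes> B) = C [^] (1 - a) \<otimes> (B [^] alpha_pow a \<otimes> A [^] alpha_sum (- a))" .
  have "A [^] (- 1::int) \<otimes> (B [^] a \<otimes> C) = C [^] (- a) \<otimes> (B [^] alpha_sum a \<otimes> (A [^] (- 1::int) \<otimes> C [^] (1::int)))"
    using inv_A_B[of a] by (simp add: m_assoc flip: m_assoc[of "A [^] (- 1::int)" "B [^] a"])
  also have "\<dots> = C [^] (- a) \<otimes> ((B [^] alpha_sum a \<otimes> C [^] (1::int)) \<otimes> A [^] (- a))"
    unfolding A_pow_C_pow by (simp add: m_assoc a_def)
  also have "\<dots> = C [^] (1 - a) \<otimes> (B [^] (alpha_sum a * alpha_pow (- 1)) \<otimes> A [^] (- a))"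
    unfolding B_pow_C_pow using int_pow_mult_left[of C _ "- a" 1] by (simp add: m_assoc)
  finally have "B [^] alpha_pow a \<otimes> A [^] alpha_sum (- a) = B [^] (alpha_sum a * alpha_pow (- 1)) \<otimes> A [^] (- a)"
    using l by (simp add: CB)
  then have "B [^] (- (alpha_sum a * alpha_pow (- 1))) \<otimes> (B [^] alpha_pow a \<otimes> A [^] alpha_sum (- a)) \<otimes> A [^] (- alpha_sum (- a)) =
      B [^] (- (alpha_sum a * alpha_pow (- 1))) \<otimes> (B [^] (alpha_sum a * alpha_pow (- 1)) \<otimes> A [^] (- a)) \<otimes> A [^] (- alpha_sum (- a))"
    by simp
  then have *: "B [^] (alpha_pow a - alpha_sum a * alpha_pow (- 1)) = A [^] (- a - alpha_sum (- a))"
    by (simp add: m_assoc int_pow_mult_left int_pow_mult')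
  show ?thesis
    using * A_cong[OF alpha_sum_minus_alpha] B_cong[OF alpha_pow_minus_sum] by (simp add: a_def)
qed

text \<open>Since \<open>2 h\<^sup>2 = N l\<^sup>2\<close> and \<open>l\<close> is invertible modulo \<open>D\<close>, the factor \<open>l\<^sup>2\<close> can be removed.\<close>

lemma B_pow_N: "B [^] (N * x) = A [^] (- (N * x))"
proof -
  obtain y where y: "[l ^ 2 * y = 1] (mod D)"
    using odd_inverse_mod_D[of "l ^ 2"] odd_l by auto
  \<comment> \<open>\<open>y\<close> is an inverse of \<open>l\<^sup>2\<close>, so \<open>N x\<close> is a multiple of \<open>2 h\<^sup>2\<close> modulo \<open>D\<close>.\<close>
  have "2 * h ^ 2 * (y * x) = N * x * (l ^ 2 * y)"
    by (simp add: h_def N_def power_mult_distrib mult_ac)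
  also have "[\<dots> = N * x * 1] (mod D)" by (intro cong_scalar_left y)
  finally have c: "[N * x = 2 * h ^ 2 * (y * x)] (mod D)" by (simp add: cong_sym_eq)
  have "B [^] (N * x) = (B [^] (2 * h ^ 2)) [^] (y * x)"
    by (simp only: B_cong[OF c] int_pow_pow B_closed)
  also have "\<dots> = A [^] (- (2 * h ^ 2 * (y * x)))"
    unfolding B_pow_h by (simp add: int_pow_pow)
  also have "\<dots> = A [^] (- (N * x))"
    using c by (intro A_cong) (simp add: cong_minus_minus_iff cong_sym_eq)
  finally show ?thesis .
qed

lemma A_pow_N_B: "A [^] (N * x) \<otimes> B = B \<otimes> A [^] (N * x)"
  using B_pow_N[of "- x"] int_pow_commute_closed[of B B "- (N * x)" 1] by simp

lemma A_pow_N_C: "A [^] (N * x) \<otimes> C = C \<otimes> A [^] (N * x)"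
proof -
  have "[N * x * alpha_pow 1 = N * x] (mod D)"
    by (simp add: D_def N_def cong_iff_dvd_diff h_def power2_eq_square power3_eq_cube algebra_simps)
  then show ?thesis using A_pow_C_pow[of "N * x" 1] A_cong by simp
qed

text \<open>The element \<open>A\<^sup>N\<^sup>x\<close> is a power of \<open>B\<close> and commutes with \<open>B\<close>; comparing this with
  \<open>A_pow_B\<close> determines \<open>C\<^sup>N\<^sup>x\<close>.\<close>

lemma C_pow_N: "C [^] (N * x) = A [^] (s * N * x)"
proof -
  have "C [^] (N * x) \<otimes> A [^] alpha_sum (N * x) = A [^] (N * x)"
    using A_pow_B[of "N * x"] by (simp add: A_pow_N_B)
  then have "C [^] (N * x) = A [^] (N * x - alpha_sum (N * x))"
    by (simp add: int_pow_diff inv_solve_right)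
  also have "\<dots> = A [^] (s * N * x)"
  proof (rule A_cong)
    have "[alpha_sum (0 + N * x) = alpha_sum 0 + N * x + s * (N * x)] (mod D)" by (rule alpha_sum_cong_N) simp
    then have "[N * x - alpha_sum (N * x) = N * x - (N * x + s * (N * x))] (mod D)"
      by (intro cong_diff cong_refl) (simp add: alpha_sum_def)
    also have "[N * x - (N * x + s * (N * x)) = s * N * x] (mod D)"
      by (simp add: cong_iff_dvd_diff D_def N_def power2_eq_square power3_eq_cube)
    finally show "[N * x - alpha_sum (N * x) = s * N * x] (mod D)" .
  qed
  finally show ?thesis .
qed

definition E :: "int \<Rightarrow> int \<Rightarrow> int \<Rightarrow> 'a" where
  "E k j i = C [^] k \<otimes> (B [^] j \<otimes> A [^] i)"

lemma E_closed [simp]: "E k j i \<in> carrier G"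
  by (simp add: E_def)

lemma E_A_pow: "E k j i \<otimes> A [^] n = E k j (i + n)"
  by (simp add: E_def m_assoc int_pow_mult')

lemma E_B: "E k j i \<otimes> B = E (k + i) ((j + 1) * alpha_pow (- i)) (alpha_sum i)"
proof -
  have "E k j i \<otimes> B = C [^] k \<otimes> (B [^] (j + 1) \<otimes> C [^] i) \<otimes> A [^] alpha_sum i"
    by (simp add: E_def m_assoc A_pow_B int_pow_mult)
  then show ?thesis unfolding B_pow_C_pow by (simp add: E_def m_assoc int_pow_mult_left)
qed

lemma B_E: "B \<otimes> E k j i = E k (alpha_pow (- k) + j) i"
proof -
  have "B \<otimes> E k j i = (B [^] (1::int) \<otimes> C [^] k) \<otimes> (B [^] j \<otimes> A [^] i)"
    by (simp add: E_def m_assoc)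
  then show ?thesis unfolding B_pow_C_pow by (simp add: E_def m_assoc int_pow_mult_left)
qed

text \<open>Normal forms are stable under right multiplication by \<open>A\<close>, \<open>A\<^sup>-\<^sup>1\<close> and \<open>B\<close>, hence
  also by \<open>B\<^sup>-\<^sup>1\<close>, which is a positive power of \<open>B\<close>.\<close>

lemma generated_normal_form:
  assumes "g \<in> generate G {A, B}"
  shows "\<exists>k j i. g = E k j i"
proof -
  have A: "\<exists>k' j' i'. E k j i \<otimes> A = E k' j' i'" "\<exists>k' j' i'. E k j i \<otimes> inv A = E k' j' i'" for k j i
    using E_A_pow[of k j i 1] E_A_pow[of k j i "- 1"] by (auto simp: int_pow_neg)
  have B: "\<exists>k' j' i'. E k j i \<otimes> B = E k' j' i'" for k j i
    unfolding E_B by blast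
  have B_nat: "\<exists>k' j' i'. E k j i \<otimes> B [^] (n::nat) = E k' j' i'" for k j i n
  proof (induction n)
    case (Suc n)
    have "E k j i \<otimes> B [^] Suc n = (E k j i \<otimes> B [^] n) \<otimes> B" by (simp add: m_assoc)
    then show ?case using Suc B by metis
  qed auto
  have "inv B = B [^] (nat (D - 1))"
    using B_cong[of "- 1" "D - 1"] s_pos
    by (simp add: int_pow_neg cong_iff_dvd_diff D_def flip: int_pow_int)
  then have B': "\<exists>k' j' i'. E k j i \<otimes> inv B = E k' j' i'" for k j i
    using B_nat by metis
  have "\<exists>k' j' i'. E k j i \<otimes> g = E k' j' i'" for k j i
    using assms
  proof (induction arbitrary: k j i)
    case (eng h1 h2)
    have h: "h1 \<in> carrier G" "h2 \<in> carrier G"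
      using eng generate_in_carrier[of "{A, B}"] by auto
    obtain k1 j1 i1 where "E k j i \<otimes> h1 = E k1 j1 i1" using eng by blast
    moreover obtain k2 j2 i2 where "E k1 j1 i1 \<otimes> h2 = E k2 j2 i2" using eng by blast
    ultimately have "E k j i \<otimes> (h1 \<otimes> h2) = E k2 j2 i2" using h by (simp flip: m_assoc)
    then show ?case by blast
  qed (use A B B' in auto)
  from this[of 0 0 0] show ?thesis
    using generate_in_carrier[OF _ assms] by (simp add: E_def)
qed

end

section \<open>A permutation representation\<close>

type_synonym point = "int \<times> int \<times> int"

context scale
begin

text \<open>Equality of the triples modulo the lattice spanned by \<open>(0, N, N)\<close>, \<open>(N, 0, s N)\<close> and
  \<open>(0, 0, D)\<close>, that is, modulo the known relations \<open>B\<^sup>N A\<^sup>N = 1\<close>, \<open>C\<^sup>N = A\<^sup>s\<^sup>N\<close> and \<open>A\<^sup>D = 1\<close>. The point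
  \<open>(k, j, i)\<close> stands for \<open>C\<^sup>k B\<^sup>j A\<^sup>i\<close>, and \<open>reduce\<close> chooses representatives.\<close>

fun same_point :: "point \<Rightarrow> point \<Rightarrow> bool" where
  "same_point (k, j, i) (k', j', i') \<longleftrightarrow>
    [k = k'] (mod N) \<and> [j = j'] (mod N) \<and> [i - j - s * k = i' - j' - s * k'] (mod D)"

fun reduce :: "point \<Rightarrow> point" where
  "reduce (k, j, i) = (k mod N, j mod N, (i - (j - j mod N) - s * (k - k mod N)) mod D)"

lemma reduce_eq_iff: "reduce v = reduce w \<longleftrightarrow> same_point v w"
proof (cases v; cases w)
  fix k j i k' j' i' assume vw: "v = (k, j, i)" "w = (k', j', i')"
  have e: "i - (j - j mod N) - s * (k - k mod N) = (i - j - s * k) + (j mod N + s * (k mod N))" for i j k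
    by (simp add: algebra_simps)
  show ?thesis
  proof (cases "k mod N = k' mod N \<and> j mod N = j' mod N")
    case True
    then show ?thesis
      unfolding vw reduce.simps same_point.simps e
      using cong_add_rcancel[of "i - j - s * k" "j mod N + s * (k mod N)" "i' - j' - s * k'" D]
      by (simp add: cong_def)
  qed (auto simp: vw cong_def)
qed

lemma same_point_refl: "same_point v v" by (cases v) simp

lemma same_point_sym: "same_point v w \<Longrightarrow> same_point w v"
  by (simp flip: reduce_eq_iff)

lemma same_point_trans: "same_point v w \<Longrightarrow> same_point w u \<Longrightarrow> same_point v u"
  by (simp flip: reduce_eq_iff)

lemma reduce_reduce [simp]: "reduce (reduce v) = reduce v"
proof -
  obtain k j i where v: "v = (k, j, i)" by (cases v) auto
  have "[(i - (j - j mod N) - s * (k - k mod N)) mod D - j mod N - s * (k mod N) =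
      (i - (j - j mod N) - s * (k - k mod N)) - j mod N - s * (k mod N)] (mod D)"
    by (intro cong_diff cong_refl) (simp add: cong_def)
  then have "same_point (reduce v) v" by (simp add: v cong_def algebra_simps)
  then show ?thesis by (simp add: reduce_eq_iff)
qed

lemma same_point_reduce_left: "same_point (reduce v) v" by (simp flip: reduce_eq_iff)

lemma N_pos: "N > 0" and D_pos: "D > 0"
  using s_pos by (simp_all add: N_def D_def)

definition S :: "point set" where "S = range reduce"

lemma finite_S: "finite S"
proof (rule finite_subset)
  show "S \<subseteq> {0..<N} \<times> {0..<N} \<times> {0..<D}" using N_pos D_pos by (auto simp: S_def)
qed simp

definition induced :: "(point \<Rightarrow> point) \<Rightarrow> point \<Rightarrow> point" where
  "induced f = (\<lambda>v\<in>S. reduce (f v))"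

lemma reduce_in_S [simp]: "reduce v \<in> S" by (simp add: S_def)

lemma S_reduce: "v \<in> S \<Longrightarrow> reduce v = v" by (auto simp: S_def)

lemma induced_in_S: "v \<in> S \<Longrightarrow> induced f v \<in> S" by (simp add: induced_def)

lemma same_point_imp_N_dvd: "same_point (k, j, i) (k', j', i') \<Longrightarrow> [i = i'] (mod N)"
proof -
  assume r: "same_point (k, j, i) (k', j', i')"
  then have "[i - j - s * k + (j + s * k) = i' - j' - s * k' + (j' + s * k')] (mod N)"
    using N_dvd_D by (intro cong_add cong_mult cong_refl) (auto intro: cong_dvd_modulus)
  then show ?thesis by simp
qed

definition stable :: "(point \<Rightarrow> point) \<Rightarrow> bool" where
  "stable f \<longleftrightarrow> (\<forall>v w. same_point v w \<longrightarrow> same_point (f v) (f w))"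

lemma reduce_stable: "stable f \<Longrightarrow> reduce (f (reduce v)) = reduce (f v)"
  unfolding reduce_eq_iff stable_def using same_point_reduce_left by blast

text \<open>Up to \<open>same_point\<close>, the map \<open>f n\<close> is to be the \<open>n\<close>-th iterate of \<open>f 1\<close>. Negative \<open>n\<close> are
  included, which makes \<open>f 1\<close> invertible.\<close>

definition flow :: "(int \<Rightarrow> point \<Rightarrow> point) \<Rightarrow> bool" where
  "flow f \<longleftrightarrow> stable (f 1) \<and> (\<forall>v. same_point (f 0 v) v) \<and> (\<forall>n v. same_point (f (n + 1) v) (f 1 (f n v)))"

text \<open>The map \<open>f (- 1)\<close> provides preimages, and a surjection of a finite set is bijective.\<close>

lemma flow_Bij:
  assumes "flow f"
  shows "induced (f 1) \<in> carrier (BijGroup S)"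
proof -
  have "induced (f 1) (induced (f (- 1)) v) = v" if v: "v \<in> S" for v
  proof -
    have "same_point (f (- 1 + 1) v) (f 1 (f (- 1) v))" using assms unfolding flow_def by blast
    then have "reduce (f 1 (f (- 1) v)) = reduce (f 0 v)" by (simp add: reduce_eq_iff same_point_sym)
    also have "\<dots> = v" using assms S_reduce[OF v] by (metis flow_def reduce_eq_iff)
    finally show ?thesis using v assms by (simp add: induced_def reduce_stable flow_def)
  qed
  then have "induced (f 1) ` S = S"
    by (metis (no_types, lifting) induced_in_S image_eqI image_subsetI subsetI subset_antisym)
  then have "bij_betw (induced (f 1)) S S"
    using finite_S by (simp add: bij_betw_def eq_card_imp_inj_on)
  then show ?thesis by (simp add: BijGroup_def Bij_def induced_def)
qed

lemma BijGroup_mult_apply: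
  "f \<in> carrier (BijGroup S) \<Longrightarrow> g \<in> carrier (BijGroup S) \<Longrightarrow> v \<in> S \<Longrightarrow>
    (f \<otimes>\<^bsub>BijGroup S\<^esub> g) v = f (g v)"
  by (simp add: BijGroup_def compose_def)

lemma BijGroup_apply_closed: "f \<in> carrier (BijGroup S) \<Longrightarrow> v \<in> S \<Longrightarrow> f v \<in> S"
  by (auto simp: BijGroup_def Bij_def bij_betw_def)

lemma BijGroup_eqI:
  "f \<in> carrier (BijGroup S) \<Longrightarrow> g \<in> carrier (BijGroup S) \<Longrightarrow> (\<And>v. v \<in> S \<Longrightarrow> f v = g v) \<Longrightarrow> f = g"
  by (auto simp: BijGroup_def Bij_def intro: extensionalityI)

lemma flow_Suc_reduce:
  assumes "flow f"
  shows "reduce (f (n + 1) v) = induced (f 1) (reduce (f n v))"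
proof -
  have "reduce (f (n + 1) v) = reduce (f 1 (f n v))"
    using assms unfolding flow_def reduce_eq_iff by blast
  then show ?thesis using assms by (simp add: induced_def reduce_stable flow_def)
qed

lemma flow_stable:
  assumes f: "flow f"
  shows "stable (f n)"
  unfolding stable_def
proof (intro allI impI)
  fix v w assume vw: "same_point v w"
  have inj: "inj_on (induced (f 1)) S"
    using flow_Bij[OF f] by (simp add: BijGroup_def Bij_def bij_betw_def)
  have "reduce (f n v) = reduce (f n w)"
  proof (induction n rule: int_iff_induct)
    case 1
    then show ?case using vw f unfolding flow_def reduce_eq_iff by (meson same_point_sym same_point_trans)
  next
    case (2 k)
    then show ?case unfolding flow_Suc_reduce[OF f] using inj by (simp add: inj_on_eq_iff)
  qed
  then show "same_point (f n v) (f n w)" by (simp add: reduce_eq_iff)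
qed

lemma flow_pow:
  assumes f: "flow f" and v: "v \<in> S"
  shows "(induced (f 1) [^]\<^bsub>BijGroup S\<^esub> n) v = reduce (f n v)"
proof -
  interpret H: group "BijGroup S" by (rule group_BijGroup)
  let ?g = "induced (f 1)"
  note g = flow_Bij[OF f]
  have "\<forall>v\<in>S. (?g [^]\<^bsub>BijGroup S\<^esub> n) v = reduce (f n v)"
  proof (induction n rule: int_iff_induct)
    case 1
    then show ?case using f by (auto simp: BijGroup_def flow_def reduce_eq_iff S_reduce)
        (metis S_reduce reduce_eq_iff)
  next
    case (2 k)
    have "(?g [^]\<^bsub>BijGroup S\<^esub> k) v = reduce (f k v) \<longleftrightarrow> (?g [^]\<^bsub>BijGroup S\<^esub> (k + 1)) v = reduce (f (k + 1) v)"
      if v: "v \<in> S" for v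
    proof -
      have 1: "?g [^]\<^bsub>BijGroup S\<^esub> (k + 1) = ?g \<otimes>\<^bsub>BijGroup S\<^esub> ?g [^]\<^bsub>BijGroup S\<^esub> k"
        using H.int_pow_mult[OF g, of 1 k] g by (simp add: add.commute)
      have "inj_on ?g S" using g by (simp add: BijGroup_def Bij_def bij_betw_def)
      then show ?thesis unfolding 1 flow_Suc_reduce[OF f]
        using g v by (simp add: BijGroup_mult_apply BijGroup_apply_closed inj_on_eq_iff)
    qed
    then show ?case by blast
  qed
  then show ?thesis using v by blast
qed

text \<open>Right multiplication of \<open>C\<^sup>k B\<^sup>j A\<^sup>i\<close> by \<open>A\<^sup>n\<close>, \<open>B\<^sup>n\<close> and \<open>C\<^sup>n\<close>.\<close>

fun shiftA :: "int \<Rightarrow> point \<Rightarrow> point" where "shiftA n (k, j, i) = (k, j, i + n)"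
fun shiftB :: "int \<Rightarrow> point \<Rightarrow> point" where
  "shiftB n (k, j, i) = (k + K n i, j * alpha_pow (- K n i) + T n i, F n i)"
fun shiftC :: "int \<Rightarrow> point \<Rightarrow> point" where
  "shiftC n (k, j, i) = (k + n, j * alpha_pow (- n), i * alpha_pow n)"

lemma shiftB_1: "shiftB 1 (k, j, i) = (k + i, (j + 1) * alpha_pow (- i), alpha_sum i)"
proof -
  have "K 1 i = i" "F 1 i = alpha_sum i" by (simp_all add: K_def F_def Y_def alpha_sum_def power2_eq_square algebra_simps)
  moreover have "T 1 i = alpha_pow (- i)"
  proof -
    have "T 1 i = 1 - 2 * h * i + 2 * h ^ 2 * (2 * tri i)" by (simp add: T_def)
    then show ?thesis unfolding tri_double by (simp add: alpha_pow_def algebra_simps)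
  qed
  ultimately show ?thesis by (simp add: algebra_simps)
qed

lemma flow_A: "flow shiftA"
proof -
  have e: "i + 1 - j - s * k = (i - j - s * k) + 1" for i j k by simp
  have "stable (shiftA 1)"
    unfolding stable_def by (simp add: e cong_add_rcancel del: diff_add_eq)
  then show ?thesis by (auto simp: flow_def same_point_refl add.assoc)
qed

lemma alpha_pow_N: "[N * t * alpha_pow x = N * t] (mod D)"
proof -
  have *: "[N * t * (2 * h) = 0] (mod D)" for t
    by (simp add: cong_0_iff N_def D_def h_def power2_eq_square power3_eq_cube mult_ac)
  have "N * t * alpha_pow x - N * t = N * (t * (x + h * x * (x - 1))) * (2 * h)"
    by (simp add: alpha_pow_def algebra_simps power2_eq_square)
  then show "[N * t * alpha_pow x = N * t] (mod D)"
    using * by (metis cong_0_iff cong_iff_dvd_diff)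
qed

lemma same_point_decomp:
  assumes "same_point (k, j, i) (k', j', i')"
  obtains x y w where "k = k' + N * x" "j = j' + N * y" "i = i' + N * w" "[N * w = N * y + s * (N * x)] (mod D)"
proof -
  have "[k' = k] (mod N)" "[j' = j] (mod N)" "[i' = i] (mod N)"
    using assms same_point_imp_N_dvd[OF assms] by (simp_all add: cong_sym_eq)
  then obtain x y w where e: "k = k' + N * x" "j = j' + N * y" "i = i' + N * w"
    unfolding cong_iff_lin by blast
  have "D dvd (i - j - s * k) - (i' - j' - s * k')" using assms by (simp add: cong_iff_dvd_diff)
  then have "[N * w = N * y + s * (N * x)] (mod D)" by (simp add: e cong_iff_dvd_diff algebra_simps)
  with e that show ?thesis by blast
qed

lemma stable_C: "stable (shiftC 1)"
proof -
  have "same_point (shiftC 1 (k, j, i)) (shiftC 1 (k', j', i'))" if r: "same_point (k, j, i) (k', j', i')" for k j i k' j' i'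
  proof -
    obtain x y w where e: "k = k' + N * x" "j = j' + N * y" "i = i' + N * w"
      "[N * w = N * y + s * (N * x)] (mod D)" by (rule same_point_decomp[OF r])
    have "[N * w * alpha_pow 1 - N * y * alpha_pow (- 1) - s * (N * x) = N * w - N * y - s * (N * x)] (mod D)"
      by (intro cong_diff cong_refl alpha_pow_N)
    also have "[N * w - N * y - s * (N * x) = 0] (mod D)" using e(4) by (simp add: cong_iff_dvd_diff diff_diff_eq)
    finally have "D dvd N * w * alpha_pow 1 - N * y * alpha_pow (- 1) - s * (N * x)" by (simp add: cong_0_iff)
    then show ?thesis
      by (simp add: e cong_iff_dvd_diff algebra_simps)
  qed
  then show ?thesis unfolding stable_def by (metis prod_cases3)
qed

lemma flow_C: "flow shiftC"
proof -
  have "same_point (shiftC (n + 1) v) (shiftC 1 (shiftC n v))" for n v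
  proof -
    obtain k j i where v: "v = (k, j, i)" by (cases v) auto
    have "[j * alpha_pow (- (n + 1)) = j * alpha_pow (- n) * alpha_pow (- 1)] (mod D)"
      using alpha_pow_add[of "- n" "- 1"] by (simp add: cong_scalar_left mult.assoc)
    moreover have "[i * alpha_pow (n + 1) = i * alpha_pow n * alpha_pow 1] (mod D)"
      using cong_scalar_left[OF alpha_pow_add[of n 1]] by (simp add: mult.assoc)
    ultimately show ?thesis
      using N_dvd_D by (auto simp del: alpha_pow_1 simp: v add.assoc intro!: cong_diff cong_refl intro: cong_dvd_modulus)
  qed
  then show ?thesis using stable_C by (auto simp: flow_def same_point_refl)
qed

text \<open>A change of \<open>i\<close> by a multiple \<open>w\<close> of \<open>N\<close> moves \<open>k + i\<close> by \<open>w\<close> and \<open>alpha_sum i\<close> by \<open>w + s w\<close>;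
  together with the changes of \<open>k\<close> and \<open>j\<close> they cancel in the lattice.\<close>

lemma stable_B: "stable (shiftB 1)"
proof -
  have "same_point (shiftB 1 (k, j, i)) (shiftB 1 (k', j', i'))" if r: "same_point (k, j, i) (k', j', i')" for k j i k' j' i'
  proof -
    obtain x y w where e: "k = k' + N * x" "j = j' + N * y" "i = i' + N * w"
      "[N * w = N * y + s * (N * x)] (mod D)" by (rule same_point_decomp[OF r])
    have a: "[alpha_pow (- i) = alpha_pow (- i')] (mod D)"
      by (rule alpha_pow_cong_N) (simp add: e cong_iff_dvd_diff)
    have p: "[alpha_sum i = alpha_sum i' + N * w + s * (N * w)] (mod D)"
      unfolding e by (rule alpha_sum_cong_N) simp
    have "[(j + 1) * alpha_pow (- i) = (j + 1) * alpha_pow (- i')] (mod D)" by (intro cong_scalar_left a)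
    also have "(j + 1) * alpha_pow (- i') = (j' + 1) * alpha_pow (- i') + N * y * alpha_pow (- i')"
      by (simp add: e algebra_simps)
    also have "[\<dots> = (j' + 1) * alpha_pow (- i') + N * y] (mod D)" by (intro cong_add cong_refl alpha_pow_N)
    finally have j: "[(j + 1) * alpha_pow (- i) = (j' + 1) * alpha_pow (- i') + N * y] (mod D)" .
    then have jN: "[(j + 1) * alpha_pow (- i) = (j' + 1) * alpha_pow (- i')] (mod N)"
      using cong_dvd_modulus[OF j N_dvd_D] by (simp add: cong_iff_dvd_diff) (metis dvd_add_times_triv_right_iff dvd_diff_commute diff_diff_eq dvd_add_right_iff dvd_triv_left add_diff_cancel_left' diff_add_cancel)
    have "[alpha_sum i - (j + 1) * alpha_pow (- i) - s * (k + i) =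
       alpha_sum i' + N * w + s * (N * w) - ((j' + 1) * alpha_pow (- i') + N * y) - s * (k + i)] (mod D)"
      by (intro cong_diff cong_refl p j)
    also have "alpha_sum i' + N * w + s * (N * w) - ((j' + 1) * alpha_pow (- i') + N * y) - s * (k + i) =
      alpha_sum i' - (j' + 1) * alpha_pow (- i') - s * (k' + i') + (N * w - (N * y + s * (N * x)))"
      by (simp add: e algebra_simps)
    also have "[\<dots> = alpha_sum i' - (j' + 1) * alpha_pow (- i') - s * (k' + i') + 0] (mod D)"
      using e(4) by (intro cong_add cong_refl) (simp add: cong_iff_dvd_diff)
    finally show ?thesis using jN
      unfolding shiftB_1 by (simp add: e) (simp add: cong_iff_dvd_diff algebra_simps)
  qed
  then show ?thesis unfolding stable_def by (metis prod_cases3)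
qed

lemma flow_B: "flow shiftB"
proof -
  have 0: "same_point (shiftB 0 v) v" for v
  proof -
    obtain k j i where v: "v = (k, j, i)" by (cases v) auto
    have "K 0 i = 0" "T 0 i = 0" "F 0 i = i" by (simp_all add: K_def T_def F_def Y_def)
    then show ?thesis by (simp add: v)
  qed
  have "same_point (shiftB (n + 1) v) (shiftB 1 (shiftB n v))" for n v
  proof -
    obtain k j i where v: "v = (k, j, i)" by (cases v) auto
    have K: "[K (n + 1) i = K n i + F n i] (mod 2 * N)" by (rule K_step)
    then have KN: "[k + K (n + 1) i = k + K n i + F n i] (mod N)"
      by (metis add.assoc cong_add_lcancel cong_dvd_modulus dvd_triv_right)
    have sK: "[s * (k + K (n + 1) i) = s * (k + K n i + F n i)] (mod D)"
      using K unfolding D_def_s by (simp add: cong_iff_dvd_diff) 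
        (metis add.assoc add_diff_cancel_left dvd_diff_commute mult_dvd_mono dvd_refl right_diff_distrib)
    have "[alpha_pow (- K (n + 1) i) = alpha_pow (- K n i + - F n i)] (mod D)"
    proof (rule alpha_pow_cong_N)
      have "[- K (n + 1) i = - (K n i + F n i)] (mod N)"
        using KN by (simp only: cong_minus_minus_iff add.assoc cong_add_lcancel)
      then show "[- K (n + 1) i = - K n i + - F n i] (mod N)" by simp
    qed
    also have "[alpha_pow (- K n i + - F n i) = alpha_pow (- K n i) * alpha_pow (- F n i)] (mod D)"
      by (rule alpha_pow_add)
    finally have "[j * alpha_pow (- K (n + 1) i) + T (n + 1) i =
       j * (alpha_pow (- K n i) * alpha_pow (- F n i)) + (T n i + 1) * alpha_pow (- F n i)] (mod D)"
      by (intro cong_add cong_scalar_left T_step)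
    then have j: "[j * alpha_pow (- K (n + 1) i) + T (n + 1) i = 
      (j * alpha_pow (- K n i) + T n i + 1) * alpha_pow (- F n i)] (mod D)"
      by (simp add: algebra_simps)
    show ?thesis
      unfolding v shiftB.simps[of n] shiftB_1 shiftB.simps[of "n + 1"] same_point.simps
      using KN cong_dvd_modulus[OF j N_dvd_D] cong_diff[OF cong_diff[OF F_step j] sK] by blast
  qed
  with 0 stable_B show ?thesis by (auto simp: flow_def)
qed

lemma shift_commutator: "same_point (shiftC 1 (shiftA 1 (shiftB 1 v))) (shiftB 1 (shiftA 1 v))"
proof -
  obtain k j i where v: "v = (k, j, i)" by (cases v) auto
  have "[(j + 1) * alpha_pow (- i) * alpha_pow (- 1) = (j + 1) * alpha_pow (- (i + 1))] (mod D)"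
    using cong_scalar_left[OF alpha_pow_add[of "- i" "- 1"], of "j + 1"] by (simp add: mult.assoc cong_sym_eq)
  moreover have "[(alpha_sum i + 1) * alpha_pow 1 = alpha_sum (i + 1)] (mod D)"
    using alpha_sum_Suc[of i] by (simp add: cong_sym_eq mult.commute)
  ultimately show ?thesis
    unfolding v shiftB_1 shiftA.simps shiftC.simps same_point.simps
    using N_dvd_D by (auto simp: add.assoc intro!: cong_diff cong_refl intro: cong_dvd_modulus)
qed

lemma shift_A_rel: "shiftC 1 (shiftA 1 v) = shiftA (1 + 2 * h) (shiftC 1 v)"
  by (cases v) (simp add: algebra_simps)

lemma shift_B_rel: "same_point (shiftB 1 (shiftC 1 v)) (shiftC 1 (shiftB (1 + 2 * h) v))"
proof -
  obtain k j i where v: "v = (k, j, i)" by (cases v) auto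
  let ?a = "1 + 2 * h"
  have kN: "[k + 1 + i * ?a = k + K ?a i + 1] (mod N)"
    using K_alpha[of i] by (simp add: cong_iff_dvd_diff algebra_simps) (metis diff_diff_eq dvd_diff_commute add.commute)
  have "[alpha_pow (- (i * ?a)) = alpha_pow (- K ?a i)] (mod D)"
    using K_alpha[of i] by (intro alpha_pow_cong_N) (simp add: cong_minus_minus_iff cong_sym_eq mult.commute)
  then have j1: "[j * alpha_pow (- 1) * alpha_pow (- (i * ?a)) = j * alpha_pow (- 1) * alpha_pow (- K ?a i)] (mod D)"
    by (rule cong_scalar_left)
  have jN: "[(j * alpha_pow (- 1) + 1) * alpha_pow (- (i * ?a)) = (j * alpha_pow (- K ?a i) + T ?a i) * alpha_pow (- 1)] (mod N)"
    using cong_add[OF cong_dvd_modulus[OF j1 N_dvd_D] cong_sym[OF T_alpha[of i]]] by (simp add: algebra_simps)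
  have "[alpha_sum (i * ?a) - alpha_pow (- (i * ?a)) - s * (i * ?a) = ?a * F ?a i - alpha_pow (- 1) * T ?a i - s * K ?a i] (mod D)"
    using B_alpha_shift[of i] by (simp add: cong_iff_dvd_diff algebra_simps dvd_diff_commute)
  from cong_diff[OF cong_diff[OF this j1] cong_refl[of "s * (k + 1)"]]
  have iD: "[alpha_sum (i * ?a) - (j * alpha_pow (- 1) + 1) * alpha_pow (- (i * ?a)) - s * (k + 1 + i * ?a) =
      F ?a i * ?a - (j * alpha_pow (- K ?a i) + T ?a i) * alpha_pow (- 1) - s * (k + K ?a i + 1)] (mod D)"
    by (simp add: algebra_simps)
  show ?thesis
    unfolding v shiftC.simps shiftB.simps[of ?a] shiftB_1 same_point.simps alpha_pow_1
    using kN jN iD by blast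
qed

text \<open>Composition of permutations reverses the order of right multiplications, so it is the
  inverses of these permutations that satisfy the relations of \<open>J\<close>.\<close>

abbreviation "H \<equiv> BijGroup S"
abbreviation "pA \<equiv> induced (shiftA 1)"
abbreviation "pB \<equiv> induced (shiftB 1)"
abbreviation "pC \<equiv> induced (shiftC 1)"

lemma perm_closed: "pA \<in> carrier H" "pB \<in> carrier H" "pC \<in> carrier H"
  using flow_Bij flow_A flow_B flow_C by auto

lemma stable_1: "stable (shiftA 1)" "stable (shiftB 1)" "stable (shiftC 1)"
  using flow_A flow_B flow_C by (auto simp: flow_def)

lemma perm_commutator: "pC \<otimes>\<^bsub>H\<^esub> (pA \<otimes>\<^bsub>H\<^esub> pB) = pB \<otimes>\<^bsub>H\<^esub> pA"
proof -
  interpret H: group H by (rule group_BijGroup)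
  show ?thesis
  proof (rule BijGroup_eqI)
    fix v assume v: "v \<in> S"
    have "(pC \<otimes>\<^bsub>H\<^esub> (pA \<otimes>\<^bsub>H\<^esub> pB)) v = reduce (shiftC 1 (shiftA 1 (shiftB 1 v)))"
      using v by (simp add: BijGroup_mult_apply perm_closed BijGroup_apply_closed)
        (simp add: induced_def reduce_stable stable_1)
    also have "\<dots> = reduce (shiftB 1 (shiftA 1 v))"
      unfolding reduce_eq_iff by (rule shift_commutator)
    also have "\<dots> = (pB \<otimes>\<^bsub>H\<^esub> pA) v"
      using v by (simp add: BijGroup_mult_apply perm_closed BijGroup_apply_closed)
        (simp add: induced_def reduce_stable stable_1)
    finally show "(pC \<otimes>\<^bsub>H\<^esub> (pA \<otimes>\<^bsub>H\<^esub> pB)) v = (pB \<otimes>\<^bsub>H\<^esub> pA) v" .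
  qed (simp_all add: perm_closed)
qed

lemma perm_A_rel: "pC \<otimes>\<^bsub>H\<^esub> pA = pA [^]\<^bsub>H\<^esub> (1 + 2 * h) \<otimes>\<^bsub>H\<^esub> pC"
proof -
  interpret H: group H by (rule group_BijGroup)
  show ?thesis
  proof (rule BijGroup_eqI)
    fix v assume v: "v \<in> S"
    note st = flow_stable[OF flow_A]
    have "(pC \<otimes>\<^bsub>H\<^esub> pA) v = reduce (shiftC 1 (shiftA 1 v))"
      using v by (simp add: BijGroup_mult_apply perm_closed)
        (simp add: induced_def reduce_stable stable_1)
    also have "\<dots> = reduce (shiftA (1 + 2 * h) (reduce (shiftC 1 v)))"
      unfolding shift_A_rel by (simp add: st reduce_stable)
    also have "\<dots> = (pA [^]\<^bsub>H\<^esub> (1 + 2 * h) \<otimes>\<^bsub>H\<^esub> pC) v"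
      using v by (simp add: BijGroup_mult_apply perm_closed flow_pow[OF flow_A] BijGroup_apply_closed)
        (simp add: induced_def)
    finally show "(pC \<otimes>\<^bsub>H\<^esub> pA) v = (pA [^]\<^bsub>H\<^esub> (1 + 2 * h) \<otimes>\<^bsub>H\<^esub> pC) v" .
  qed (simp_all add: perm_closed)
qed

lemma perm_B_rel: "pB \<otimes>\<^bsub>H\<^esub> pC = pC \<otimes>\<^bsub>H\<^esub> pB [^]\<^bsub>H\<^esub> (1 + 2 * h)"
proof -
  interpret H: group H by (rule group_BijGroup)
  show ?thesis
  proof (rule BijGroup_eqI)
    fix v assume v: "v \<in> S"
    have "(pB \<otimes>\<^bsub>H\<^esub> pC) v = reduce (shiftB 1 (shiftC 1 v))"
      using v by (simp add: BijGroup_mult_apply perm_closed)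
        (simp add: induced_def reduce_stable stable_1)
    also have "\<dots> = reduce (shiftC 1 (shiftB (1 + 2 * h) v))"
      unfolding reduce_eq_iff by (rule shift_B_rel)
    also have "\<dots> = (pC \<otimes>\<^bsub>H\<^esub> pB [^]\<^bsub>H\<^esub> (1 + 2 * h)) v"
      using v by (simp add: BijGroup_mult_apply perm_closed flow_pow[OF flow_B])
        (simp add: induced_def reduce_stable stable_1)
    finally show "(pB \<otimes>\<^bsub>H\<^esub> pC) v = (pC \<otimes>\<^bsub>H\<^esub> pB [^]\<^bsub>H\<^esub> (1 + 2 * h)) v" .
  qed (simp_all add: perm_closed)
qed

lemma perm_order: "pA [^]\<^bsub>H\<^esub> D = \<one>\<^bsub>H\<^esub>" "pB [^]\<^bsub>H\<^esub> D = \<one>\<^bsub>H\<^esub>"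
proof -
  interpret H: group H by (rule group_BijGroup)
  have one: "\<one>\<^bsub>H\<^esub> v = v" if "v \<in> S" for v using that by (simp add: BijGroup_def)
  have "same_point (shiftA D v) v" for v by (cases v) (simp add: cong_iff_dvd_diff)
  then have "reduce (shiftA D v) = reduce v" for v by (simp add: reduce_eq_iff)
  then show "pA [^]\<^bsub>H\<^esub> D = \<one>\<^bsub>H\<^esub>"
    by (intro BijGroup_eqI) (simp_all add: perm_closed flow_pow[OF flow_A] one S_reduce)
  have "same_point (shiftB D v) v" for v
  proof -
    obtain k j i where v: "v = (k, j, i)" by (cases v) auto
    have KN: "[K D i = 0] (mod N)" using D_values(1) by (rule cong_dvd_modulus) simp
    have "[alpha_pow (- K D i) = alpha_pow 0] (mod D)"
      using KN by (intro alpha_pow_cong_N) (simp add: cong_0_iff)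
    then have j: "[j * alpha_pow (- K D i) + T D i = j * alpha_pow 0 + 0] (mod D)"
      by (intro cong_add cong_scalar_left D_values)
    have sK: "[s * (k + K D i) = s * k] (mod D)"
      using D_values(1)[of i] unfolding D_def_s by (simp add: cong_0_iff cong_iff_dvd_diff algebra_simps)
    show ?thesis
      unfolding v shiftB.simps same_point.simps
      using KN j cong_dvd_modulus[OF j N_dvd_D] cong_diff[OF cong_diff[OF D_values(3)[of i] j] sK]
      by (simp add: cong_0_iff cong_iff_dvd_diff)
  qed
  then have "reduce (shiftB D v) = reduce v" for v by (simp add: reduce_eq_iff)
  then show "pB [^]\<^bsub>H\<^esub> D = \<one>\<^bsub>H\<^esub>"
    by (intro BijGroup_eqI) (simp_all add: perm_closed flow_pow[OF flow_B] one S_reduce)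
qed

lemma perm_commutator_inv: "gcomm H (inv\<^bsub>H\<^esub> pA) (inv\<^bsub>H\<^esub> pB) = inv\<^bsub>H\<^esub> pC"
proof -
  interpret H: group H by (rule group_BijGroup)
  have "pA \<otimes>\<^bsub>H\<^esub> pB = inv\<^bsub>H\<^esub> pC \<otimes>\<^bsub>H\<^esub> (pB \<otimes>\<^bsub>H\<^esub> pA)"
    using perm_closed by (simp flip: perm_commutator H.m_assoc)
  then have "pA \<otimes>\<^bsub>H\<^esub> pB \<otimes>\<^bsub>H\<^esub> inv\<^bsub>H\<^esub> pA \<otimes>\<^bsub>H\<^esub> inv\<^bsub>H\<^esub> pB = inv\<^bsub>H\<^esub> pC"
    using perm_closed by (simp add: H.m_assoc H.inv_solve_right)
  then show ?thesis using perm_closed by (simp add: gcomm_def)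
qed

lemma perm_J_rel: "J_rel H m l (inv\<^bsub>H\<^esub> pA) (inv\<^bsub>H\<^esub> pB)"
proof -
  interpret H: group H by (rule group_BijGroup)
  note cl = perm_closed
  have al: "1 + 2 ^ m * l = 1 + 2 * h" by (simp add: power_m h_def)
  have pw: "(inv\<^bsub>H\<^esub> x) [^]\<^bsub>H\<^esub> ((2::nat) ^ (3 * m - 1)) = \<one>\<^bsub>H\<^esub>"
    if "x [^]\<^bsub>H\<^esub> D = \<one>\<^bsub>H\<^esub>" "x \<in> carrier H" for x
  proof -
    have "D = int (2 ^ (3 * m - 1))" by (simp flip: power_D)
    then have "x [^]\<^bsub>H\<^esub> ((2::nat) ^ (3 * m - 1)) = \<one>\<^bsub>H\<^esub>"
      using that(1) by (simp only: int_pow_int)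
    then show ?thesis using that by (simp add: H.nat_pow_inv)
  qed
  show ?thesis
  proof
    show "gconj H (inv\<^bsub>H\<^esub> pA) (gcomm H (inv\<^bsub>H\<^esub> pA) (inv\<^bsub>H\<^esub> pB)) = inv\<^bsub>H\<^esub> pA [^]\<^bsub>H\<^esub> (1 + 2 ^ m * l)"
    proof -
      have "pA [^]\<^bsub>H\<^esub> (1 + 2 * h) = pC \<otimes>\<^bsub>H\<^esub> pA \<otimes>\<^bsub>H\<^esub> inv\<^bsub>H\<^esub> pC"
        using cl perm_A_rel by (simp add: H.inv_solve_right)
      then have "inv\<^bsub>H\<^esub> (pA [^]\<^bsub>H\<^esub> (1 + 2 * h)) = pC \<otimes>\<^bsub>H\<^esub> inv\<^bsub>H\<^esub> pA \<otimes>\<^bsub>H\<^esub> inv\<^bsub>H\<^esub> pC"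
        using cl by (simp add: H.inv_mult_group H.m_assoc)
      then show ?thesis unfolding perm_commutator_inv al
        using cl by (simp add: gconj_def H.int_pow_inv)
    qed
    have "gcomm H (inv\<^bsub>H\<^esub> pB) (inv\<^bsub>H\<^esub> pA) = inv\<^bsub>H\<^esub> (gcomm H (inv\<^bsub>H\<^esub> pA) (inv\<^bsub>H\<^esub> pB))"
      using cl by (simp add: gcomm_def H.inv_mult_group H.m_assoc)
    then have c: "gcomm H (inv\<^bsub>H\<^esub> pB) (inv\<^bsub>H\<^esub> pA) = pC" using cl by (simp add: perm_commutator_inv)
    show "gconj H (inv\<^bsub>H\<^esub> pB) (gcomm H (inv\<^bsub>H\<^esub> pB) (inv\<^bsub>H\<^esub> pA)) = inv\<^bsub>H\<^esub> pB [^]\<^bsub>H\<^esub> (1 + 2 ^ m * l)"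
    proof -
      have "pB [^]\<^bsub>H\<^esub> (1 + 2 * h) = inv\<^bsub>H\<^esub> pC \<otimes>\<^bsub>H\<^esub> (pB \<otimes>\<^bsub>H\<^esub> pC)"
        using cl perm_B_rel by (simp add: H.inv_solve_left)
      then have "inv\<^bsub>H\<^esub> (pB [^]\<^bsub>H\<^esub> (1 + 2 * h)) = inv\<^bsub>H\<^esub> pC \<otimes>\<^bsub>H\<^esub> inv\<^bsub>H\<^esub> pB \<otimes>\<^bsub>H\<^esub> pC"
        using cl by (simp add: H.inv_mult_group H.m_assoc)
      then show ?thesis unfolding c al
        using cl by (simp add: gconj_def H.int_pow_inv)
    qed
  qed (simp_all add: cl pw perm_order m_gt_1 odd_l del: One_nat_def)
qed

text \<open>The inverse of the permutation \<open>E k j i\<close> moves the origin to the point \<open>(k, j, i)\<close>.\<close>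

lemma perm_E_unique:
  assumes "J_rel.E H (inv\<^bsub>H\<^esub> pA) (inv\<^bsub>H\<^esub> pB) k j i = J_rel.E H (inv\<^bsub>H\<^esub> pA) (inv\<^bsub>H\<^esub> pB) k' j' i'"
  shows "same_point (k, j, i) (k', j', i')"
proof -
  interpret J_rel H m l "inv\<^bsub>H\<^esub> pA" "inv\<^bsub>H\<^esub> pB" by (rule perm_J_rel)
  note cl = perm_closed
  have C: "C = inv\<^bsub>H\<^esub> pC" by (simp add: C_def perm_commutator_inv)
  have ev: "(inv\<^bsub>H\<^esub> E k j i) (0, 0, 0) = reduce (k, j, i)" for k j i
  proof -
    have e: "inv\<^bsub>H\<^esub> E k j i = pA [^]\<^bsub>H\<^esub> i \<otimes>\<^bsub>H\<^esub> (pB [^]\<^bsub>H\<^esub> j \<otimes>\<^bsub>H\<^esub> pC [^]\<^bsub>H\<^esub> k)"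
      using cl by (simp add: E_def C int_pow_inv inv_mult_group m_assoc)
    have 0: "(0, 0, 0) \<in> S" using reduce_in_S[of "(0, 0, 0)"] by simp
    have pw: "pA [^]\<^bsub>H\<^esub> i \<in> carrier H" "pB [^]\<^bsub>H\<^esub> j \<in> carrier H" "pC [^]\<^bsub>H\<^esub> k \<in> carrier H"
      by (simp_all add: cl)
    have "(inv\<^bsub>H\<^esub> E k j i) (0, 0, 0) = (pA [^]\<^bsub>H\<^esub> i) ((pB [^]\<^bsub>H\<^esub> j) ((pC [^]\<^bsub>H\<^esub> k) (0, 0, 0)))"
      unfolding e BijGroup_mult_apply[OF pw(1) m_closed[OF pw(2,3)] 0] BijGroup_mult_apply[OF pw(2,3) 0] ..
    also have "(pC [^]\<^bsub>H\<^esub> k) (0, 0, 0) = reduce (k, 0, 0)"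
      unfolding flow_pow[OF flow_C 0] by simp
    also have "(pB [^]\<^bsub>H\<^esub> j) (reduce (k, 0, 0)) = reduce (shiftB j (k, 0, 0))"
      unfolding flow_pow[OF flow_B reduce_in_S] by (rule reduce_stable[OF flow_stable[OF flow_B]])
    also have "shiftB j (k, 0, 0) = (k, j, 0)" by (simp add: K_def T_def F_def Y_def)
    also have "(pA [^]\<^bsub>H\<^esub> i) (reduce (k, j, 0)) = reduce (shiftA i (k, j, 0))"
      unfolding flow_pow[OF flow_A reduce_in_S] by (rule reduce_stable[OF flow_stable[OF flow_A]])
    also have "shiftA i (k, j, 0) = (k, j, i)" by simp
    finally show ?thesis .
  qed
  show ?thesis
    unfolding reduce_eq_iff[symmetric] ev[symmetric] assms ..
qed

end

section \<open>An abelian normal subgroup and the action on it\<close>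

lemma (in group) gcomm_eqI:
  assumes "x \<in> carrier G" "y \<in> carrier G" "c \<in> carrier G" "x \<otimes> y = y \<otimes> (x \<otimes> c)"
  shows "gcomm G x y = c"
  using assms by (simp add: gcomm_def m_assoc inv_solve_left')

lemma (in group) gconj_eq_iff:
  assumes "x \<in> carrier G" "y \<in> carrier G" "c \<in> carrier G"
  shows "gconj G x y = c \<longleftrightarrow> x \<otimes> y = y \<otimes> c"
  using assms by (auto simp: gconj_def m_assoc inv_solve_left')

context J_rel
begin

text \<open>These elements form an abelian normal subgroup, the third term of the upper central
  series (\<open>Z3_eq\<close>). Conjugation is linear in the coordinates \<open>x\<close>, \<open>y\<close>, \<open>z\<close>, which turns the relations of \<open>J\<close>
  into linear congruences.\<close>

definition W :: "int \<Rightarrow> int \<Rightarrow> int \<Rightarrow> 'a" where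
  "W x y z = A [^] (2 * s * x) \<otimes> (B [^] (2 * s * y) \<otimes> C [^] (s * z))"

lemma W_closed [simp]: "W x y z \<in> carrier G" by (simp add: W_def)

lemma W_000 [simp]: "W 0 0 0 = \<one>" by (simp add: W_def)

lemma W_swap: "J_rel.W G m B A x y z = B [^] (2 * s * x) \<otimes> (A [^] (2 * s * y) \<otimes> C [^] (s * - z))"
proof -
  interpret sw: J_rel G m l B A by (rule swap)
  have "sw.C = inv C" unfolding sw.C_def by (rule C_swap)
  then show ?thesis by (simp add: sw.W_def int_pow_inv int_pow_neg)
qed

lemma two_s_alpha_pow: "[2 * s * x * alpha_pow (s * z) = 2 * s * x] (mod D)"
proof -
  have "2 * s * x * alpha_pow (s * z) - 2 * s * x = 4 * s ^ 3 * (x * (l * z + h * l * z * (s * z - 1)))"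
    by (simp add: alpha_pow_def h_def algebra_simps power2_eq_square power3_eq_cube)
  then show ?thesis by (simp add: cong_iff_dvd_diff D_def)
qed

lemma A_2s_C_s: "A [^] (2 * s * x) \<otimes> C [^] (s * z) = C [^] (s * z) \<otimes> A [^] (2 * s * x)"
  unfolding A_pow_C_pow A_cong[OF two_s_alpha_pow] ..

lemma B_2s_C_s: "B [^] (2 * s * y) \<otimes> C [^] (s * z) = C [^] (s * z) \<otimes> B [^] (2 * s * y)"
  using B_cong[OF two_s_alpha_pow[of y "- z"]] by (simp add: B_pow_C_pow)

lemma A_2s_cong: "[x = y] (mod 2 * s ^ 2) \<Longrightarrow> A [^] (2 * s * x) = A [^] (2 * s * y)"
proof (rule A_cong)
  assume "[x = y] (mod 2 * s ^ 2)"
  then obtain t where "x - y = 2 * s ^ 2 * t" by (auto simp: cong_iff_dvd_diff dvd_def)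
  then have "2 * s * x - 2 * s * y = D * t"
    by (simp add: D_def power2_eq_square power3_eq_cube flip: right_diff_distrib)
  then show "[2 * s * x = 2 * s * y] (mod D)" by (simp add: cong_iff_dvd_diff)
qed

lemma C_s_period: "C [^] (s * (z + 2 * s * k)) = A [^] (2 * s * (s ^ 2 * k)) \<otimes> C [^] (s * z)"
proof -
  have "C [^] (s * (z + 2 * s * k)) = C [^] (N * k) \<otimes> C [^] (s * z)"
    by (simp add: int_pow_mult' N_def algebra_simps power2_eq_square)
  moreover have "s * N * k = 2 * s * (s ^ 2 * k)" by (simp add: N_def)
  ultimately show ?thesis by (simp only: C_pow_N)
qed

lemma B_s_period: "B [^] (2 * s * (y + s * k)) = A [^] (2 * s * (- (s * k))) \<otimes> B [^] (2 * s * y)"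
proof -
  have "B [^] (2 * s * (y + s * k)) = B [^] (N * k) \<otimes> B [^] (2 * s * y)"
    by (simp add: int_pow_mult' N_def algebra_simps power2_eq_square)
  moreover have "- (N * k) = 2 * s * (- (s * k))" by (simp add: N_def power2_eq_square)
  ultimately show ?thesis by (simp only: B_pow_N)
qed

lemma alpha_sum_2s: "[alpha_sum (2 * s * x) = 2 * s * (x + h * x)] (mod D)"
proof -
  have t: "tri (2 * s * x) = s * x * (2 * s * x + 1)"
    using tri_double[of "2 * s * x"] by (simp add: algebra_simps)
  have "3 * (alpha_sum (2 * s * x) - 2 * s * (x + h * x)) =
     6 * h * tri (2 * s * x) + 4 * h ^ 2 * (3 * tet (2 * s * x)) - 6 * s * h * x"
    by (simp add: alpha_sum_def algebra_simps)
  also have "\<dots> = 4 * s ^ 3 * (3 * l * x ^ 2 + l ^ 2 * x * (2 * s * x + 1) * (2 * s * x - 1))"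
    unfolding tet_times_3 t by (simp add: h_def algebra_simps power2_eq_square power3_eq_cube)
  finally have "D dvd 3 * (alpha_sum (2 * s * x) - 2 * s * (x + h * x))" by (simp add: D_def)
  then show ?thesis
    using coprime_3_D by (metis cong_iff_dvd_diff coprime_commute coprime_dvd_mult_right_iff)
qed

lemma A_2s_B: "A [^] (2 * s * x) \<otimes> B = B \<otimes> (A [^] (2 * s * (x + h * x)) \<otimes> C [^] (s * (2 * x)))"
proof -
  have "C [^] (2 * s * x) = C [^] (s * (2 * x))" by (simp add: mult_ac)
  then show ?thesis
    unfolding A_pow_B A_cong[OF alpha_sum_2s] by (simp only: A_2s_C_s)
qed

lemma alpha_pow_s: "[alpha_pow (s * z) - 1 = 2 * s * (h * z + s ^ 2 * z)] (mod D)"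
proof -
  have "alpha_pow (s * z) - 1 - 2 * s * (h * z + s ^ 2 * z) = 2 * s ^ 3 * (l ^ 2 * (z * (s * z - 1)) - z)"
    by (simp add: alpha_pow_def h_def algebra_simps power2_eq_square power3_eq_cube)
  moreover have "even (l ^ 2 * (z * (s * z - 1)) - z)"
    using s_even odd_l by (cases "even z") auto
  then obtain t where "l ^ 2 * (z * (s * z - 1)) - z = 2 * t" by blast
  ultimately have "alpha_pow (s * z) - 1 - 2 * s * (h * z + s ^ 2 * z) = D * t" by (simp add: D_def)
  then show ?thesis by (simp add: cong_iff_dvd_diff)
qed

lemma C_s_A: "C [^] (s * z) \<otimes> A = A \<otimes> (A [^] (2 * s * ((s ^ 2 - h) * z)) \<otimes> C [^] (s * z))"
proof -
  have 1: "[alpha_pow (- (s * z)) * alpha_pow (s * z) = 1] (mod D)"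
    using alpha_pow_add[of "- (s * z)" "s * z"] by (simp add: cong_sym_eq)
  have "A [^] alpha_pow (- (s * z)) \<otimes> C [^] (s * z) = C [^] (s * z) \<otimes> A"
    unfolding A_pow_C_pow using A_cong[OF 1] by simp
  moreover have "A [^] alpha_pow (- (s * z)) = A [^] (1 + 2 * s * ((s ^ 2 - h) * z))"
  proof (rule A_cong)
    have "[alpha_pow (- (s * z)) - 1 = 2 * s * (h * - z + s ^ 2 * - z)] (mod D)"
      using alpha_pow_s[of "- z"] by simp
    also have "[2 * s * (h * - z + s ^ 2 * - z) = 2 * s * ((s ^ 2 - h) * z)] (mod D)"
      by (simp add: cong_iff_dvd_diff D_def algebra_simps power2_eq_square power3_eq_cube)
    finally show "[alpha_pow (- (s * z)) = 1 + 2 * s * ((s ^ 2 - h) * z)] (mod D)"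
      by (simp add: cong_iff_dvd_diff algebra_simps)
  qed
  ultimately show ?thesis by (simp add: int_pow_mult m_assoc)
qed

lemma C_s_B: "C [^] (s * z) \<otimes> B = B \<otimes> (A [^] (2 * s * ((s ^ 2 - h) * z)) \<otimes> C [^] (s * z))"
proof -
  interpret sw: J_rel G m l B A by (rule swap)
  have "sw.C = inv C" unfolding sw.C_def by (rule C_swap)
  then have *: "C [^] (s * z) \<otimes> B = B \<otimes> (B [^] (2 * s * ((s ^ 2 - h) * - z)) \<otimes> C [^] (s * z))"
    using sw.C_s_A[of "- z"] by (simp add: int_pow_inv int_pow_neg)
  have "B [^] (2 * s * (0 + s * ((s - l) * - z))) = A [^] (2 * s * (- (s * ((s - l) * - z)))) \<otimes> B [^] (2 * s * 0)"
    by (rule B_s_period)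
  then have "B [^] (2 * s * ((s ^ 2 - h) * - z)) = A [^] (2 * s * ((s ^ 2 - h) * z))"
    by (simp add: h_def power2_eq_square algebra_simps)
  with * show ?thesis by simp
qed

lemma W0_mult: "W x 0 z \<otimes> W x' 0 z' = W (x + x') 0 (z + z')"
proof -
  have "C [^] (s * z) \<otimes> (A [^] (2 * s * x') \<otimes> C [^] (s * z')) = A [^] (2 * s * x') \<otimes> (C [^] (s * z) \<otimes> C [^] (s * z'))"
    using A_2s_C_s[of x' z] by (simp flip: m_assoc)
  then show ?thesis
    by (simp add: W_def m_assoc int_pow_mult' int_pow_mult_left distrib_left)
qed

lemma W_cong: "[x = x'] (mod 2 * s ^ 2) \<Longrightarrow> W x y z = W x' y z"
  unfolding W_def by (simp add: A_2s_cong)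

lemma W_period_y: "W x (y + s * k) z = W (x - s * k) y z"
  unfolding W_def B_s_period by (simp add: m_assoc int_pow_mult_left algebra_simps)

lemma W0_period_z: "W x 0 (z + 2 * s * k) = W (x + s ^ 2 * k) 0 z"
  unfolding W_def C_s_period by (simp add: m_assoc int_pow_mult_left algebra_simps)

lemma W0_B: "W x 0 z \<otimes> B = B \<otimes> W (x + h * x + (s ^ 2 - h) * z) 0 (z + 2 * x)"
proof -
  have "W x 0 z \<otimes> B = A [^] (2 * s * x) \<otimes> (C [^] (s * z) \<otimes> B)"
    by (simp add: W_def m_assoc)
  also have "\<dots> = (A [^] (2 * s * x) \<otimes> B) \<otimes> W ((s ^ 2 - h) * z) 0 z"
    unfolding C_s_B by (simp add: W_def m_assoc)
  also have "\<dots> = B \<otimes> (W (x + h * x) 0 (2 * x) \<otimes> W ((s ^ 2 - h) * z) 0 z)"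
    unfolding A_2s_B by (simp add: W_def m_assoc)
  finally show ?thesis unfolding W0_mult by (simp add: algebra_simps)
qed

text \<open>In the coordinates \<open>(x, z)\<close>, conjugation by \<open>B\<close> is \<open>1 + \<delta>\<close> with
  \<open>\<delta> (x, z) = (h x + (s\<^sup>2 - h) z, 2 x)\<close>. Modulo the periods \<open>W_cong\<close> and \<open>W0_period_z\<close> one has
  \<open>\<delta>\<^sup>2 (x, 0) = (- 2 h x, 0)\<close> and \<open>\<delta>\<^sup>3 (x, 0) = 0\<close>.\<close>

lemma W0_B_pow: "W x 0 0 \<otimes> B [^] n = B [^] n \<otimes> W (x + n * h * x - 2 * h * x * tri (n - 1)) 0 (2 * n * x)"
proof (induction n rule: int_iff_induct)
  case 1
  then show ?case by simp
next
  case (2 n)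
  define x' where "x' = x + n * h * x - 2 * h * x * tri (n - 1)"
  have t: "tri n = tri (n - 1) + n" using tri_Suc[of "n - 1"] by simp
  \<comment> \<open>\<open>X\<close> is the new first coordinate; the excess over it consists of periods, because \<open>l (l + 1)\<close> is even.\<close>
  define Q where "Q = n * x - 2 * x * tri (n - 1)"
  define X where "X = x + (n + 1) * h * x - 2 * h * x * tri n"
  obtain u where u: "l * (l + 1) = 2 * u" by (metis tri_double)
  have "x' + h * x' + (s ^ 2 - h) * (2 * n * x) + s ^ 2 * (l * Q) =
      X + 2 * s ^ 2 * (n * x) + s ^ 2 * (l * (l + 1)) * Q"
    by (simp add: x'_def X_def Q_def t h_def algebra_simps power2_eq_square)
  then have e1: "x' + h * x' + (s ^ 2 - h) * (2 * n * x) + s ^ 2 * (l * Q) = X + 2 * s ^ 2 * (n * x + u * Q)"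
    unfolding u by (simp add: algebra_simps)
  have e2: "2 * n * x + 2 * x' = 2 * (n + 1) * x + 2 * s * (l * Q)"
    by (simp add: x'_def Q_def h_def algebra_simps)
  have "W (x' + h * x' + (s ^ 2 - h) * (2 * n * x)) 0 (2 * n * x + 2 * x') =
      W (X + 2 * s ^ 2 * (n * x + u * Q)) 0 (2 * (n + 1) * x)"
    unfolding e2 W0_period_z e1 ..
  also have "\<dots> = W (x + (n + 1) * h * x - 2 * h * x * tri n) 0 (2 * (n + 1) * x)"
    by (rule W_cong) (simp add: cong_iff_dvd_diff X_def)
  finally have step: "W x' 0 (2 * n * x) \<otimes> B = B \<otimes> W (x + (n + 1) * h * x - 2 * h * x * tri n) 0 (2 * (n + 1) * x)"
    by (simp only: W0_B)
  have "B [^] (n + 1) \<otimes> W (x + (n + 1) * h * x - 2 * h * x * tri n) 0 (2 * (n + 1) * x) = 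
      B [^] n \<otimes> W x' 0 (2 * n * x) \<otimes> B"
    by (simp add: int_pow_mult m_assoc step)
  moreover have "W x 0 0 \<otimes> B [^] (n + 1) = W x 0 0 \<otimes> B [^] n \<otimes> B"
    by (simp add: int_pow_mult m_assoc)
  ultimately show ?case by (simp add: x'_def)
qed

lemma A_2s_B_2s: "A [^] (2 * s * x) \<otimes> B [^] (2 * s * y) = B [^] (2 * s * y) \<otimes> A [^] (2 * s * x)"
proof -
  define n where "n = 2 * s * y"
  have t: "tri (n - 1) = s * y * (n - 1)"
    using tri_double[of "n - 1"] by (simp add: n_def algebra_simps)
  have "2 * n * x = 0 + 2 * s * (2 * y * x)" by (simp add: n_def)
  then have "W (x + n * h * x - 2 * h * x * tri (n - 1)) 0 (2 * n * x) =
      W (x + n * h * x - 2 * h * x * tri (n - 1) + s ^ 2 * (2 * y * x)) 0 0"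
    by (simp only: W0_period_z)
  also have "\<dots> = W x 0 0"
    unfolding t by (rule W_cong) (simp add: n_def cong_iff_dvd_diff h_def algebra_simps power2_eq_square)
  finally show ?thesis using W0_B_pow[of x n] by (simp add: W_def n_def)
qed

lemma W_mult: "W x y z \<otimes> W x' y' z' = W (x + x') (y + y') (z + z')"
proof -
  have "W x y z \<otimes> W x' y' z' = A [^] (2 * s * x) \<otimes> (B [^] (2 * s * y) \<otimes>
      (C [^] (s * z) \<otimes> A [^] (2 * s * x')) \<otimes> (B [^] (2 * s * y') \<otimes> C [^] (s * z')))"
    by (simp add: W_def m_assoc)
  also have "\<dots> = A [^] (2 * s * x) \<otimes> ((B [^] (2 * s * y) \<otimes> A [^] (2 * s * x')) \<otimes> 
      ((C [^] (s * z) \<otimes> B [^] (2 * s * y')) \<otimes> C [^] (s * z')))"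
    unfolding A_2s_C_s[symmetric] by (simp add: m_assoc)
  also have "\<dots> = W (x + x') (y + y') (z + z')"
    unfolding A_2s_B_2s[symmetric] B_2s_C_s[symmetric]
    by (simp add: W_def m_assoc int_pow_mult' int_pow_mult_left distrib_left)
  finally show ?thesis .
qed

lemma W_mult_left: "g \<in> carrier G \<Longrightarrow> W x y z \<otimes> (W x' y' z' \<otimes> g) = W (x + x') (y + y') (z + z') \<otimes> g"
  by (simp add: W_mult flip: m_assoc)

lemma W_pow: "W x y z [^] (n::int) = W (n * x) (n * y) (n * z)"
proof (induction n rule: int_iff_induct)
  case (2 k)
  have "W x y z [^] (k + 1) = W x y z [^] k \<otimes> W x y z" by (simp add: int_pow_mult)
  moreover have "W ((k + 1) * x) ((k + 1) * y) ((k + 1) * z) = W (k * x) (k * y) (k * z) \<otimes> W x y z"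
    by (simp add: W_mult algebra_simps)
  ultimately show ?case by simp
qed simp

lemma W_period_z: "W x y (z + 2 * s * k) = W (x + s ^ 2 * k) y z"
  using W0_period_z[of x z k] W_mult[of 0 y 0 x 0 "z + 2 * s * k"] W_mult[of 0 y 0 "x + s ^ 2 * k" 0 z] by simp

text \<open>Conjugation by \<open>B\<close>, \<open>A\<close> and \<open>C\<close> as linear maps of the coordinates.\<close>

lemma W_B: "W x y z \<otimes> B = B \<otimes> W (x + h * x + (s ^ 2 - h) * z) y (z + 2 * x)"
proof -
  have "W 0 y 0 \<otimes> B = B \<otimes> W 0 y 0"
    using int_pow_commute_closed[of B B "2 * s * y" 1] by (simp add: W_def)
  moreover have "W x y z = W 0 y 0 \<otimes> W x 0 z" by (simp add: W_mult)
  ultimately have "W x y z \<otimes> B = B \<otimes> (W 0 y 0 \<otimes> W (x + h * x + (s ^ 2 - h) * z) 0 (z + 2 * x))"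
    using W0_B[of x z] by (simp add: m_assoc) (simp flip: m_assoc)
  then show ?thesis by (simp add: W_mult)
qed

lemma W_swap_eq: "J_rel.W G m B A x y z = W y x (- z)"
proof -
  have "B [^] (2 * s * x) \<otimes> (A [^] (2 * s * y) \<otimes> C [^] (s * - z)) = (B [^] (2 * s * x) \<otimes> A [^] (2 * s * y)) \<otimes> C [^] (s * - z)"
    by (simp add: m_assoc)
  then show ?thesis
    unfolding W_swap A_2s_B_2s[symmetric] by (simp add: W_def m_assoc)
qed

lemma W_A: "W x y z \<otimes> A = A \<otimes> W (x - h * y + (s ^ 2 - h) * z) y (z - 2 * y)"
proof -
  interpret sw: J_rel G m l B A by (rule swap)
  have "W x y z \<otimes> A = A \<otimes> W x (y + s * (l * y + (s - l) * - z)) (z - 2 * y)"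
    using sw.W_B[of y x "- z"] unfolding W_swap_eq by (simp add: h_def algebra_simps power2_eq_square)
  then show ?thesis
    unfolding W_period_y by (simp add: h_def algebra_simps power2_eq_square)
qed

lemma W_C: "W x y z \<otimes> C = C \<otimes> W (x + 2 * h * (x + y)) y z"
proof -
  have 1: "A [^] (2 * s * x) \<otimes> C [^] (1::int) = C [^] (1::int) \<otimes> A [^] (2 * s * (x + 2 * h * x))"
    unfolding A_pow_C_pow by (simp add: algebra_simps)
  have 2: "B [^] (2 * s * y) \<otimes> C [^] (1::int) = C [^] (1::int) \<otimes> B [^] (2 * s * (y + s * (- 2 * l * y + 4 * s * l ^ 2 * y)))"
    unfolding B_pow_C_pow by (simp add: alpha_pow_def h_def algebra_simps power2_eq_square)
  have 3: "C [^] (s * z) \<otimes> C = C \<otimes> C [^] (s * z)"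
    using int_pow_commute_closed[of C C "s * z" 1] by simp
  have "W x y z \<otimes> C = A [^] (2 * s * x) \<otimes> (B [^] (2 * s * y) \<otimes> C) \<otimes> C [^] (s * z)"
    using 3 by (simp add: W_def m_assoc)
  also have "\<dots> = (A [^] (2 * s * x) \<otimes> C) \<otimes> (B [^] (2 * s * (y + s * (- 2 * l * y + 4 * s * l ^ 2 * y))) \<otimes> C [^] (s * z))"
    using 2 by (simp add: m_assoc)
  also have "\<dots> = C \<otimes> W (x + 2 * h * x) (y + s * (- 2 * l * y + 4 * s * l ^ 2 * y)) z"
    using 1 by (simp add: W_def m_assoc)
  also have "W (x + 2 * h * x) (y + s * (- 2 * l * y + 4 * s * l ^ 2 * y)) z = W (x + 2 * h * (x + y)) y z"
    unfolding W_period_y by (rule W_cong) (simp add: cong_iff_dvd_diff h_def algebra_simps power2_eq_square)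
  finally show ?thesis .
qed

text \<open>Conjugation by \<open>A\<close> is \<open>1 + \<delta>\<close> with \<open>\<delta>\<^sup>3 = 0\<close>, whence
  the correction to \<open>A\<^sup>n\<close> has the coordinates of \<open>n v\<close> plus
  \<open>n\<close> over \<open>2\<close> times \<open>\<delta> v\<close> plus \<open>n\<close> over \<open>3\<close> times \<open>\<delta>\<^sup>2 v\<close>.\<close>

lemma A_W_pow: "(A \<otimes> W x y z) [^] n = A [^] n \<otimes> W (n * x + tri (n - 1) * (- h * y + (s ^ 2 - h) * z)
    - 2 * tet (n - 1) * (s ^ 2 - h) * y) (n * y) (n * z - 2 * tri (n - 1) * y)"
  (is "_ = _ \<otimes> ?V n")
proof (induction n rule: int_iff_induct)
  case (2 n)
  have t: "tri n = tri (n - 1) + n" "tet n = tet (n - 1) + tri (n - 1)"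
    using tri_Suc[of "n - 1"] tet_Suc[of "n - 1"] by simp_all
  have "?V n \<otimes> (A \<otimes> W x y z) = A \<otimes> ?V (n + 1)"
    by (simp add: W_A W_mult flip: m_assoc) (simp add: W_mult m_assoc t algebra_simps)
  then have "A [^] (n + 1) \<otimes> ?V (n + 1) = A [^] n \<otimes> ?V n \<otimes> (A \<otimes> W x y z)"
    by (simp add: int_pow_mult m_assoc)
  moreover have "(A \<otimes> W x y z) [^] (n + 1) = (A \<otimes> W x y z) [^] n \<otimes> (A \<otimes> W x y z)"
    by (simp add: int_pow_mult)
  ultimately show ?case by simp
qed simp

lemma A_W_pow_D: "(A \<otimes> W x y z) [^] D = \<one>"
proof -
  obtain a b where ab: "tri (D - 1) = 2 * s ^ 3 * a" "tet (D - 1) = 2 * s ^ 3 * b"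
    using D_tri_tet by (meson dvdE)
  define u where "u = D * x + tri (D - 1) * (- h * y + (s ^ 2 - h) * z) - 2 * tet (D - 1) * (s ^ 2 - h) * y"
  have "D * z - 2 * tri (D - 1) * y = 0 + 2 * s * (2 * s ^ 2 * (z - a * y))" "D * y = 0 + s * (4 * s ^ 2 * y)"
    unfolding ab by (simp_all add: D_def algebra_simps power2_eq_square power3_eq_cube)
  then have "W u (D * y) (D * z - 2 * tri (D - 1) * y) = W (u + s ^ 2 * (2 * s ^ 2 * (z - a * y)) - s * (4 * s ^ 2 * y)) 0 0"
    by (simp only: W_period_y W_period_z)
  also have "\<dots> = W 0 0 0"
    unfolding u_def ab
    by (rule W_cong) (simp add: D_def cong_0_iff algebra_simps power2_eq_square power3_eq_cube)
  finally show ?thesis by (simp add: A_W_pow A_pow_D u_def)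
qed

lemma W0_A_pow: "W x 0 z \<otimes> A [^] n = A [^] n \<otimes> W (x + n * (s ^ 2 - h) * z) 0 z"
proof (induction n rule: int_iff_induct)
  case (2 n)
  have "A [^] (n + 1) \<otimes> W (x + (n + 1) * (s ^ 2 - h) * z) 0 z = A [^] n \<otimes> W (x + n * (s ^ 2 - h) * z) 0 z \<otimes> A"
    by (simp add: int_pow_mult m_assoc W_A) (simp add: algebra_simps)
  moreover have "W x 0 z \<otimes> A [^] (n + 1) = W x 0 z \<otimes> A [^] n \<otimes> A"
    by (simp add: int_pow_mult m_assoc)
  ultimately show ?case by simp
qed simp

lemma W_eq_iff: "W x y z = W x' y z \<longleftrightarrow> W (x - x') 0 0 = \<one>"
proof -
  have "W x y z = W (x - x') 0 0 \<otimes> W x' y z" by (simp add: W_mult)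
  then show ?thesis by simp
qed

lemma A_W_C: "A \<otimes> W x y z \<otimes> (C \<otimes> W x' y' z') =
    C \<otimes> (A [^] (1 + 2 * h) \<otimes> W (x + 2 * h * (x + y) + x') (y + y') (z + z'))"
proof -
  have "A \<otimes> W x y z \<otimes> (C \<otimes> W x' y' z') = A \<otimes> (W x y z \<otimes> C) \<otimes> W x' y' z'"
    by (simp add: m_assoc)
  also have "\<dots> = (A \<otimes> C) \<otimes> (W (x + 2 * h * (x + y)) y z \<otimes> W x' y' z')"
    unfolding W_C by (simp add: m_assoc)
  finally show ?thesis unfolding W_mult A_C by (simp add: m_assoc)
qed

text \<open>The correction is the solution \<open>t\<close> of the linear equation
  \<open>(A v) (B w) = (B w) (A v) (C t)\<close>.\<close>

lemma perturbed_commutator: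
  "gcomm G (A \<otimes> W a b k) (B \<otimes> W c d k') =
    C \<otimes> W (h * a + (s ^ 2 - h) * k + h * d - (s ^ 2 - h) * k'
        - 2 * h * (a + b + c + d - h * d + (s ^ 2 - h) * k')) 0 (2 * (a + d))"
proof (rule gcomm_eqI)
  define p where "p = (s ^ 2 - h) * k"
  define p' where "p' = (s ^ 2 - h) * k'"
  have l: "A \<otimes> W a b k \<otimes> (B \<otimes> W c d k') = A \<otimes> B \<otimes> W (a + h * a + p + c) (b + d) (k + 2 * a + k')"
  proof -
    have "A \<otimes> W a b k \<otimes> (B \<otimes> W c d k') = A \<otimes> (W a b k \<otimes> B) \<otimes> W c d k'"
      by (simp add: m_assoc)
    then show ?thesis unfolding W_B by (simp add: m_assoc W_mult p_def)
  qed
  let ?t = "h * a + p + h * d - p' - 2 * h * (a + b + c + d - h * d + p')"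
  have "B \<otimes> W c d k' \<otimes> (A \<otimes> W a b k \<otimes> (C \<otimes> W ?t 0 (2 * (a + d)))) =
      B \<otimes> (W c d k' \<otimes> A) \<otimes> W a b k \<otimes> C \<otimes> W ?t 0 (2 * (a + d))"
    by (simp add: m_assoc)
  also have "\<dots> = B \<otimes> A \<otimes> (W (c - h * d + p' + a) (d + b) (k' - 2 * d + k) \<otimes> C) \<otimes> W ?t 0 (2 * (a + d))"
    unfolding W_A by (simp add: m_assoc W_mult W_mult_left p'_def)
  also have "\<dots> = (B \<otimes> (A \<otimes> C)) \<otimes> W (c - h * d + p' + a + 2 * h * (c - h * d + p' + a + (d + b)) + ?t)
      (d + b) (k' - 2 * d + k + 2 * (a + d))"
    unfolding W_C by (simp add: m_assoc W_mult)
  also have "c - h * d + p' + a + 2 * h * (c - h * d + p' + a + (d + b)) + ?t = a + h * a + p + c"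
    by (simp add: algebra_simps)
  finally show "A \<otimes> W a b k \<otimes> (B \<otimes> W c d k') =
      B \<otimes> W c d k' \<otimes> (A \<otimes> W a b k \<otimes> (C \<otimes> W (h * a + (s ^ 2 - h) * k + h * d - (s ^ 2 - h) * k'
        - 2 * h * (a + b + c + d - h * d + (s ^ 2 - h) * k')) 0 (2 * (a + d))))"
    unfolding l A_B[symmetric] p_def p'_def by (simp add: algebra_simps)
qed simp_all

text \<open>Both sides of \<open>(A v) (C t) = (C t) (A v)\<^sup>\<alpha>\<close> have the form \<open>C A\<^sup>\<alpha> W x b z\<close> with equal \<open>b\<close>
  and \<open>z\<close>, so the relation is one congruence for \<open>x\<close> modulo \<open>2 s\<^sup>2\<close>. Since \<open>l\<close> is odd and \<open>h\<close> is even, all its terms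
  but \<open>2 h (a + d + 2 b)\<close> cancel.\<close>

lemma perturbed_relation_iff:
  "gconj G (A \<otimes> W a b k) (gcomm G (A \<otimes> W a b k) (B \<otimes> W c d k')) = (A \<otimes> W a b k) [^] (1 + 2 ^ m * l)
    \<longleftrightarrow> W (2 * h * (a + d + 2 * b)) 0 0 = \<one>"
proof -
  \<comment> \<open>\<open>C t\<close> is the perturbed commutator, and \<open>v\<close> is the first coordinate of the correction in \<open>(A W)\<^sup>\<alpha>\<close>.\<close>
  define e where "e = s ^ 2 - h"
  define \<alpha> where "\<alpha> = 1 + 2 * h"
  define t where "t = h * a + e * k + h * d - e * k' - 2 * h * (a + b + c + d - h * d + e * k')"
  define v where "v = \<alpha> * a + tri (2 * h) * (- h * b + e * k) - 2 * tet (2 * h) * e * b"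
  have tri: "tri (2 * h) = \<alpha> * h" using tri_double[of "2 * h"] by (simp add: \<alpha>_def algebra_simps)
  have comm: "gcomm G (A \<otimes> W a b k) (B \<otimes> W c d k') = C \<otimes> W t 0 (2 * (a + d))"
    unfolding perturbed_commutator t_def e_def ..
  have pow: "(A \<otimes> W a b k) [^] \<alpha> = A [^] \<alpha> \<otimes> W v (\<alpha> * b) (\<alpha> * k - 2 * tri (2 * h) * b)"
    by (simp add: A_W_pow \<alpha>_def v_def e_def)
  have "C \<otimes> W t 0 (2 * (a + d)) \<otimes> (A \<otimes> W a b k) [^] \<alpha> =
      C \<otimes> (W t 0 (2 * (a + d)) \<otimes> A [^] \<alpha>) \<otimes> W v (\<alpha> * b) (\<alpha> * k - 2 * tri (2 * h) * b)"
    unfolding pow by (simp add: m_assoc)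
  also have "\<dots> = C \<otimes> (A [^] \<alpha> \<otimes> W (t + \<alpha> * e * (2 * (a + d)) + v) (\<alpha> * b) (2 * (a + d) + (\<alpha> * k - 2 * tri (2 * h) * b)))"
    unfolding W0_A_pow by (simp add: m_assoc W_mult e_def)
  also have "\<alpha> * b = b + s * (2 * l * b)" by (simp add: \<alpha>_def h_def algebra_simps)
  also have "2 * (a + d) + (\<alpha> * k - 2 * tri (2 * h) * b) = (k + 2 * (a + d)) + 2 * s * (l * (k - \<alpha> * b))"
    unfolding tri by (simp add: \<alpha>_def h_def algebra_simps)
  finally have r: "C \<otimes> W t 0 (2 * (a + d)) \<otimes> (A \<otimes> W a b k) [^] \<alpha> = C \<otimes> (A [^] \<alpha> \<otimes>
      W (t + \<alpha> * e * (2 * (a + d)) + v + s ^ 2 * (l * (k - \<alpha> * b)) - s * (2 * l * b)) b (k + 2 * (a + d)))"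
    unfolding W_period_y W_period_z \<alpha>_def by (simp add: algebra_simps)
  have "s dvd 3 * tet (2 * h)" unfolding tet_times_3 tri by (simp add: h_def)
  moreover have "coprime 3 s" using coprime_3_N by (simp add: N_def)
  ultimately have "s dvd tet (2 * h)" by (metis coprime_commute coprime_dvd_mult_right_iff)
  then obtain y where y: "tet (2 * h) = s * y" by blast
  obtain u where u: "l * (l + 1) = 2 * u" by (metis tri_double)
  \<comment> \<open>\<open>u\<close> and \<open>w\<close> witness the parities that make the unwanted terms multiples of \<open>2 s\<^sup>2\<close>.\<close>
  have "even (h + l - \<alpha> * l ^ 2)" using odd_l h_even by (simp add: \<alpha>_def)
  then have "even (h * \<alpha> + l - \<alpha> * l ^ 2)" using h_even odd_l by (simp add: \<alpha>_def)
  then obtain w where w: "h * \<alpha> + l - \<alpha> * l ^ 2 = 2 * w" by blast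
  have "a + 2 * h * (a + b) + t - (t + \<alpha> * e * (2 * (a + d)) + v + s ^ 2 * (l * (k - \<alpha> * b)) - s * (2 * l * b)) =
      2 * h * (a + d + 2 * b) + 2 * s ^ 2 * (2 * l ^ 2 * (a + d) - \<alpha> * (a + d) + (s - l) * y * b)
      + s ^ 2 * \<alpha> * b * (l * (l + 1)) - s ^ 2 * k * (h * \<alpha> + l - \<alpha> * l ^ 2)"
    unfolding v_def tri y by (simp add: e_def \<alpha>_def h_def algebra_simps power2_eq_square power3_eq_cube)
  also have "\<dots> = 2 * h * (a + d + 2 * b) + 2 * s ^ 2 * (2 * l ^ 2 * (a + d) - \<alpha> * (a + d) + (s - l) * y * b
      + \<alpha> * b * u - k * w)"
    unfolding u w by (simp add: algebra_simps)
  finally have diff: "W (a + 2 * h * (a + b) + t -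
        (t + \<alpha> * e * (2 * (a + d)) + v + s ^ 2 * (l * (k - \<alpha> * b)) - s * (2 * l * b))) 0 0
      = W (2 * h * (a + d + 2 * b)) 0 0"
    by (intro W_cong) (simp add: cong_iff_dvd_diff)
  have left: "A \<otimes> W a b k \<otimes> (C \<otimes> W t 0 (2 * (a + d))) =
      C \<otimes> (A [^] \<alpha> \<otimes> W (a + 2 * h * (a + b) + t) b (k + 2 * (a + d)))"
    unfolding A_W_C \<alpha>_def by simp
  have cancel: "C \<otimes> (A [^] \<alpha> \<otimes> W x y z) = C \<otimes> (A [^] \<alpha> \<otimes> W x' y z) \<longleftrightarrow> W (x - x') 0 0 = \<one>" for x x' y z
    using W_eq_iff by simp
  show ?thesis
    unfolding comm exponent_alpha \<alpha>_def[symmetric]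
    by (subst gconj_eq_iff) (simp_all only: left r cancel diff W_closed m_closed A_closed C_closed int_pow_closed)
qed

text \<open>The second condition is the mirror image of the first one, and the relations on the orders
  hold for all perturbations.\<close>

lemma perturbed_J_rel_iff:
  "J_rel G m l (A \<otimes> W a b k) (B \<otimes> W c d k') \<longleftrightarrow>
    W (2 * h * (a + d + 2 * b)) 0 0 = \<one> \<and> J_rel.W G m B A (2 * h * (a + d + 2 * c)) 0 0 = \<one>"
proof -
  interpret sw: J_rel G m l B A by (rule swap)
  have ord: "x [^] ((2::nat) ^ (3 * m - 1)) = \<one>" if "x [^] D = \<one>" for x :: 'a
  proof -
    have "D = int (2 ^ (3 * m - 1))" by (simp flip: power_D)
    then show ?thesis using that by (simp only: int_pow_int)
  qed
  have B_W: "B \<otimes> W x y z = B \<otimes> sw.W y x (- z)" for x y z by (simp add: W_swap_eq)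
  have "(B \<otimes> W c d k') [^] D = \<one>" unfolding B_W by (rule sw.A_W_pow_D)
  then have "J_rel G m l (A \<otimes> W a b k) (B \<otimes> W c d k') \<longleftrightarrow>
      gconj G (A \<otimes> W a b k) (gcomm G (A \<otimes> W a b k) (B \<otimes> W c d k')) = (A \<otimes> W a b k) [^] (1 + 2 ^ m * l) \<and>
      gconj G (B \<otimes> W c d k') (gcomm G (B \<otimes> W c d k') (A \<otimes> W a b k)) = (B \<otimes> W c d k') [^] (1 + 2 ^ m * l)"
    using ord[OF A_W_pow_D] ord
    by (auto simp: J_rel_def J_rel_axioms_def is_group scale_axioms)
  moreover have "gconj G (B \<otimes> W c d k') (gcomm G (B \<otimes> W c d k') (A \<otimes> W a b k)) = (B \<otimes> W c d k') [^] (1 + 2 ^ m * l)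
      \<longleftrightarrow> sw.W (2 * h * (d + a + 2 * c)) 0 0 = \<one>"
    using sw.perturbed_relation_iff[of d c "- k'" b a "- k"] by (simp add: W_swap_eq)
  ultimately show ?thesis by (simp add: perturbed_relation_iff add.commute)
qed

end

section \<open>The upper central series\<close>

declare upper_central.simps(2) [simp del]

context group
begin

lemma normal_coset_mult_cong:
  assumes "N \<lhd> G" "N #> x = N #> x'" "N #> y = N #> y'"
    and "x \<in> carrier G" "x' \<in> carrier G" "y \<in> carrier G" "y' \<in> carrier G"
  shows "N #> (x \<otimes> y) = N #> (x' \<otimes> y')"
  using assms by (simp flip: normal.rcos_sum)

lemma normal_coset_cong_left:
  assumes "N \<lhd> G" "N #> y = N #> y'" "x \<in> carrier G" "y \<in> carrier G" "y' \<in> carrier G"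
  shows "N #> (x \<otimes> y) = N #> (x \<otimes> y')"
  using assms by (intro normal_coset_mult_cong) auto

lemma normal_coset_cong_right:
  assumes "N \<lhd> G" "N #> x = N #> x'" "x \<in> carrier G" "x' \<in> carrier G" "y \<in> carrier G"
  shows "N #> (x \<otimes> y) = N #> (x' \<otimes> y)"
  using assms by (intro normal_coset_mult_cong) auto

lemma coset_eq_iff:
  assumes "subgroup N G" "x \<in> carrier G" "y \<in> carrier G"
  shows "N #> x = N #> y \<longleftrightarrow> x \<in> N #> y"
  using assms rcos_self repr_independence by metis

lemma central_coset_iff:
  assumes N: "N \<lhd> G" and x: "x \<in> carrier G"
  shows "N #> x \<in> gcenter (G Mod N) \<longleftrightarrow> (\<forall>g\<in>carrier G. N #> (x \<otimes> g) = N #> (g \<otimes> x))"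
  using x by (auto simp: gcenter_def carrier_FactGroup normal.rcos_sum[OF N])

lemma upper_central_normal: "upper_central G i \<lhd> G"
proof (induction i)
  case 0
  then show ?case by (simp add: one_is_normal upper_central.simps)
next
  case (Suc i)
  define N where "N = upper_central G i"
  have N: "N \<lhd> G" using Suc by (simp add: N_def)
  have sub: "subgroup N G" using N by (rule normal_imp_subgroup)
  have mem: "x \<in> upper_central G (Suc i) \<longleftrightarrow>
      x \<in> carrier G \<and> (\<forall>g\<in>carrier G. N #> (x \<otimes> g) = N #> (g \<otimes> x))" for x
    using central_coset_iff[OF N] by (auto simp: N_def upper_central.simps)
  note cong = normal_coset_cong_left[OF N] normal_coset_cong_right[OF N]
  show ?case
  proof (rule normal_invI)
    show "subgroup (upper_central G (Suc i)) G"
    proof (rule subgroupI)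
      show "upper_central G (Suc i) \<subseteq> carrier G" by (auto simp: mem)
      show "upper_central G (Suc i) \<noteq> {}" using mem[of \<one>] by auto
    next
      fix a assume a: "a \<in> upper_central G (Suc i)"
      then have ac: "a \<in> carrier G" by (simp add: mem)
      have "N #> (inv a \<otimes> g) = N #> (g \<otimes> inv a)" if g: "g \<in> carrier G" for g
      proof -
        have "N #> (inv a \<otimes> (g \<otimes> a \<otimes> inv a)) = N #> (inv a \<otimes> (a \<otimes> g \<otimes> inv a))"
          using a g ac by (intro cong) (auto simp: mem)
        then show ?thesis using g ac by (simp add: m_assoc flip: m_assoc[of "inv a" a])
      qed
      then show "inv a \<in> upper_central G (Suc i)" using ac by (simp add: mem)
    next
      fix a b assume ab: "a \<in> upper_central G (Suc i)" "b \<in> upper_central G (Suc i)"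
      then have c: "a \<in> carrier G" "b \<in> carrier G" by (simp_all add: mem)
      have "N #> (a \<otimes> b \<otimes> g) = N #> (g \<otimes> (a \<otimes> b))" if g: "g \<in> carrier G" for g
      proof -
        have "N #> (a \<otimes> (b \<otimes> g)) = N #> (a \<otimes> (g \<otimes> b))"
          using ab g c by (intro cong) (auto simp: mem)
        also have "\<dots> = N #> (a \<otimes> g \<otimes> b)" using g c by (simp add: m_assoc)
        also have "\<dots> = N #> (g \<otimes> a \<otimes> b)"
          using ab g c by (intro cong) (auto simp: mem)
        finally show ?thesis using g c by (simp add: m_assoc)
      qed
      then show "a \<otimes> b \<in> upper_central G (Suc i)" using c by (simp add: mem)
    qed
  next
    fix x a assume x: "x \<in> carrier G" and a: "a \<in> upper_central G (Suc i)"
    then have ac: "a \<in> carrier G" by (simp add: mem)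
    have e: "N #> (x \<otimes> a \<otimes> inv x) = N #> a"
    proof -
      have "N #> (x \<otimes> a \<otimes> inv x) = N #> (a \<otimes> x \<otimes> inv x)"
        using a x ac by (intro cong) (auto simp: mem)
      then show ?thesis using x ac by (simp add: m_assoc)
    qed
    have "N #> (x \<otimes> a \<otimes> inv x \<otimes> g) = N #> (g \<otimes> (x \<otimes> a \<otimes> inv x))" if g: "g \<in> carrier G" for g
    proof -
      have "N #> (x \<otimes> a \<otimes> inv x \<otimes> g) = N #> (a \<otimes> g)"
        using e x ac g by (intro cong) auto
      also have "\<dots> = N #> (g \<otimes> a)" using a g by (auto simp: mem)
      also have "\<dots> = N #> (g \<otimes> (x \<otimes> a \<otimes> inv x))"
        using e x ac g by (intro cong) auto
      finally show ?thesis .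
    qed
    then show "x \<otimes> a \<otimes> inv x \<in> upper_central G (Suc i)"
      using x ac by (simp add: mem)
  qed
qed

lemma upper_central_Suc_iff:
  "x \<in> upper_central G (Suc i) \<longleftrightarrow>
    x \<in> carrier G \<and> (\<forall>g\<in>carrier G. x \<otimes> g \<in> upper_central G i #> (g \<otimes> x))"
  using central_coset_iff[OF upper_central_normal]
  by (auto simp: upper_central.simps coset_eq_iff[OF normal_imp_subgroup[OF upper_central_normal]])

text \<open>The elements that commute with \<open>x\<close> modulo a normal subgroup form a subgroup.\<close>

lemma upper_central_generators:
  assumes gen: "carrier G = generate G S" and x: "x \<in> carrier G"
    and S: "\<And>g. g \<in> S \<Longrightarrow> x \<otimes> g \<in> upper_central G i #> (g \<otimes> x)"
  shows "x \<in> upper_central G (Suc i)"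
proof -
  define N where "N = upper_central G i"
  have N: "N \<lhd> G" by (simp add: N_def upper_central_normal)
  note sub = normal_imp_subgroup[OF N]
  note cong = normal_coset_cong_left[OF N] normal_coset_cong_right[OF N]
  have Sc: "S \<subseteq> carrier G" using gen generate.incl[of _ S G] by blast
  have S': "N #> (x \<otimes> g) = N #> (g \<otimes> x)" if g: "g \<in> S" for g
  proof -
    have "x \<otimes> g \<in> carrier G" "g \<otimes> x \<in> carrier G" using subsetD[OF Sc g] x by simp_all
    then show ?thesis using coset_eq_iff[OF sub] S[OF g] unfolding N_def by blast
  qed
  have "N #> (x \<otimes> g) = N #> (g \<otimes> x)" if "g \<in> generate G S" for g
    using that
  proof induction
    case one
    then show ?case using x by simp
  next
    case (incl h)
    then show ?case by (rule S')
  next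
    case (inv h)
    then have h: "h \<in> carrier G" using Sc by auto
    have "N #> (inv h \<otimes> (h \<otimes> x \<otimes> inv h)) = N #> (inv h \<otimes> (x \<otimes> h \<otimes> inv h))"
      using S'[OF inv] x h by (intro cong) auto
    then show ?case using x h by (simp add: m_assoc flip: m_assoc[of "inv h" h])
  next
    case (eng h1 h2)
    then have c: "h1 \<in> carrier G" "h2 \<in> carrier G" using gen by auto
    have "N #> (x \<otimes> h1 \<otimes> h2) = N #> (h1 \<otimes> x \<otimes> h2)"
      using eng x c by (intro cong) auto
    also have "\<dots> = N #> (h1 \<otimes> (x \<otimes> h2))" using x c by (simp add: m_assoc)
    also have "\<dots> = N #> (h1 \<otimes> (h2 \<otimes> x))"
      using eng x c by (intro cong) auto
    finally show ?case using x c by (simp add: m_assoc)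
  qed
  then have "x \<otimes> g \<in> N #> (g \<otimes> x)" if "g \<in> carrier G" for g
    using coset_eq_iff[OF sub, of "x \<otimes> g" "g \<otimes> x"] that x gen by blast
  then show ?thesis
    unfolding upper_central_Suc_iff N_def[symmetric] using x by blast
qed

lemma mult_mem_coset:
  assumes "N \<lhd> G" "z \<in> N" "y \<in> carrier G"
  shows "y \<otimes> z \<in> N #> y"
  using normal.coset_eq[OF assms(1)] assms(2,3) by (auto simp: l_coset_def)

end

context scale
begin

text \<open>In \<open>alpha_pow x - 1 = 2 s x l (1 + h (x - 1))\<close> the last two factors are odd.\<close>

lemma alpha_pow_eq_1_imp:
  assumes "[alpha_pow x = 1] (mod 2 * s * M)" "M dvd D"
  shows "M dvd x"
proof -
  have "2 * s * M dvd 2 * s * (x * (l * (1 + h * (x - 1))))"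
    using assms(1) by (simp add: cong_iff_dvd_diff alpha_pow_def h_def algebra_simps power2_eq_square)
  then have "M dvd x * (l * (1 + h * (x - 1)))" using s_pos by simp
  moreover have "odd (l * (1 + h * (x - 1)))" using odd_l h_even by simp
  then have "coprime (l * (1 + h * (x - 1))) D" by (simp flip: power_D)
  then have "coprime M (l * (1 + h * (x - 1)))"
    using assms(2) by (metis coprime_commute coprime_divisors dvd_refl)
  ultimately show ?thesis by (simp add: coprime_dvd_mult_left_iff)
qed

lemma s_dvd_D: "s dvd D" and s_dvd_N: "s dvd N"
  by (simp_all add: D_def N_def power2_eq_square power3_eq_cube)

text \<open>For even \<open>i\<close> the leading term \<open>h i (i + 1)\<close> of the difference has only the factors \<open>s\<close> and
  \<open>i\<close> that may be even.\<close>

lemma alpha_sum_eq_imp: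
  assumes "[alpha_sum i = i] (mod N)" "s dvd i"
  shows "2 * s dvd i"
proof -
  have "N dvd 4 * h ^ 2 * tet i" by (simp add: N_def h_def power_mult_distrib)
  moreover have "alpha_sum i - i = h * (i * (i + 1)) + 4 * h ^ 2 * tet i"
    by (simp add: alpha_sum_def flip: tri_double)
  ultimately have "N dvd h * (i * (i + 1))"
    using assms(1) by (simp add: cong_iff_dvd_diff dvd_add_left_iff)
  then have "s * (2 * s) dvd s * (i * (l * (i + 1)))"
    by (simp add: N_def h_def power2_eq_square mult_ac)
  then have *: "2 * s dvd i * (l * (i + 1))" using s_pos by simp
  have "even i" using assms(2) s_even by auto
  then have "coprime (l * (i + 1)) D" using odd_l by (simp flip: power_D)
  moreover have "2 * s dvd D" by (simp add: D_def power3_eq_cube)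
  ultimately have "coprime (2 * s) (l * (i + 1))"
    by (metis coprime_commute coprime_divisors dvd_refl)
  then show ?thesis using * by (simp add: coprime_dvd_mult_left_iff)
qed

end

text \<open>What is used of the presentation of \<open>J\<close>: the normal form is unique up to the known
  relations, and the universal property holds for endomorphisms.\<close>

locale J_full = J_rel +
  assumes E_unique: "E k j i = E k' j' i' \<Longrightarrow> same_point (k, j, i) (k', j', i')"
    and generated: "carrier G = generate G {A, B}"
    and endo: "J_rel G m l x y \<Longrightarrow> \<exists>f\<in>hom G G. f A = x \<and> f B = y"
begin

lemma normal_form: assumes "g \<in> carrier G" obtains k j i where "g = E k j i"
  using assms generated generated_normal_form by blast

lemma W_E: "W x y z = E (s * z) (2 * s * y) (2 * s * x)"
proof -
  have "W x y z = A [^] (2 * s * x) \<otimes> C [^] (s * z) \<otimes> B [^] (2 * s * y)"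
    unfolding W_def B_2s_C_s by (simp add: m_assoc)
  also have "\<dots> = C [^] (s * z) \<otimes> (A [^] (2 * s * x) \<otimes> B [^] (2 * s * y))"
    unfolding A_2s_C_s by (simp add: m_assoc)
  finally show ?thesis unfolding A_2s_B_2s E_def .
qed

lemma W_unique:
  assumes "W x y z = W x' y' z'"
  shows "2 * s dvd z - z'" "s dvd y - y'" "s dvd x - x'"
proof -
  have r: "same_point (s * z, 2 * s * y, 2 * s * x) (s * z', 2 * s * y', 2 * s * x')"
    using E_unique assms unfolding W_E by blast
  then have "s * (2 * s) dvd s * (z - z')" "2 * s * s dvd 2 * s * (y - y')"
    by (simp_all add: cong_iff_dvd_diff N_def power2_eq_square right_diff_distrib mult_ac)
  then show "2 * s dvd z - z'" "s dvd y - y'" using s_pos by simp_all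
  have "2 * s * s dvd 2 * s * (x - x')" using same_point_imp_N_dvd[OF r]
    by (simp add: cong_iff_dvd_diff N_def power2_eq_square right_diff_distrib mult_ac)
  then show "s dvd x - x'" using s_pos by simp
qed

lemma W_unique_x:
  assumes "W x y z = W x' y z"
  shows "2 * s ^ 2 dvd x - x'"
proof -
  have r: "same_point (s * z, 2 * s * y, 2 * s * x) (s * z, 2 * s * y, 2 * s * x')"
    using E_unique assms unfolding W_E by blast
  then have "(2 * s) * (2 * s ^ 2) dvd (2 * s) * (x - x')"
    by (simp add: cong_iff_dvd_diff D_def power2_eq_square power3_eq_cube right_diff_distrib mult_ac)
  then show ?thesis using s_pos by (metis dvd_mult_cancel_left less_irrefl mult_eq_0_iff zero_neq_numeral)
qed

abbreviation Z :: "nat \<Rightarrow> 'a set" where "Z \<equiv> upper_central G"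

lemma Z_subgroup: "subgroup (Z r) G"
  by (rule normal_imp_subgroup[OF upper_central_normal])

text \<open>The two hypotheses concern the commutators of \<open>W x y z\<close> with \<open>A\<close> and with \<open>B\<close>.\<close>

lemma W_in_Z:
  assumes "W (- h * y + (s ^ 2 - h) * z) 0 (- 2 * y) \<in> Z r" "W (h * x + (s ^ 2 - h) * z) 0 (2 * x) \<in> Z r"
  shows "W x y z \<in> Z (Suc r)"
proof (rule upper_central_generators[OF generated])
  have A: "W x y z \<otimes> A = A \<otimes> W x y z \<otimes> W (- h * y + (s ^ 2 - h) * z) 0 (- 2 * y)"
    unfolding W_A by (simp add: m_assoc W_mult algebra_simps)
  have B: "W x y z \<otimes> B = B \<otimes> W x y z \<otimes> W (h * x + (s ^ 2 - h) * z) 0 (2 * x)"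
    unfolding W_B by (simp add: m_assoc W_mult algebra_simps)
  show "W x y z \<otimes> g \<in> Z r #> (g \<otimes> W x y z)" if "g \<in> {A, B}" for g
    using that A B assms mult_mem_coset[OF upper_central_normal] by auto
qed simp

lemma W_in_Z1: "W (s * x) 0 0 \<in> Z (Suc 0)"
proof -
  obtain u where u: "l + 1 = 2 * u" using odd_l by (metis even_add odd_one dvdE)
  have "W (h * (s * x)) 0 (0 + 2 * s * x) = W (h * (s * x) + s ^ 2 * x) 0 0"
    unfolding W_period_z ..
  also have "h * (s * x) + s ^ 2 * x = s ^ 2 * (l + 1) * x"
    by (simp add: h_def algebra_simps power2_eq_square)
  also have "W (s ^ 2 * (l + 1) * x) 0 0 = W 0 0 0"
    unfolding u by (rule W_cong) (simp add: cong_0_iff)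
  finally show ?thesis by (intro W_in_Z) (simp_all add: mult_ac)
qed

lemma W_in_Z2: "W (s * x) 0 z \<in> Z (Suc (Suc 0))"
proof (rule W_in_Z)
  show "W (- h * 0 + (s ^ 2 - h) * z) 0 (- 2 * 0) \<in> Z (Suc 0)"
    using W_in_Z1[of "(s - l) * z"] by (simp add: h_def algebra_simps power2_eq_square)
  have "W (h * (s * x) + (s ^ 2 - h) * z) 0 (0 + 2 * s * x) = W (s * (h * x + (s - l) * z + s * x)) 0 0"
    unfolding W_period_z by (simp add: h_def algebra_simps power2_eq_square)
  then show "W (h * (s * x) + (s ^ 2 - h) * z) 0 (2 * (s * x)) \<in> Z (Suc 0)"
    using W_in_Z1[of "h * x + (s - l) * z + s * x"] by (simp add: mult.assoc mult.left_commute)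
qed

lemma W_in_Z3: "W x y z \<in> Z (Suc (Suc (Suc 0)))"
proof (rule W_in_Z)
  show "W (- h * y + (s ^ 2 - h) * z) 0 (- 2 * y) \<in> Z (Suc (Suc 0))"
    using W_in_Z2[of "- l * y + (s - l) * z" "- 2 * y"] by (simp add: h_def algebra_simps power2_eq_square)
  show "W (h * x + (s ^ 2 - h) * z) 0 (2 * x) \<in> Z (Suc (Suc 0))"
    using W_in_Z2[of "l * x + (s - l) * z" "2 * x"] by (simp add: h_def algebra_simps power2_eq_square)
qed

text \<open>If \<open>g = E k j i\<close> commutes with \<open>B\<close> modulo a term of the series, then the normal forms of
  \<open>g B\<close> and \<open>B g\<close> can be compared; this restricts \<open>k\<close> and \<open>i\<close>. The companion for \<open>A\<close> restricts \<open>j\<close>.\<close>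

lemma in_Z_Suc_B:
  assumes "E k j i \<in> Z (Suc r)"
  obtains z where "z \<in> Z r" "E (k + i) ((j + 1) * alpha_pow (- i)) (alpha_sum i) = z \<otimes> E k (alpha_pow (- k) + j) i"
proof -
  have "E k j i \<otimes> B \<in> Z r #> (B \<otimes> E k j i)"
    using assms unfolding upper_central_Suc_iff by auto
  then show ?thesis using that unfolding E_B B_E by (auto simp: r_coset_def)
qed

lemma in_Z_Suc_A:
  assumes "B [^] j \<in> Z (Suc r)"
  obtains z where "z \<in> Z r" "E (- j) (alpha_sum j) 0 = z \<otimes> E 0 j 0"
proof -
  have "B [^] j \<otimes> A \<in> Z r #> (A \<otimes> B [^] j)"
    using assms unfolding upper_central_Suc_iff by auto
  then obtain w where w: "w \<in> Z r" "A \<otimes> E (- j) (alpha_sum j) 0 = w \<otimes> (A \<otimes> B [^] j)"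
    unfolding B_pow_A by (auto simp: r_coset_def E_def)
  have wc: "w \<in> carrier G" using w(1) subgroup.subset[OF Z_subgroup] by blast
  have "E (- j) (alpha_sum j) 0 = inv A \<otimes> (A \<otimes> E (- j) (alpha_sum j) 0)" by (simp flip: m_assoc)
  also have "\<dots> = (inv A \<otimes> w \<otimes> A) \<otimes> E 0 j 0"
    unfolding w(2) using wc by (simp add: E_def m_assoc)
  finally show ?thesis
    using that normal.inv_op_closed1[OF upper_central_normal _ w(1), of A] by simp
qed

lemma peel_B:
  assumes "E k j i \<in> Z r" "C [^] k \<in> Z r" "A [^] i \<in> Z r"
  shows "B [^] j \<in> Z r"
proof -
  have "B [^] j = inv (C [^] k) \<otimes> E k j i \<otimes> inv (A [^] i)"
    by (simp add: E_def m_assoc flip: m_assoc[of "inv (C [^] k)"])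
  then show ?thesis
    using assms subgroup.m_closed[OF Z_subgroup] subgroup.m_inv_closed[OF Z_subgroup] by simp
qed

lemma W_powers: "A [^] (2 * s * x) = W x 0 0" "B [^] (2 * s * y) = W 0 y 0" "C [^] (s * z) = W 0 0 z"
  by (simp_all add: W_def)

lemma N_powers: "A [^] (N * x) = W (s * x) 0 0" "B [^] (N * x) = W (- (s * x)) 0 0" 
  "C [^] (N * x) = W (s ^ 2 * x) 0 0"
proof -
  show 1: "A [^] (N * x) = W (s * x) 0 0" for x
    unfolding N_def_s by (simp add: W_def mult_ac)
  show "B [^] (N * x) = W (- (s * x)) 0 0" using 1[of "- x"] by (simp add: B_pow_N)
  show "C [^] (N * x) = W (s ^ 2 * x) 0 0"
    unfolding C_pow_N using 1[of "s * x"] by (simp add: mult_ac power2_eq_square)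
qed

text \<open>The same three steps lead to \<open>Z1_eq\<close>, \<open>Z2_eq\<close> and \<open>Z3_eq\<close>. Commuting with \<open>B\<close> modulo the previous
  term puts \<open>i\<close> and \<open>k\<close> in the claimed range; then \<open>C\<^sup>k\<close> and \<open>A\<^sup>i\<close> belong to the term and can be split off; finally
  commuting of \<open>B\<^sup>j\<close> with \<open>A\<close> puts \<open>j\<close> in the claimed range.\<close>

lemma Z1_eq: "Z (Suc 0) = {W (s * x) 0 0 |x. True}"
proof (intro equalityI subsetI)
  fix g assume g: "g \<in> Z (Suc 0)"
  then have "g \<in> carrier G" using subgroup.subset[OF Z_subgroup] by blast
  then obtain k j i where e: "g = E k j i" by (rule normal_form)
  obtain z where "z \<in> Z 0" "E (k + i) ((j + 1) * alpha_pow (- i)) (alpha_sum i) = z \<otimes> E k (alpha_pow (- k) + j) i"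
    using g e in_Z_Suc_B by metis
  then have sm: "same_point (k + i, (j + 1) * alpha_pow (- i), alpha_sum i) (k, alpha_pow (- k) + j, i)"
    by (intro E_unique) simp
  then have i: "N dvd i" by (simp add: cong_iff_dvd_diff)
  have a: "[alpha_pow (- i) = 1] (mod D)" using alpha_pow_cong_N[of "- i" 0] i by (simp add: cong_0_iff)
  have "[alpha_sum i = i + s * i] (mod D)" using alpha_sum_cong_N[OF i, of 0] by (simp add: alpha_sum_def)
  then have "[alpha_sum i - (j + 1) * alpha_pow (- i) - s * (k + i) = i + s * i - (j + 1) * 1 - s * (k + i)] (mod D)"
    by (intro cong_diff cong_scalar_left a cong_refl)
  then have "[i + s * i - (j + 1) * 1 - s * (k + i) = i - (alpha_pow (- k) + j) - s * k] (mod D)"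
    using sm by (meson cong_sym cong_trans same_point.simps)
  then have "[alpha_pow (- k) = 1] (mod 2 * s * N)"
    by (simp add: cong_iff_dvd_diff D_def_s algebra_simps)
  then have k: "N dvd k" using alpha_pow_eq_1_imp[of "- k" N] N_dvd_D by simp
  obtain i' k' where ik: "i = N * i'" "k = N * k'" using i k by blast
  have "B [^] j \<in> Z (Suc 0)"
    using g W_in_Z1[of i'] W_in_Z1[of "s * k'"] unfolding e ik
    by (intro peel_B[of "N * k'" _ "N * i'"]) (simp_all only: N_powers power2_eq_square mult.assoc)
  then obtain w where "w \<in> Z 0" "E (- j) (alpha_sum j) 0 = w \<otimes> E 0 j 0" by (rule in_Z_Suc_A)
  then have "same_point (- j, alpha_sum j, 0) (0, j, 0)" by (intro E_unique) simp
  then have "N dvd j" by (simp add: cong_0_iff)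
  then obtain j' where j: "j = N * j'" by blast
  have "g = W (s * (s * k' - j' + i')) 0 0"
    unfolding e E_def ik j N_powers by (simp add: W_mult algebra_simps power2_eq_square)
  then show "g \<in> {W (s * x) 0 0 |x. True}" by blast
qed (use W_in_Z1 in blast)

lemma W_s_E: "W (s * x) 0 z \<otimes> E k j i = E (k + s * z) j (i + N * x)"
proof -
  have AB: "A [^] (N * x) \<otimes> B [^] j = B [^] j \<otimes> A [^] (N * x)"
    using int_pow_commute_closed[of "A [^] (N * x)" B 1 j] A_pow_N_B by simp
  have AC: "A [^] (N * x) \<otimes> C [^] k = C [^] k \<otimes> A [^] (N * x)" for k :: int
    using int_pow_commute_closed[of "A [^] (N * x)" C 1 k] A_pow_N_C by simp
  have "W (s * x) 0 z = A [^] (N * x) \<otimes> C [^] (s * z)"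
    unfolding N_powers by (simp add: W_powers W_mult)
  then have "W (s * x) 0 z \<otimes> E k j i = A [^] (N * x) \<otimes> C [^] (k + s * z) \<otimes> (B [^] j \<otimes> A [^] i)"
    by (simp add: E_def m_assoc int_pow_mult_left add.commute)
  also have "\<dots> = C [^] (k + s * z) \<otimes> ((A [^] (N * x) \<otimes> B [^] j) \<otimes> A [^] i)"
    unfolding AC by (simp add: m_assoc)
  finally show ?thesis unfolding AB by (simp add: E_def m_assoc int_pow_mult' add.commute)
qed

lemma Z2_eq: "Z (Suc (Suc 0)) = {W (s * x) 0 z |x z. True}"
proof (intro equalityI subsetI)
  fix g assume g: "g \<in> Z (Suc (Suc 0))"
  then have "g \<in> carrier G" using subgroup.subset[OF Z_subgroup] by blast
  then obtain k j i where e: "g = E k j i" by (rule normal_form)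
  obtain z where "z \<in> Z (Suc 0)" "E (k + i) ((j + 1) * alpha_pow (- i)) (alpha_sum i) = z \<otimes> E k (alpha_pow (- k) + j) i"
    using g e in_Z_Suc_B by metis
  then obtain x where "E (k + i) ((j + 1) * alpha_pow (- i)) (alpha_sum i) = E k (alpha_pow (- k) + j) (i + N * x)"
    unfolding Z1_eq using W_s_E[of _ 0] by auto
  then have sm: "same_point (k + i, (j + 1) * alpha_pow (- i), alpha_sum i) (k, alpha_pow (- k) + j, i + N * x)" by (rule E_unique)
  then have i: "N dvd i" by (simp add: cong_iff_dvd_diff)
  have a: "[alpha_pow (- i) = 1] (mod D)" using alpha_pow_cong_N[of "- i" 0] i by (simp add: cong_0_iff)
  have "[(j + 1) * alpha_pow (- i) = (j + 1) * 1] (mod N)"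
    using a N_dvd_D by (intro cong_scalar_left) (rule cong_dvd_modulus)
  then have "[(j + 1) * 1 = alpha_pow (- k) + j] (mod N)"
    using sm by (meson cong_sym cong_trans same_point.simps)
  then have "[alpha_pow (- k) = 1] (mod 2 * s * s)"
    by (simp add: cong_iff_dvd_diff N_def power2_eq_square dvd_diff_commute mult.assoc)
  then have k: "s dvd k" using alpha_pow_eq_1_imp[of "- k" s] s_dvd_D by simp
  obtain i' k' where ik: "i = N * i'" "k = s * k'" using i k by blast
  have "B [^] j \<in> Z (Suc (Suc 0))"
    using g W_in_Z2[of i' 0] W_in_Z2[of 0 k'] unfolding e
    by (intro peel_B) (auto simp: ik N_powers W_powers)
  then obtain w where "w \<in> Z (Suc 0)" "E (- j) (alpha_sum j) 0 = w \<otimes> E 0 j 0" by (rule in_Z_Suc_A)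
  then obtain x where "E (- j) (alpha_sum j) 0 = E 0 j (N * x)"
    unfolding Z1_eq using W_s_E[of _ 0] by auto
  then have "same_point (- j, alpha_sum j, 0) (0, j, N * x)" by (rule E_unique)
  then have "N dvd j" by (simp add: cong_0_iff)
  then obtain j' where j: "j = N * j'" by blast
  have "g = W (s * (i' - j')) 0 k'"
    unfolding e E_def ik j N_powers W_powers by (simp add: W_mult algebra_simps)
  then show "g \<in> {W (s * x) 0 z |x z. True}" by blast
qed (use W_in_Z2 in blast)

lemma Z3_eq: "Z (Suc (Suc (Suc 0))) = {W x y z |x y z. True}"
proof (intro equalityI subsetI)
  fix g assume g: "g \<in> Z (Suc (Suc (Suc 0)))"
  then have "g \<in> carrier G" using subgroup.subset[OF Z_subgroup] by blast
  then obtain k j i where e: "g = E k j i" by (rule normal_form)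
  obtain z where "z \<in> Z (Suc (Suc 0))" "E (k + i) ((j + 1) * alpha_pow (- i)) (alpha_sum i) = z \<otimes> E k (alpha_pow (- k) + j) i"
    using g e in_Z_Suc_B by metis
  then obtain x y where "E (k + i) ((j + 1) * alpha_pow (- i)) (alpha_sum i) = E (k + s * y) (alpha_pow (- k) + j) (i + N * x)"
    unfolding Z2_eq using W_s_E by auto
  then have sm: "same_point (k + i, (j + 1) * alpha_pow (- i), alpha_sum i) (k + s * y, alpha_pow (- k) + j, i + N * x)" by (rule E_unique)
  then have "[i = s * y] (mod N)" by (simp add: cong_add_lcancel)
  then have "s dvd i" using s_dvd_N by (metis cong_dvd_iff cong_dvd_modulus dvd_triv_left)
  moreover have "[alpha_sum i = i] (mod N)"
    using same_point_imp_N_dvd[OF sm] by (simp add: cong_iff_dvd_diff flip: diff_diff_eq)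
      (metis dvd_diff_left_iff dvd_triv_left)
  ultimately have i: "2 * s dvd i" by (intro alpha_sum_eq_imp)
  then obtain i' where i': "i = 2 * s * i'" by blast
  have "alpha_pow (- i) - 1 = N * (- 2 * l * i' + 2 * l * h * i' * (2 * s * i' + 1))"
    by (simp add: alpha_pow_def i' h_def N_def algebra_simps power2_eq_square)
  then have a: "[alpha_pow (- i) = 1] (mod N)" by (simp add: cong_iff_dvd_diff)
  have "[(j + 1) * alpha_pow (- i) = (j + 1) * 1] (mod N)" by (intro cong_scalar_left a)
  then have "[(j + 1) * 1 = alpha_pow (- k) + j] (mod N)"
    using sm by (meson cong_sym cong_trans same_point.simps)
  then have "[alpha_pow (- k) = 1] (mod 2 * s * s)"
    by (simp add: cong_iff_dvd_diff N_def power2_eq_square dvd_diff_commute mult.assoc)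
  then have k: "s dvd k" using alpha_pow_eq_1_imp[of "- k" s] s_dvd_D by simp
  then obtain k' where k': "k = s * k'" by blast
  have "B [^] j \<in> Z (Suc (Suc (Suc 0)))"
    using g W_in_Z3[of i' 0 0] W_in_Z3[of 0 0 k'] unfolding e
    by (intro peel_B) (auto simp: i' k' W_powers)
  then obtain w where "w \<in> Z (Suc (Suc 0))" "E (- j) (alpha_sum j) 0 = w \<otimes> E 0 j 0" by (rule in_Z_Suc_A)
  then obtain x y where "E (- j) (alpha_sum j) 0 = E (s * y) j (N * x)"
    unfolding Z2_eq using W_s_E by auto
  then have sm: "same_point (- j, alpha_sum j, 0) (s * y, j, N * x)" by (rule E_unique)
  then have "[- j = s * y] (mod N)" by simp
  then have "s dvd - j" using s_dvd_N by (metis cong_dvd_iff cong_dvd_modulus dvd_triv_left)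
  then have "2 * s dvd j" using sm by (intro alpha_sum_eq_imp) simp_all
  then obtain j' where j: "j = 2 * s * j'" by blast
  have "g = W i' j' k'"
    unfolding e i' k' j E_def W_powers by (simp add: W_mult)
  then show "g \<in> {W x y z |x y z. True}" by blast
qed (use W_in_Z3 in blast)

end

section \<open>Automorphisms that are trivial modulo the upper central series\<close>

context group
begin

lemma carrier_AutoGroup [simp]: "carrier (AutoGroup G) = auto G"
  by (simp add: AutoGroup_def)

lemma AutoGroup_mult_apply:
  "f \<in> auto G \<Longrightarrow> g \<in> auto G \<Longrightarrow> x \<in> carrier G \<Longrightarrow> (f \<otimes>\<^bsub>AutoGroup G\<^esub> g) x = f (g x)"
  by (simp add: AutoGroup_def BijGroup_def auto_def compose_def)

lemma auto_mult_closed: "f \<in> auto G \<Longrightarrow> g \<in> auto G \<Longrightarrow> f \<otimes>\<^bsub>AutoGroup G\<^esub> g \<in> auto G"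
  using monoid.m_closed[OF group.is_monoid[OF AutoGroup]] by simp

lemma auto_inv_closed: "f \<in> auto G \<Longrightarrow> inv\<^bsub>AutoGroup G\<^esub> f \<in> auto G"
  using group.inv_closed[OF AutoGroup] by simp

lemma AutoGroup_one: "\<one>\<^bsub>AutoGroup G\<^esub> = (\<lambda>x\<in>carrier G. x)"
  by (simp add: AutoGroup_def BijGroup_def)

lemma auto_hom: "f \<in> auto G \<Longrightarrow> f \<in> hom G G"
  by (simp add: auto_def)

lemma auto_group_hom: "f \<in> auto G \<Longrightarrow> group_hom G G f"
  by (simp add: auto_hom group_hom_axioms_def group_hom_def is_group)

lemma auto_closed: "f \<in> auto G \<Longrightarrow> x \<in> carrier G \<Longrightarrow> f x \<in> carrier G"
  using auto_hom[of f] hom_in_carrier[of f G G x] by simp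

lemma auto_bij: "f \<in> auto G \<Longrightarrow> bij_betw f (carrier G) (carrier G)"
  by (simp add: auto_def Bij_def)

lemma auto_eqI:
  "f \<in> auto G \<Longrightarrow> g \<in> auto G \<Longrightarrow> (\<And>x. x \<in> carrier G \<Longrightarrow> f x = g x) \<Longrightarrow> f = g"
  by (auto simp: auto_def Bij_def intro: extensionalityI)

lemma restrict_hom_auto:
  assumes f: "f \<in> hom G G" and inj: "inj_on f (carrier G)" and fin: "finite (carrier G)"
  shows "restrict f (carrier G) \<in> auto G"
proof -
  have "f ` carrier G \<subseteq> carrier G" using f by (auto simp: hom_def)
  then have "bij_betw f (carrier G) (carrier G)"
    using inj fin by (simp add: bij_betw_def endo_inj_surj)
  moreover have "restrict f (carrier G) \<in> hom G G"
    using f by (auto simp: hom_def)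
  ultimately show ?thesis by (simp add: auto_def Bij_def bij_betw_restrict_eq)
qed

lemma hom_coset_closed:
  assumes N: "N \<lhd> G" and f: "f \<in> hom G G" and S: "S \<subseteq> carrier G"
    and gen: "\<And>x. x \<in> S \<Longrightarrow> N #> f x = N #> x" and x: "x \<in> generate G S"
  shows "N #> f x = N #> x"
proof -
  interpret f: group_hom G G f using f by (simp add: group_hom_axioms_def group_hom_def is_group)
  show ?thesis using x
  proof induction
    case (inv h)
    then have h: "h \<in> carrier G" using S by auto
    have "N #> inv (f h) = N #> (inv h \<otimes> h \<otimes> inv (f h))" using h by simp
    also have "\<dots> = N #> (inv h \<otimes> f h \<otimes> inv (f h))"
      using gen[OF inv] h
      by (intro normal_coset_cong_right[OF N] normal_coset_cong_left[OF N]) auto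
    finally show ?case using h by (simp add: m_assoc)
  next
    case (eng h1 h2)
    then have "h1 \<in> carrier G" "h2 \<in> carrier G"
      using generate_in_carrier[OF S, of h1] generate_in_carrier[OF S, of h2] by simp_all
    then show ?case
      using normal_coset_mult_cong[OF N eng.IH] by (simp only: f.hom_mult f.hom_closed)
  qed (use gen in simp_all)
qed

text \<open>On a finite group, an injective map that sends a coset into itself sends it onto itself.\<close>

lemma Aut_ker_iff:
  assumes fin: "finite (carrier G)"
  shows "f \<in> Aut_ker G i \<longleftrightarrow>
    f \<in> auto G \<and> (\<forall>x\<in>carrier G. upper_central G i #> f x = upper_central G i #> x)"
proof -
  define N where "N = upper_central G i"
  have N: "N \<lhd> G" by (simp add: N_def upper_central_normal)
  note sub = normal_imp_subgroup[OF N]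
  have Nc: "N \<subseteq> carrier G" using sub by (rule subgroup.subset)
  have one: "\<one>\<^bsub>AutoGroup (G Mod N)\<^esub> = (\<lambda>K\<in>carrier (G Mod N). K)"
    by (simp add: AutoGroup_def BijGroup_def)
  have "quot_aut G N f = (\<lambda>K\<in>carrier (G Mod N). K) \<longleftrightarrow> (\<forall>x\<in>carrier G. f ` (N #> x) = N #> x)"
    by (auto simp: quot_aut_def carrier_FactGroup fun_eq_iff restrict_def)
  also have "\<dots> \<longleftrightarrow> (\<forall>x\<in>carrier G. N #> f x = N #> x)" if f: "f \<in> auto G"
  proof
    assume *: "\<forall>x\<in>carrier G. f ` (N #> x) = N #> x"
    show "\<forall>x\<in>carrier G. N #> f x = N #> x"
    proof
      fix x assume x: "x \<in> carrier G"
      have "f x \<in> N #> x" using * x rcos_self[OF x sub] by blast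
      then show "N #> f x = N #> x" using coset_eq_iff[OF sub] auto_closed[OF f] x by blast
    qed
  next
    assume *: "\<forall>x\<in>carrier G. N #> f x = N #> x"
    show "\<forall>x\<in>carrier G. f ` (N #> x) = N #> x"
    proof
      fix x assume x: "x \<in> carrier G"
      have sub_c: "N #> x \<subseteq> carrier G" using Nc x by (rule r_coset_subset_G)
      have "f y \<in> N #> x" if y: "y \<in> N #> x" for y
      proof -
        have yc: "y \<in> carrier G" using y sub_c by blast
        then have "N #> f y = N #> x" using * y x coset_eq_iff[OF sub] by blast
        then show ?thesis using rcos_self[OF auto_closed[OF f yc] sub] by simp
      qed
      then have "f ` (N #> x) \<subseteq> N #> x" by blast
      moreover have "inj_on f (N #> x)"
        using auto_bij[OF f] sub_c by (meson bij_betw_def inj_on_subset)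
      ultimately show "f ` (N #> x) = N #> x"
        using finite_subset[OF sub_c fin] by (simp add: endo_inj_surj)
    qed
  qed
  finally show ?thesis
    unfolding Aut_ker_def kernel_def N_def[symmetric] one by auto
qed

lemma Aut_ker_generators_iff:
  assumes fin: "finite (carrier G)" and gen: "carrier G = generate G S"
  shows "f \<in> Aut_ker G i \<longleftrightarrow>
    f \<in> auto G \<and> (\<forall>x\<in>S. upper_central G i #> f x = upper_central G i #> x)"
proof -
  have S: "S \<subseteq> carrier G" using gen generate.incl[of _ S G] by blast
  show ?thesis
    unfolding Aut_ker_iff[OF fin]
    using hom_coset_closed[OF upper_central_normal auto_hom S] S gen by blast
qed

lemma Aut_ker_subgroup:
  assumes fin: "finite (carrier G)"
  shows "subgroup (Aut_ker G i) (AutoGroup G)"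
proof -
  interpret Aut: group "AutoGroup G" by (rule AutoGroup)
  note iff = Aut_ker_iff[OF fin, of _ i]
  have mult: "f \<otimes>\<^bsub>AutoGroup G\<^esub> g \<in> Aut_ker G i" if "f \<in> Aut_ker G i" "g \<in> Aut_ker G i" for f g
    using that Aut.m_closed[of f g] auto_closed by (auto simp: iff AutoGroup_mult_apply)
  show ?thesis
  proof (rule Aut.subgroupI)
    show "Aut_ker G i \<subseteq> carrier (AutoGroup G)" by (auto simp: iff)
    have "\<one>\<^bsub>AutoGroup G\<^esub> \<in> Aut_ker G i" using Aut.one_closed by (simp add: iff AutoGroup_one)
    then show "Aut_ker G i \<noteq> {}" by blast
  next
    fix f assume f: "f \<in> Aut_ker G i"
    then have fc: "f \<in> auto G" by (simp add: iff)
    then have ic: "inv\<^bsub>AutoGroup G\<^esub> f \<in> auto G" using Aut.inv_closed by simp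
    have "upper_central G i #> (inv\<^bsub>AutoGroup G\<^esub> f) x = upper_central G i #> x" if x: "x \<in> carrier G" for x
    proof -
      have "f ((inv\<^bsub>AutoGroup G\<^esub> f) x) = x"
        using Aut.r_inv[of f] fc ic x by (simp flip: AutoGroup_mult_apply add: AutoGroup_one)
      then show ?thesis using f auto_closed[OF ic x] by (metis iff)
    qed
    then show "inv\<^bsub>AutoGroup G\<^esub> f \<in> Aut_ker G i" using ic by (simp add: iff)
  qed (use mult in blast)
qed

lemma inner_aut_apply: "x \<in> carrier G \<Longrightarrow> inner_aut G g x = inv g \<otimes> x \<otimes> g"
  by (simp add: inner_aut_def gconj_def)

lemma inner_aut_auto: "g \<in> carrier G \<Longrightarrow> inner_aut G g \<in> auto G"
proof -
  assume g: "g \<in> carrier G"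
  have "inner_aut G g \<in> hom G G"
    using g by (auto simp: hom_def inner_aut_apply m_assoc) (simp flip: m_assoc)
  moreover have "bij_betw (inner_aut G g) (carrier G) (carrier G)"
  proof (rule bij_betwI[where g = "inner_aut G (inv g)"])
    show "inner_aut G (inv g) (inner_aut G g x) = x" "inner_aut G g (inner_aut G (inv g) x) = x"
      if "x \<in> carrier G" for x
      using that g by (simp_all add: inner_aut_apply m_assoc) (simp_all flip: m_assoc)
  qed (use g in \<open>auto simp: inner_aut_apply\<close>)
  ultimately show ?thesis by (simp add: auto_def Bij_def inner_aut_def)
qed

lemma inner_aut_mult:
  "g \<in> carrier G \<Longrightarrow> k \<in> carrier G \<Longrightarrow>
    inner_aut G g \<otimes>\<^bsub>AutoGroup G\<^esub> inner_aut G k = inner_aut G (k \<otimes> g)"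
  by (rule auto_eqI)
    (simp_all add: auto_mult_closed inner_aut_auto AutoGroup_mult_apply
      inner_aut_apply inv_mult_group m_assoc)

text \<open>This is \<open>f (g\<^sup>-\<^sup>1 x g) = f(g)\<^sup>-\<^sup>1 f(x) f(g)\<close>; it makes the inner automorphisms a normal subgroup.\<close>

lemma auto_inner_aut:
  assumes f: "f \<in> auto G" and g: "g \<in> carrier G"
  shows "f \<otimes>\<^bsub>AutoGroup G\<^esub> inner_aut G g = inner_aut G (f g) \<otimes>\<^bsub>AutoGroup G\<^esub> f"
proof -
  interpret f: group_hom G G f by (rule auto_group_hom[OF f])
  show ?thesis
    using f g by (intro auto_eqI) (simp_all add: auto_mult_closed
      inner_aut_auto AutoGroup_mult_apply inner_aut_apply)
qed

lemma Inn_normal: "Inn G \<lhd> AutoGroup G"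
proof -
  interpret Aut: group "AutoGroup G" by (rule AutoGroup)
  have inv: "inv\<^bsub>AutoGroup G\<^esub> (inner_aut G g) = inner_aut G (inv g)" if g: "g \<in> carrier G" for g
  proof (rule Aut.inv_equality)
    have "inner_aut G \<one> = \<one>\<^bsub>AutoGroup G\<^esub>"
      by (auto simp: inner_aut_def gconj_def AutoGroup_one fun_eq_iff restrict_def)
    then show "inner_aut G (inv g) \<otimes>\<^bsub>AutoGroup G\<^esub> inner_aut G g = \<one>\<^bsub>AutoGroup G\<^esub>"
      using g by (simp add: inner_aut_mult)
  qed (use g in \<open>simp_all add: inner_aut_auto\<close>)
  have "subgroup (Inn G) (AutoGroup G)"
  proof (rule Aut.subgroupI)
    show "Inn G \<subseteq> carrier (AutoGroup G)" by (auto simp: Inn_def inner_aut_auto)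
    show "Inn G \<noteq> {}" by (auto simp: Inn_def)
  qed (auto simp: Inn_def inv inner_aut_mult)
  then show ?thesis
  proof (rule Aut.normal_invI)
    fix f a assume f: "f \<in> carrier (AutoGroup G)" and a: "a \<in> Inn G"
    then obtain g where g: "g \<in> carrier G" "a = inner_aut G g" by (auto simp: Inn_def)
    have "f \<otimes>\<^bsub>AutoGroup G\<^esub> a \<otimes>\<^bsub>AutoGroup G\<^esub> inv\<^bsub>AutoGroup G\<^esub> f = inner_aut G (f g)"
      using f g auto_closed[of f g] by (simp add: auto_inner_aut inner_aut_auto auto_inv_closed Aut.m_assoc)
    then show "f \<otimes>\<^bsub>AutoGroup G\<^esub> a \<otimes>\<^bsub>AutoGroup G\<^esub> inv\<^bsub>AutoGroup G\<^esub> f \<in> Inn G"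
      using f g auto_closed[of f g] by (simp add: Inn_def)
  qed
qed

text \<open>As long as an element of \<open>K\<close> is not central, some commutator with it is a nontrivial
  element of \<open>K\<close> one step further down the series.\<close>

lemma normal_meets_center:
  assumes K: "K \<lhd> G" and x: "x \<in> K" "x \<noteq> \<one>" "x \<in> upper_central G r"
  shows "\<exists>y\<in>K. y \<noteq> \<one> \<and> y \<in> upper_central G (Suc 0)"
  using x
proof (induction r arbitrary: x)
  case (Suc r)
  note Ks = normal_imp_subgroup[OF K]
  have xc: "x \<in> carrier G" using Suc.prems Ks by (meson subgroup.mem_carrier)
  show ?case
  proof (cases "\<forall>g\<in>carrier G. x \<otimes> g = g \<otimes> x")
    case True
    then have "x \<in> upper_central G (Suc 0)"
      unfolding upper_central_Suc_iff using xc by (auto simp: r_coset_def)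
    then show ?thesis using Suc.prems by blast
  next
    case False
    then obtain g where g: "g \<in> carrier G" "x \<otimes> g \<noteq> g \<otimes> x" by blast
    define y where "y = x \<otimes> g \<otimes> inv (g \<otimes> x)"
    have "x \<otimes> g \<in> upper_central G r #> (g \<otimes> x)"
      using Suc.prems g unfolding upper_central_Suc_iff by blast
    then obtain z where z: "z \<in> upper_central G r" "x \<otimes> g = z \<otimes> (g \<otimes> x)" by (auto simp: r_coset_def)
    have zc: "z \<in> carrier G"
      using z subgroup.mem_carrier[OF normal_imp_subgroup[OF upper_central_normal]] by blast
    have "y = z" unfolding y_def z(2) using zc g xc by (simp add: m_assoc)
    moreover have "y \<noteq> \<one>" using g xc by (simp add: y_def inv_solve_right')
    moreover have "y = x \<otimes> (g \<otimes> inv x \<otimes> inv g)"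
      using g xc by (simp add: y_def inv_mult_group m_assoc)
    then have "y \<in> K"
      using Suc.prems g K Ks by (simp add: subgroup.m_closed subgroup.m_inv_closed normal.inv_op_closed2)
    ultimately show ?thesis using Suc.IH z by blast
  qed
qed simp

end

section \<open>The quotient of \<open>Aut\<^sub>3\<close> by \<open>Aut\<^sub>2\<close>\<close>

context J_rel
begin

text \<open>Modulo the second centre, which consists of the \<open>W (s x) 0 z\<close>, the power is \<open>W 1 0 0 = A\<^sup>2\<^sup>s\<close>:
  perturbing \<open>A\<close> has no effect there.\<close>

lemma A_W_pow_2s: "\<exists>X Y z'. (A \<otimes> W a b k) [^] (2 * s) = W (1 + s * X) (s * Y) z'"
proof -
  have t: "tri (2 * s - 1) = s * (2 * s - 1)"
    using tri_double[of "2 * s - 1"] by (simp add: algebra_simps)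
  define e where "e = s - l"
  have e: "s ^ 2 - h = s * e" by (simp add: e_def h_def algebra_simps power2_eq_square)
  have A: "A [^] (2 * s) = W 1 0 0" by (simp add: W_def)
  have "(A \<otimes> W a b k) [^] (2 * s) =
    W (1 + s * (2 * a + (2 * s - 1) * (- h * b + s * e * k) - 2 * tet (2 * s - 1) * e * b)) (s * (2 * b))
      (2 * s * k - 2 * (s * (2 * s - 1)) * b)"
    unfolding A_W_pow t e A W_mult by (simp add: algebra_simps)
  then show ?thesis by blast
qed

lemma B_W_pow_2s: "\<exists>X Y z'. (B \<otimes> W c d k) [^] (2 * s) = W (s * X) (1 + s * Y) z'"
proof -
  interpret sw: J_rel G m l B A by (rule swap)
  have "B \<otimes> W c d k = B \<otimes> sw.W d c (- k)" by (simp add: W_swap_eq)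
  then obtain X Y z' where "(B \<otimes> W c d k) [^] (2 * s) = W (s * Y) (1 + s * X) (- z')"
    using sw.A_W_pow_2s[of d c "- k"] unfolding W_swap_eq by metis
  then show ?thesis by blast
qed

end

context J_full
begin

lemma finite_carrier: "finite (carrier G)"
proof (rule finite_subset)
  show "carrier G \<subseteq> (\<lambda>(k, j, i). E k j i) ` ({0..<D} \<times> {0..<D} \<times> {0..<D})"
  proof
    fix g assume "g \<in> carrier G"
    then obtain k j i where "g = E k j i" by (rule normal_form)
    also have "E k j i = E (k mod D) (j mod D) (i mod D)"
      unfolding E_def using A_cong[of i "i mod D"] B_cong[of j "j mod D"] C_cong[of k "k mod D"]
      by simp
    finally show "g \<in> (\<lambda>(k, j, i). E k j i) ` ({0..<D} \<times> {0..<D} \<times> {0..<D})"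
      using D_pos by (intro image_eqI[of _ _ "(k mod D, j mod D, i mod D)"]) auto
  qed
qed simp

lemma C_in_Z4: "C \<in> Z (Suc (Suc (Suc (Suc 0))))"
proof (rule upper_central_generators[OF generated])
  have "C \<otimes> A = A \<otimes> C \<otimes> W (- l) 0 0"
    unfolding A_C W_powers(1)[symmetric] by (simp add: h_def m_assoc int_pow_mult' mult.assoc)
  moreover have "C \<otimes> B = B \<otimes> C \<otimes> W (2 * h * l) l 0"
  proof -
    have "[alpha_pow 1 * alpha_pow (- 1) = 1] (mod D)" using alpha_pow_add[of 1 "- 1"] by (simp add: cong_sym_eq)
    then have "B [^] alpha_pow 1 \<otimes> C [^] (1::int) = C [^] (1::int) \<otimes> B [^] (1::int)"
      unfolding B_pow_C_pow using B_cong by simp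
    then have "C \<otimes> B = B \<otimes> (B [^] (2 * h) \<otimes> C)"
      by (simp add: int_pow_mult m_assoc)
    also have "B [^] (2 * h) = W 0 l 0" by (simp add: W_def h_def mult.assoc)
    also have "W 0 l 0 \<otimes> C = C \<otimes> W (2 * h * l) l 0" unfolding W_C by simp
    finally show ?thesis by (simp add: m_assoc)
  qed
  ultimately show "C \<otimes> g \<in> Z (Suc (Suc (Suc 0))) #> (g \<otimes> C)" if "g \<in> {A, B}" for g
    using that W_in_Z3 mult_mem_coset[OF upper_central_normal] by auto
qed simp

text \<open>\<open>J\<close> is nilpotent: \<open>C\<close> lies in the fourth term, and \<open>A\<close> and \<open>B\<close> commute modulo \<open>C\<close>.\<close>

lemma carrier_Z5: "carrier G \<subseteq> Z (Suc (Suc (Suc (Suc (Suc 0)))))"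
proof -
  let ?Z4 = "Z (Suc (Suc (Suc (Suc 0))))"
  have AB: "A \<otimes> B = B \<otimes> A \<otimes> C" using A_B by (simp add: m_assoc)
  have BA: "B \<otimes> A = A \<otimes> B \<otimes> inv C" unfolding AB by (simp add: m_assoc)
  have iC: "inv C \<in> ?Z4" using C_in_Z4 by (rule subgroup.m_inv_closed[OF Z_subgroup])
  have "A \<in> Z (Suc (Suc (Suc (Suc (Suc 0)))))"
  proof (rule upper_central_generators[OF generated])
    show "A \<otimes> g \<in> ?Z4 #> (g \<otimes> A)" if "g \<in> {A, B}" for g
      using that AB C_in_Z4 mult_mem_coset[OF upper_central_normal] rcos_self[OF _ Z_subgroup] by auto
  qed simp
  moreover have "B \<in> Z (Suc (Suc (Suc (Suc (Suc 0)))))"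
  proof (rule upper_central_generators[OF generated])
    show "B \<otimes> g \<in> ?Z4 #> (g \<otimes> B)" if "g \<in> {A, B}" for g
      using that BA iC mult_mem_coset[OF upper_central_normal] rcos_self[OF _ Z_subgroup] by auto
  qed simp
  ultimately show ?thesis
    unfolding generated by (intro generate_subgroup_incl[OF _ Z_subgroup]) simp
qed

text \<open>An endomorphism that perturbs \<open>A\<close> by an element of the third centre therefore fixes the
  centre pointwise.\<close>

lemma A_W_pow_N: "(A \<otimes> W x y z) [^] N = A [^] N"
proof -
  have t: "tri (N - 1) = s ^ 2 * (N - 1)"
    using tri_double[of "N - 1"] by (simp add: N_def algebra_simps)
  have "s ^ 2 dvd 3 * tet (N - 1)" unfolding tet_times_3 t by simp
  moreover have "coprime 3 (s ^ 2)" using coprime_3_N by (simp add: N_def)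
  ultimately have "s ^ 2 dvd tet (N - 1)" by (metis coprime_commute coprime_dvd_mult_right_iff)
  then obtain w where w: "tet (N - 1) = s ^ 2 * w" by blast
  obtain r where r: "s = 2 * r" using s_even by blast
  have z: "N * z - 2 * tri (N - 1) * y = 0 + 2 * s * (s * (z - (N - 1) * y))"
    and y: "N * y = 0 + s * (2 * s * y)"
    unfolding t by (simp_all add: N_def algebra_simps power2_eq_square)
  have "W (N * x + tri (N - 1) * (- h * y + (s ^ 2 - h) * z) - 2 * tet (N - 1) * (s ^ 2 - h) * y)
      (N * y) (N * z - 2 * tri (N - 1) * y) =
    W (N * x + tri (N - 1) * (- h * y + (s ^ 2 - h) * z) - 2 * tet (N - 1) * (s ^ 2 - h) * y
      + s ^ 2 * (s * (z - (N - 1) * y)) - s * (2 * s * y)) 0 0"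
    unfolding z unfolding y W_period_z W_period_y ..
  also have "\<dots> = W 0 0 0"
  proof (rule W_cong)
    have "N * x + tri (N - 1) * (- h * y + (s ^ 2 - h) * z) - 2 * tet (N - 1) * (s ^ 2 - h) * y
      + s ^ 2 * (s * (z - (N - 1) * y)) - s * (2 * s * y) =
      2 * s ^ 2 * (x + (N - 1) * (- r * l * y + (s * r - r * l) * z) - w * (s ^ 2 - h) * y
        + r * (z - (N - 1) * y) - y)"
      unfolding t w by (simp add: N_def h_def r algebra_simps power2_eq_square)
    then show "[N * x + tri (N - 1) * (- h * y + (s ^ 2 - h) * z) - 2 * tet (N - 1) * (s ^ 2 - h) * y
      + s ^ 2 * (s * (z - (N - 1) * y)) - s * (2 * s * y) = 0] (mod 2 * s ^ 2)"
      by (simp add: cong_0_iff)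
  qed
  finally show ?thesis unfolding A_W_pow by simp
qed

text \<open>A nontrivial kernel would contain a nontrivial central element, but central elements are
  fixed.\<close>

lemma perturbation_inj:
  assumes f: "f \<in> hom G G" and fA: "f A = A \<otimes> W a b k"
  shows "inj_on f (carrier G)"
proof -
  interpret f: group_hom G G f using f by (simp add: group_hom_axioms_def group_hom_def is_group)
  show ?thesis
  proof (rule ccontr)
    assume "\<not> inj_on f (carrier G)"
    then obtain x where x: "x \<in> kernel G G f" "x \<noteq> \<one>"
      unfolding f.inj_on_one_iff by (auto simp: kernel_def)
    then have "x \<in> Z (Suc (Suc (Suc (Suc (Suc 0)))))" using carrier_Z5 by (auto simp: kernel_def)
    then obtain y where y: "y \<in> kernel G G f" "y \<noteq> \<one>" "y \<in> Z (Suc 0)"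
      using normal_meets_center[OF f.normal_kernel] x by blast
    then obtain t where t: "y = W (s * t) 0 0" unfolding Z1_eq by blast
    have "y = (A [^] N) [^] t" unfolding t N_powers(1)[symmetric] by (simp add: int_pow_pow)
    then have "f y = y" by (simp add: f.hom_int_pow fA A_W_pow_N)
    then show False using y by (simp add: kernel_def)
  qed
qed

lemma W_eq_one_iff: "W (2 * h * x) 0 0 = \<one> \<longleftrightarrow> s dvd x"
proof
  assume "W (2 * h * x) 0 0 = \<one>"
  then have "W (2 * h * x) 0 0 = W 0 0 0" by simp
  then have "2 * s ^ 2 dvd 2 * h * x - 0" by (rule W_unique_x)
  then have "(2 * s) * s dvd (2 * s) * (l * x)" by (simp add: h_def power2_eq_square mult_ac)
  then have "s dvd l * x" using s_pos by simp
  moreover have "coprime s l" using odd_l by (simp add: s_def)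
  ultimately show "s dvd x" by (simp add: coprime_dvd_mult_right_iff)
next
  assume "s dvd x"
  then obtain t where "x = s * t" by blast
  then have "[2 * h * x = 0] (mod 2 * s ^ 2)" by (simp add: cong_0_iff h_def power2_eq_square)
  then show "W (2 * h * x) 0 0 = \<one>" using W_cong by simp
qed

text \<open>By uniqueness of normal forms the vanishing of the two elements in
  \<open>perturbed_J_rel_iff\<close> becomes divisibility by \<open>s\<close>.\<close>

lemma perturbation_J_rel: 
  "J_rel G m l (A \<otimes> W a b k) (B \<otimes> W c d k') \<longleftrightarrow> s dvd a + d + 2 * b \<and> s dvd a + d + 2 * c"
proof -
  have "J_rel.W G m B A (2 * h * (a + d + 2 * c)) 0 0 = W 0 (0 + s * (2 * l * (a + d + 2 * c))) 0"
    unfolding W_swap_eq by (simp add: h_def mult_ac)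
  also have "\<dots> = W (2 * h * - (a + d + 2 * c)) 0 0"
    unfolding W_period_y by (simp add: h_def algebra_simps)
  finally have "J_rel.W G m B A (2 * h * (a + d + 2 * c)) 0 0 = \<one> \<longleftrightarrow> s dvd a + d + 2 * c"
    by (simp only: W_eq_one_iff dvd_minus_iff)
  then show ?thesis unfolding perturbed_J_rel_iff W_eq_one_iff by simp
qed

lemma hom_J_rel: assumes "f \<in> hom G G" shows "J_rel G m l (f A) (f B)"
proof -
  interpret f: group_hom G G f using assms by (simp add: group_hom_axioms_def group_hom_def is_group)
  have "gconj G (f A) (gcomm G (f A) (f B)) = f (gconj G A (gcomm G A B))"
    "gconj G (f B) (gcomm G (f B) (f A)) = f (gconj G B (gcomm G B A))"
    by (simp_all add: gconj_def gcomm_def)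
  moreover have "f A [^] ((2::nat) ^ (3 * m - 1)) = f (A [^] ((2::nat) ^ (3 * m - 1)))"
    "f B [^] ((2::nat) ^ (3 * m - 1)) = f (B [^] ((2::nat) ^ (3 * m - 1)))"
    by (simp_all add: f.hom_nat_pow)
  ultimately show ?thesis
    unfolding J_rel_def J_rel_axioms_def
    by (simp add: is_group scale_axioms A_rel B_rel A_ord B_ord f.hom_int_pow del: One_nat_def)
qed

lemma perturbation_auto:
  assumes "s dvd a + d + 2 * b" "s dvd a + d + 2 * c"
  obtains f where "f \<in> auto G" "f A = A \<otimes> W a b k" "f B = B \<otimes> W c d k'"
proof -
  obtain f where f: "f \<in> hom G G" "f A = A \<otimes> W a b k" "f B = B \<otimes> W c d k'"
    using endo assms perturbation_J_rel by blast
  have "restrict f (carrier G) \<in> auto G"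
    using f by (intro restrict_hom_auto perturbation_inj finite_carrier)
  with f that show ?thesis by simp
qed

lemma hom_eqI:
  assumes "f \<in> auto G" "g \<in> auto G" "f A = g A" "f B = g B"
  shows "f = g"
proof (rule auto_eqI)
  interpret f: group_hom G G f using assms by (simp add: auto_group_hom)
  interpret g: group_hom G G g using assms by (simp add: auto_group_hom)
  fix x assume "x \<in> carrier G"
  then have "x \<in> generate G {A, B}" by (simp add: generated)
  then show "f x = g x"
  proof induction
    case (eng h1 h2)
    then have "h1 \<in> carrier G" "h2 \<in> carrier G"
      using generate_in_carrier[of "{A, B}" h1] generate_in_carrier[of "{A, B}" h2] by simp_all
    then show ?case using eng by simp
  qed (use assms in auto)
qed (use assms in auto)

lemma coset_generator_iff:
  assumes "x \<in> carrier G" "y \<in> carrier G"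
  shows "Z r #> y = Z r #> x \<longleftrightarrow> (\<exists>z\<in>Z r. y = x \<otimes> z)"
proof -
  have e: "Z r #> x = x <# Z r" using normal.coset_eq[OF upper_central_normal] assms by blast
  have "Z r #> y = Z r #> x \<longleftrightarrow> y \<in> Z r #> x" by (rule coset_eq_iff[OF Z_subgroup assms(2,1)])
  then show ?thesis unfolding e l_coset_def by auto
qed

lemma Aut_ker_iff_generators:
  "f \<in> Aut_ker G r \<longleftrightarrow> f \<in> auto G \<and> (\<exists>z\<in>Z r. f A = A \<otimes> z) \<and> (\<exists>z\<in>Z r. f B = B \<otimes> z)"
  unfolding Aut_ker_generators_iff[OF finite_carrier generated]
  by (cases "f \<in> auto G") (simp_all add: coset_generator_iff auto_closed)

lemma Aut_ker3_iff: "f \<in> Aut_ker G 3 \<longleftrightarrow>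
    f \<in> auto G \<and> (\<exists>a b k. f A = A \<otimes> W a b k) \<and> (\<exists>c d k'. f B = B \<otimes> W c d k')"
proof -
  have "Z 3 = {W x y z |x y z. True}" using Z3_eq by (simp add: numeral_3_eq_3)
  then show ?thesis unfolding Aut_ker_iff_generators by auto
qed

lemma Aut_ker2_iff: "f \<in> Aut_ker G 2 \<longleftrightarrow>
    f \<in> auto G \<and> (\<exists>x z. f A = A \<otimes> W (s * x) 0 z) \<and> (\<exists>x z. f B = B \<otimes> W (s * x) 0 z)"
proof -
  have "Z 2 = {W (s * x) 0 z |x z. True}" using Z2_eq by (simp add: numeral_2_eq_2)
  then show ?thesis unfolding Aut_ker_iff_generators by auto
qed

text \<open>Such an \<open>f\<close> acts trivially on the third centre modulo the second. This is why the coordinates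
  of perturbations are additive under composition.\<close>

lemma perturbation_W:
  assumes f: "f \<in> hom G G" and fA: "f A = A \<otimes> W a b k" and fB: "f B = B \<otimes> W c d k'"
  shows "\<exists>X Y z'. f (W x y z) = W (x + s * X) (y + s * Y) z'"
proof -
  interpret f: group_hom G G f using f by (simp add: group_hom_axioms_def group_hom_def is_group)
  obtain X1 Y1 Z1 where 1: "f (W 1 0 0) = W (1 + s * X1) (s * Y1) Z1"
    using A_W_pow_2s[of a b k] by (auto simp: W_def[of 1 0 0] f.hom_int_pow fA)
  obtain X2 Y2 Z2 where 2: "f (W 0 1 0) = W (s * X2) (1 + s * Y2) Z2"
    using B_W_pow_2s[of c d k'] by (auto simp: W_def[of 0 1 0] f.hom_int_pow fB)
  obtain T z0 where "f C = C \<otimes> W (s * T) 0 z0"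
  proof -
    have "f C = gcomm G (f A) (f B)" by (simp add: C_def gcomm_def)
    also have "\<dots> = C \<otimes> W (s * (l * a + (s - l) * k + l * d - (s - l) * k'
        - 2 * l * (a + b + c + d - h * d + (s ^ 2 - h) * k'))) 0 (2 * (a + d))"
      unfolding fA fB perturbed_commutator by (simp add: h_def algebra_simps power2_eq_square)
    finally show ?thesis using that by blast
  qed
  moreover have "W (s * T) 0 z0 \<otimes> C = C \<otimes> W (s * T) 0 z0"
  proof -
    have "W (s * T + 2 * h * (s * T + 0)) 0 z0 = W (s * T) 0 z0"
      by (rule W_cong) (simp add: cong_iff_dvd_diff h_def power2_eq_square mult_ac)
    then show ?thesis unfolding W_C by simp
  qed
  ultimately have "f C [^] s = C [^] s \<otimes> W (s * T) 0 z0 [^] s"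
    by (simp add: int_pow_mult_distrib)
  moreover have "C [^] s = W 0 0 1" by (simp add: W_def)
  ultimately have 3: "f (W 0 0 1) = W (s * (s * T)) 0 (1 + s * z0)"
    by (simp add: W_pow W_mult flip: f.hom_int_pow)
  have e: "W x y z = W 1 0 0 [^] x \<otimes> W 0 1 0 [^] y \<otimes> W 0 0 1 [^] z"
    by (simp add: W_pow W_mult)
  have "f (W x y z) = W (x + s * (x * X1 + y * X2 + z * (s * T))) (y + s * (x * Y1 + y * Y2))
     (x * Z1 + y * Z2 + z * (1 + s * z0))"
    unfolding e by (simp only: f.hom_mult f.hom_int_pow W_closed int_pow_closed m_closed 1 2 3)
      (simp add: W_pow W_mult algebra_simps)
  then show ?thesis by blast
qed

text \<open>The coordinates of an element of the third centre modulo the second one; \<open>W_unique\<close> makes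
  the choice irrelevant.\<close>

definition A_coord :: "'a \<Rightarrow> int" where "A_coord g = (SOME n. \<exists>x y z. g = W x y z \<and> n = x mod s)"
definition B_coord :: "'a \<Rightarrow> int" where "B_coord g = (SOME n. \<exists>x y z. g = W x y z \<and> n = y mod s)"

lemma A_coord_W [simp]: "A_coord (W x y z) = x mod s"
proof -
  have "\<exists>n. \<exists>x' y' z'. W x y z = W x' y' z' \<and> n = x' mod s" by blast
  from someI_ex[OF this] obtain x' y' z' where "W x y z = W x' y' z'" "A_coord (W x y z) = x' mod s"
    unfolding A_coord_def by blast
  then show ?thesis using W_unique(3) by (metis mod_eq_dvd_iff)
qed

lemma B_coord_W [simp]: "B_coord (W x y z) = y mod s"
proof -
  have "\<exists>n. \<exists>x' y' z'. W x y z = W x' y' z' \<and> n = y' mod s" by blast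
  from someI_ex[OF this] obtain x' y' z' where "W x y z = W x' y' z'" "B_coord (W x y z) = y' mod s"
    unfolding B_coord_def by blast
  then show ?thesis using W_unique(2) by (metis mod_eq_dvd_iff)
qed

text \<open>If \<open>f A = A W(a, b, \<dots>)\<close> and \<open>f B = B W(c, d, \<dots>)\<close>, then \<open>s\<close> divides \<open>a + d + 2 b\<close> and
  \<open>a + d + 2 c\<close>. Hence \<open>c = b + (s / 2) t\<close>, and \<open>d\<close> is determined modulo \<open>s\<close>, so that \<open>a\<close> and \<open>b\<close> modulo \<open>s\<close> and
  \<open>t\<close> modulo \<open>2\<close> are free parameters.\<close>

definition \<psi> :: "('a \<Rightarrow> 'a) \<Rightarrow> int \<times> int \<times> int" where
  "\<psi> f = (A_coord (inv A \<otimes> f A), B_coord (inv A \<otimes> f A),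
    ((A_coord (inv B \<otimes> f B) - B_coord (inv A \<otimes> f A)) div (s div 2)) mod 2)"

lemma Aut3_elim:
  assumes "f \<in> Aut_ker G 3"
  obtains a b k c t d k' where "f \<in> auto G" "f A = A \<otimes> W a b k" "f B = B \<otimes> W c d k'"
    "c = b + s div 2 * t" "s dvd a + d + 2 * b" "\<psi> f = (a mod s, b mod s, t mod 2)"
proof -
  obtain a b k c d k' where f: "f \<in> auto G" "f A = A \<otimes> W a b k" "f B = B \<otimes> W c d k'"
    using assms unfolding Aut_ker3_iff by blast
  have dv: "s dvd a + d + 2 * b" "s dvd a + d + 2 * c"
    using hom_J_rel[OF auto_hom[OF f(1)]] perturbation_J_rel f by simp_all
  obtain r where r: "s = 2 * r" using s_even by blast
  have "s dvd (a + d + 2 * c) - (a + d + 2 * b)" using dv by (rule dvd_diff[rotated])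
  then have "2 * r dvd 2 * (c - b)" by (simp add: r algebra_simps)
  then have "r dvd c - b" by (simp only: dvd_mult_cancel_left) simp
  then obtain t where "c - b = r * t" by blast
  then have t: "c = b + r * t" by simp
  have inv: "inv A \<otimes> f A = W a b k" "inv B \<otimes> f B = W c d k'"
    unfolding f by (simp_all flip: m_assoc)
  have "c mod s - b mod s = r * (t + 2 * (b div s - c div s))"
    unfolding t by (simp add: minus_mult_div_eq_mod[symmetric] r algebra_simps)
  moreover have "r \<noteq> 0" using s_pos r by auto
  ultimately have "\<psi> f = (a mod s, b mod s, t mod 2)"
    unfolding \<psi>_def inv by (simp add: r mod_add_eq[symmetric])
  moreover have "c = b + s div 2 * t" using t by (simp add: r)
  ultimately show ?thesis using that[OF f _ dv(1)] by blast
qed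

lemma \<psi>_perturbation:
  assumes "f \<in> auto G" "f A = A \<otimes> W a b k" "f B = B \<otimes> W (b + s div 2 * t) d k'"
  shows "\<psi> f = (a mod s, b mod s, t mod 2)"
proof -
  have "f \<in> Aut_ker G 3" using assms unfolding Aut_ker3_iff by blast
  then obtain a' b' u c' t' d' u' where f: "f A = A \<otimes> W a' b' u" "f B = B \<otimes> W c' d' u'"
    "c' = b' + s div 2 * t'" "\<psi> f = (a' mod s, b' mod s, t' mod 2)"
    by (rule Aut3_elim)
  obtain r where r: "s = 2 * r" using s_even by blast
  have r0: "r \<noteq> 0" using s_pos r by auto
  have e1: "W a b k = W a' b' u" and e2: "W (b + r * t) d k' = W (b' + r * t') d' u'"
    using assms f r by simp_all
  have ab: "s dvd a - a'" "s dvd b - b'" using W_unique(2,3)[OF e1] by blast+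
  have "s dvd (b + r * t) - (b' + r * t')" using W_unique(3)[OF e2] .
  then have "s dvd ((b + r * t) - (b' + r * t')) - (b - b')" using ab(2) by (rule dvd_diff)
  then have "r * 2 dvd r * (t - t')" by (simp add: r algebra_simps)
  then have "2 dvd t - t'" using r0 by simp
  then have "a mod s = a' mod s" "b mod s = b' mod s" "t mod 2 = t' mod 2"
    using ab by (simp_all add: mod_eq_dvd_iff)
  then show ?thesis using f(4) by simp
qed

abbreviation "P \<equiv> integer_mod_group (2 ^ (m - 1)) \<times>\<times> integer_mod_group (2 ^ (m - 1)) \<times>\<times> integer_mod_group 2"

lemma int_s: "int (2 ^ (m - 1)) = s" by (simp add: s_def)

lemma carrier_Zs: "carrier (integer_mod_group (2 ^ (m - 1))) = {0..<s}"
  by (simp add: carrier_integer_mod_group s_def)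

lemma carrier_Z2: "carrier (integer_mod_group 2) = {0..<2}"
  by (simp add: carrier_integer_mod_group)

lemma group_P: "group P"
  by (intro DirProd_group group_integer_mod_group)

abbreviation "Aut3 \<equiv> AutoGroup G\<lparr>carrier := Aut_ker G 3\<rparr>"

lemma group_Aut3: "group Aut3"
  using subgroup.subgroup_is_group[OF Aut_ker_subgroup[OF finite_carrier] AutoGroup] .

lemma \<psi>_hom: "\<psi> \<in> hom Aut3 P"
proof (rule homI)
  fix f assume "f \<in> carrier Aut3"
  then have "f \<in> Aut_ker G 3" by simp
  then show "\<psi> f \<in> carrier P"
    by (rule Aut3_elim) (use s_pos in \<open>auto simp: carrier_Zs carrier_Zs[unfolded One_nat_def] carrier_Z2\<close>)
next
  fix f g assume "f \<in> carrier Aut3" "g \<in> carrier Aut3"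
  then have fg: "f \<in> Aut_ker G 3" "g \<in> Aut_ker G 3" by simp_all
  obtain a b k c t d k' where f: "f \<in> auto G" "f A = A \<otimes> W a b k" "f B = B \<otimes> W c d k'"
    "c = b + s div 2 * t" "s dvd a + d + 2 * b" "\<psi> f = (a mod s, b mod s, t mod 2)"
    by (rule Aut3_elim[OF fg(1)])
  obtain a' b' u c' t' d' u' where g: "g \<in> auto G" "g A = A \<otimes> W a' b' u" "g B = B \<otimes> W c' d' u'"
    "c' = b' + s div 2 * t'" "s dvd a' + d' + 2 * b'" "\<psi> g = (a' mod s, b' mod s, t' mod 2)"
    by (rule Aut3_elim[OF fg(2)])
  interpret f: group_hom G G f by (rule auto_group_hom[OF f(1)])
  obtain r where r: "s = 2 * r" using s_even by blast
  obtain X Y z1 where 1: "f (W a' b' u) = W (a' + s * X) (b' + s * Y) z1"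
    using perturbation_W[OF auto_hom f(2,3)] f(1) by blast
  obtain X' Y' z2 where 2: "f (W c' d' u') = W (c' + s * X') (d' + s * Y') z2"
    using perturbation_W[OF auto_hom f(2,3)] f(1) by blast
  have "(f \<otimes>\<^bsub>AutoGroup G\<^esub> g) A = A \<otimes> W (a + a' + s * X) (b + b' + s * Y) (k + z1)"
    unfolding AutoGroup_mult_apply[OF f(1) g(1) A_closed] g
    by (simp add: 1 f(2) m_assoc W_mult algebra_simps)
  moreover have "(f \<otimes>\<^bsub>AutoGroup G\<^esub> g) B = B \<otimes> W ((b + b' + s * Y) + s div 2 * (t + t' + 2 * X' - 2 * Y))
      (d + d' + s * Y') (k' + z2)"
    unfolding AutoGroup_mult_apply[OF f(1) g(1) B_closed] g(3)
    by (simp add: 2 f(3) m_assoc W_mult) (simp add: f(4) g(4) r algebra_simps)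
  ultimately have "\<psi> (f \<otimes>\<^bsub>AutoGroup G\<^esub> g) =
      ((a + a' + s * X) mod s, (b + b' + s * Y) mod s, (t + t' + 2 * X' - 2 * Y) mod 2)"
    by (rule \<psi>_perturbation[OF auto_mult_closed[OF f(1) g(1)]])
  also have "(t + t' + 2 * X' - 2 * Y) mod 2 = (t + t') mod 2" by presburger
  finally show "\<psi> (f \<otimes>\<^bsub>Aut3\<^esub> g) = \<psi> f \<otimes>\<^bsub>P\<^esub> \<psi> g"
    unfolding f(6) g(6) mult_DirProd' mult_integer_mod_group by (simp add: int_s[simplified] mod_add_eq)
qed

lemma group_hom_\<psi>: "group_hom Aut3 P \<psi>"
  using \<psi>_hom group_Aut3 group_P by (simp add: group_hom_def group_hom_axioms_def)

text \<open>If \<open>s\<close> divides \<open>a\<close> and \<open>b\<close> and \<open>t\<close> is even, then \<open>s\<close> divides \<open>c\<close> and \<open>d\<close> too, and both perturbations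
  lie in the second centre.\<close>

lemma \<psi>_kernel: "kernel Aut3 P \<psi> = Aut_ker G 2"
proof (intro equalityI subsetI)
  fix f assume "f \<in> kernel Aut3 P \<psi>"
  then have f3: "f \<in> Aut_ker G 3" and one: "\<psi> f = (0, 0, 0)" by (simp_all add: kernel_def)
  obtain a b k c t d k' where f: "f \<in> auto G" "f A = A \<otimes> W a b k" "f B = B \<otimes> W c d k'"
    "c = b + s div 2 * t" "s dvd a + d + 2 * b" "\<psi> f = (a mod s, b mod s, t mod 2)"
    by (rule Aut3_elim[OF f3])
  obtain r where r: "s = 2 * r" using s_even by blast
  have dv: "s dvd a" "s dvd b" "even t" using f(6) one by auto
  then have c: "s dvd c" using f(4) r by (auto simp: mult.assoc)
  have "s dvd d" using f(5) dv by (metis dvd_add_left_iff dvd_add_right_iff dvd_mult)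
  have in_Z2: "\<exists>x' z'. W x y z = W (s * x') 0 z'" if "s dvd x" "s dvd y" for x y z
  proof -
    obtain x1 where "x = s * x1" using \<open>s dvd x\<close> by blast
    moreover obtain y1 where "y = 0 + s * y1" using \<open>s dvd y\<close> by auto
    ultimately have xy: "x = s * x1" "y = 0 + s * y1" .
    show ?thesis unfolding xy W_period_y by (metis right_diff_distrib)
  qed
  show "f \<in> Aut_ker G 2"
    unfolding Aut_ker2_iff f(2,3) using f(1) in_Z2 dv(1,2) c \<open>s dvd d\<close> by metis
next
  fix f assume f2: "f \<in> Aut_ker G 2"
  then obtain x z x' z' where f: "f \<in> auto G" "f A = A \<otimes> W (s * x) 0 z" "f B = B \<otimes> W (s * x') 0 z'"
    unfolding Aut_ker2_iff by blast
  obtain r where r: "s = 2 * r" using s_even by blast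
  have "f B = B \<otimes> W (0 + s div 2 * (2 * x')) 0 z'" using f(3) r by (simp add: mult_ac)
  then have "\<psi> f = ((s * x) mod s, 0 mod s, (2 * x') mod 2)" by (rule \<psi>_perturbation[OF f(1,2)])
  moreover have "f \<in> Aut_ker G 3" using f unfolding Aut_ker3_iff by blast
  ultimately show "f \<in> kernel Aut3 P \<psi>" by (simp add: kernel_def)
qed

lemma \<psi>_surj: "\<psi> ` carrier Aut3 = carrier P"
proof (intro equalityI subsetI)
  fix p assume "p \<in> carrier P"
  then obtain a b t where p: "p = (a, b, t)" "0 \<le> a" "a < s" "0 \<le> b" "b < s" "0 \<le> t" "t < 2"
    by (auto simp: carrier_Zs carrier_Zs[unfolded One_nat_def] carrier_Z2)
  obtain r where r: "s = 2 * r" using s_even by blast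
  have "s dvd a + (- a - 2 * b) + 2 * b" "s dvd a + (- a - 2 * b) + 2 * (b + s div 2 * t)"
    by (simp_all add: r algebra_simps)
  then obtain f where f: "f \<in> auto G" "f A = A \<otimes> W a b 0" "f B = B \<otimes> W (b + s div 2 * t) (- a - 2 * b) 0"
    by (rule perturbation_auto)
  then have "\<psi> f = p" using \<psi>_perturbation[OF f] p by simp
  moreover have "f \<in> Aut_ker G 3" using f unfolding Aut_ker3_iff by blast
  ultimately show "p \<in> \<psi> ` carrier Aut3" by auto
qed (use group_hom.hom_closed[OF group_hom_\<psi>] in blast)

lemma Aut3_mod_Aut2: "Aut3 Mod Aut_ker G 2 \<cong> P"
  using group_hom.FactGroup_iso[OF group_hom_\<psi> \<psi>_surj] unfolding \<psi>_kernel .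

text \<open>The periods of the coordinates reduce both of them to residues modulo \<open>2 s\<close>.\<close>

lemma card_Z2: "card (Z 2) = 2 ^ (2 * m)"
proof -
  have Z: "Z 2 = {W (s * x) 0 z |x z. True}" using Z2_eq by (simp add: numeral_2_eq_2)
  have "bij_betw (\<lambda>(x, z). W (s * x) 0 z) ({0..<2 * s} \<times> {0..<2 * s}) (Z 2)"
  proof (rule bij_betw_imageI)
    show "inj_on (\<lambda>(x, z). W (s * x) 0 z) ({0..<2 * s} \<times> {0..<2 * s})"
    proof (rule inj_onI, clarsimp)
      fix x z x' z' assume b: "0 \<le> x" "x < 2 * s" "0 \<le> z" "z < 2 * s" "0 \<le> x'" "x' < 2 * s" "0 \<le> z'" "z' < 2 * s"
        and e: "W (s * x) 0 z = W (s * x') 0 z'"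
      have "2 * s dvd z - z'" using W_unique(1)[OF e] .
      then have z: "z = z'" using b by (metis mod_eq_dvd_iff mod_pos_pos_trivial)
      have "s * (2 * s) dvd s * (x - x')" using W_unique_x e unfolding z
        by (simp add: power2_eq_square right_diff_distrib mult_ac)
      then have "2 * s dvd x - x'" using s_pos by simp
      then show "x = x' \<and> z = z'" using b z by (metis mod_eq_dvd_iff mod_pos_pos_trivial)
    qed
    show "(\<lambda>(x, z). W (s * x) 0 z) ` ({0..<2 * s} \<times> {0..<2 * s}) = Z 2"
    proof (intro equalityI subsetI)
      fix g assume "g \<in> Z 2"
      then obtain x z where "g = W (s * x) 0 z" using Z by blast
      also have "z = z mod (2 * s) + 2 * s * (z div (2 * s))" by simp
      also have "W (s * x) 0 \<dots> = W (s * x + s ^ 2 * (z div (2 * s))) 0 (z mod (2 * s))"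
        by (rule W_period_z)
      also have "\<dots> = W (s * ((x + s * (z div (2 * s))) mod (2 * s))) 0 (z mod (2 * s))"
      proof (rule W_cong)
        have "s * (2 * s) dvd s * ((x + s * (z div (2 * s))) - (x + s * (z div (2 * s))) mod (2 * s))"
          by (intro mult_dvd_mono dvd_refl) simp
        then show "[s * x + s ^ 2 * (z div (2 * s)) = s * ((x + s * (z div (2 * s))) mod (2 * s))] (mod 2 * s ^ 2)"
          by (simp add: cong_iff_dvd_diff power2_eq_square algebra_simps)
      qed
      finally show "g \<in> (\<lambda>(x, z). W (s * x) 0 z) ` ({0..<2 * s} \<times> {0..<2 * s})"
        using s_pos by (intro image_eqI[of _ _ "((x + s * (z div (2 * s))) mod (2 * s), z mod (2 * s))"]) auto
    qed (use Z in auto)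
  qed
  then have "card (Z 2) = card ({0..<2 * s} \<times> {0..<2 * s})" by (simp add: bij_betw_same_card)
  also have "\<dots> = nat (2 * s) * nat (2 * s)" by simp
  also have "nat (2 * s) = 2 ^ m" unfolding power_m[symmetric] by (simp add: nat_power_eq)
  finally show ?thesis by (simp add: mult_2 power_add)
qed

text \<open>For perturbations in the second centre the two congruences hold trivially, so all pairs
  of such perturbations occur.\<close>

lemma card_Aut2: "card (Aut_ker G 2) = 2 ^ (4 * m)"
proof -
  have Z: "Z 2 = {W (s * x) 0 z |x z. True}" using Z2_eq by (simp add: numeral_2_eq_2)
  have "bij_betw (\<lambda>f. (inv A \<otimes> f A, inv B \<otimes> f B)) (Aut_ker G 2) (Z 2 \<times> Z 2)"
  proof (rule bij_betw_imageI)
    show "inj_on (\<lambda>f. (inv A \<otimes> f A, inv B \<otimes> f B)) (Aut_ker G 2)"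
    proof (rule inj_onI, clarsimp)
      fix f g assume "f \<in> Aut_ker G 2" "g \<in> Aut_ker G 2"
        and e: "inv A \<otimes> f A = inv A \<otimes> g A" "inv B \<otimes> f B = inv B \<otimes> g B"
      then have "f \<in> auto G" "g \<in> auto G" by (simp_all add: Aut_ker2_iff)
      then show "f = g" using e by (intro hom_eqI) (simp_all add: auto_closed)
    qed
    show "(\<lambda>f. (inv A \<otimes> f A, inv B \<otimes> f B)) ` Aut_ker G 2 = Z 2 \<times> Z 2"
    proof (intro equalityI subsetI)
      fix p assume "p \<in> (\<lambda>f. (inv A \<otimes> f A, inv B \<otimes> f B)) ` Aut_ker G 2"
      then obtain f where f: "f \<in> Aut_ker G 2" "p = (inv A \<otimes> f A, inv B \<otimes> f B)" by blast
      then obtain x z x' z' where "f A = A \<otimes> W (s * x) 0 z" "f B = B \<otimes> W (s * x') 0 z'"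
        unfolding Aut_ker2_iff by blast
      then show "p \<in> Z 2 \<times> Z 2" using f(2) Z by (auto simp flip: m_assoc)
    next
      fix p assume "p \<in> Z 2 \<times> Z 2"
      then obtain x z x' z' where p: "p = (W (s * x) 0 z, W (s * x') 0 z')" using Z by auto
      obtain f where f: "f \<in> auto G" "f A = A \<otimes> W (s * x) 0 z" "f B = B \<otimes> W (s * x') 0 z'"
        by (rule perturbation_auto[of "s * x" 0 0 "s * x'" z z']) auto
      then have "f \<in> Aut_ker G 2" unfolding Aut_ker2_iff by blast
      moreover have "p = (inv A \<otimes> f A, inv B \<otimes> f B)" unfolding p f by (simp flip: m_assoc)
      ultimately show "p \<in> (\<lambda>f. (inv A \<otimes> f A, inv B \<otimes> f B)) ` Aut_ker G 2" by blast
    qed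
  qed
  then have "card (Aut_ker G 2) = card (Z 2) * card (Z 2)"
    by (simp add: bij_betw_same_card card_cartesian_product)
  then show ?thesis by (simp add: card_Z2 flip: power_add)
qed

lemma card_Aut3: "card (Aut_ker G 3) = 2 ^ (6 * m - 1)"
proof -
  have sub: "subgroup (Aut_ker G 2) Aut3"
    using group_hom.subgroup_kernel[OF group_hom_\<psi>] unfolding \<psi>_kernel .
  have "card (Aut_ker G 3) = card (rcosets\<^bsub>Aut3\<^esub> (Aut_ker G 2)) * card (Aut_ker G 2)"
    using group.lagrange[OF group_Aut3 sub] by (simp add: order_def)
  also have "card (rcosets\<^bsub>Aut3\<^esub> (Aut_ker G 2)) = card (carrier P)"
    using iso_same_order Aut3_mod_Aut2 by (fastforce simp: is_iso_def order_def FactGroup_def)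
  also have "\<dots> = 2 ^ (m - 1) * (2 ^ (m - 1) * 2)"
    by (simp add: carrier_Zs carrier_Zs[unfolded One_nat_def] carrier_Z2 card_cartesian_product s_def nat_power_eq)
  also have "\<dots> * card (Aut_ker G 2) = 2 ^ ((m - 1) + ((m - 1) + 1) + 4 * m)"
    by (simp only: card_Aut2 power_add power_one_right mult.assoc)
  also have "(m - 1) + ((m - 1) + 1) + 4 * m = 6 * m - 1" using m_gt_1 by simp
  finally show ?thesis .
qed

end

section \<open>Generators, and inner automorphisms modulo \<open>Aut\<^sub>3\<close>\<close>

lemma int_pow_DirProd:
  assumes "group G" "group H" "x \<in> carrier G" "y \<in> carrier H"
  shows "(x, y) [^]\<^bsub>G \<times>\<times> H\<^esub> (n::int) = (x [^]\<^bsub>G\<^esub> n, y [^]\<^bsub>H\<^esub> n)"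
proof -
  have "fst \<in> hom (G \<times>\<times> H) G" "snd \<in> hom (G \<times>\<times> H) H"
    by (auto simp: hom_def DirProd_def)
  then have "fst ((x, y) [^]\<^bsub>G \<times>\<times> H\<^esub> n) = x [^]\<^bsub>G\<^esub> n" "snd ((x, y) [^]\<^bsub>G \<times>\<times> H\<^esub> n) = y [^]\<^bsub>H\<^esub> n"
    using assms hom_int_pow[of fst "G \<times>\<times> H" G "(x, y)" n] hom_int_pow[of snd "G \<times>\<times> H" H "(x, y)" n]
    by (simp_all add: DirProd_group)
  then show ?thesis by (simp add: prod_eq_iff)
qed

context J_full
begin

abbreviation "AutG \<equiv> AutoGroup G"
abbreviation aut_mult (infixl \<open>\<star>\<close> 70) where "f \<star> g \<equiv> f \<otimes>\<^bsub>AutG\<^esub> g"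
abbreviation aut_pow (infixr \<open>\<up>\<close> 75) where "f \<up> n \<equiv> f [^]\<^bsub>AutG\<^esub> (n::int)"
abbreviation "\<iota> \<equiv> inner_aut G"

lemma B_A_W: "B [^] (1 - 4 * s) \<otimes> A [^] (2 * s) = B \<otimes> W 1 (- 2) 0"
proof -
  have "W 1 (- 2) 0 = A [^] (2 * s * 1) \<otimes> B [^] (2 * s * (- 2))" by (simp add: W_def)
  also have "\<dots> = B [^] (2 * s * (- 2)) \<otimes> A [^] (2 * s * 1)" by (rule A_2s_B_2s)
  finally have "B \<otimes> W 1 (- 2) 0 = B [^] (1 + 2 * s * (- 2)) \<otimes> A [^] (2 * s)"
    by (simp only: int_pow_mult B_closed int_pow_1 m_assoc A_closed int_pow_closed mult_1_right)
  then show ?thesis by simp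
qed

lemma half_s: "2 * s * (s div 2) = s ^ 2"
  using s_even by (auto elim!: evenE simp: power2_eq_square)

lemma \<Delta>_exist:
  obtains d1 d2 where "d1 \<in> auto G" "d1 A = A \<otimes> B [^] (2 * s)" "d1 B = B [^] (1 - 4 * s) \<otimes> A [^] (2 * s)"
    "d2 \<in> auto G" "d2 A = A" "d2 B = B \<otimes> A [^] (s ^ 2)"
proof -
  obtain d1 where d1: "d1 \<in> auto G" "d1 A = A \<otimes> W 0 1 0" "d1 B = B \<otimes> W 1 (- 2) 0"
    by (rule perturbation_auto[of 0 "- 2" 1 1 0 0]) auto
  obtain d2 where d2: "d2 \<in> auto G" "d2 A = A \<otimes> W 0 0 0" "d2 B = B \<otimes> W (s div 2) 0 0"
    by (rule perturbation_auto[of 0 0 0 "s div 2" 0 0]) (use s_even in auto)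
  have "W (s div 2) 0 0 = A [^] (s ^ 2)"
    by (simp add: W_def half_s)
  moreover have "W 0 1 0 = B [^] (2 * s)" by (simp add: W_def)
  ultimately show ?thesis using that d1 d2 by (simp add: B_A_W)
qed

lemma inner_aut_values:
  "\<iota> (A [^] i) A = A" "\<iota> (A [^] i) B = B \<otimes> (C [^] (- i) \<otimes> A [^] (alpha_sum (- i) + i))"
  "\<iota> (A [^] i) C = C \<otimes> A [^] (- 2 * h * i)"
  "\<iota> (C [^] k) A = A [^] alpha_pow k" "\<iota> (C [^] k) B = B [^] alpha_pow (- k)" "\<iota> (C [^] k) C = C"
proof -
  have i: "inv (x [^] i) = x [^] (- i)" if "x \<in> carrier G" for x and i :: int
    using that by (simp add: int_pow_neg)
  show "\<iota> (A [^] i) A = A"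
    using int_pow_commute_closed[of A A 1 i] by (simp add: inner_aut_apply m_assoc)
      (simp flip: m_assoc)
  show "\<iota> (A [^] i) B = B \<otimes> (C [^] (- i) \<otimes> A [^] (alpha_sum (- i) + i))"
    by (simp add: inner_aut_apply i A_pow_B m_assoc int_pow_mult')
  have "A [^] (- i) \<otimes> C = C \<otimes> A [^] (- i * (1 + 2 * h))"
    using A_pow_C_pow[of "- i" 1] by simp
  then show "\<iota> (A [^] i) C = C \<otimes> A [^] (- 2 * h * i)"
    by (simp add: inner_aut_apply i m_assoc int_pow_mult') (simp add: algebra_simps)
  show "\<iota> (C [^] k) A = A [^] alpha_pow k"
    using A_pow_C_pow[of 1 k] by (simp add: inner_aut_apply m_assoc) (simp flip: m_assoc)
  show "\<iota> (C [^] k) B = B [^] alpha_pow (- k)"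
    using B_pow_C_pow[of 1 k] by (simp add: inner_aut_apply m_assoc) (simp flip: m_assoc)
  show "\<iota> (C [^] k) C = C"
    using int_pow_commute_closed[of C C 1 k] by (simp add: inner_aut_apply m_assoc)
      (simp flip: m_assoc)
qed

lemma inner_aut_values_B:
  "\<iota> (B [^] j) B = B" "\<iota> (B [^] j) A = A \<otimes> (C [^] j \<otimes> B [^] (alpha_sum (- j) + j))"
  "\<iota> (B [^] j) C = C \<otimes> B [^] (2 * s * (l * j * (1 - 2 * h)))"
proof -
  have i: "inv (x [^] i) = x [^] (- i)" if "x \<in> carrier G" for x and i :: int
    using that by (simp add: int_pow_neg)
  show "\<iota> (B [^] j) B = B"
    using int_pow_commute_closed[of B B 1 j] by (simp add: inner_aut_apply m_assoc)
      (simp flip: m_assoc)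
  show "\<iota> (B [^] j) A = A \<otimes> (C [^] j \<otimes> B [^] (alpha_sum (- j) + j))"
    by (simp add: inner_aut_apply i B_pow_A m_assoc int_pow_mult')
  have "B [^] (- j) \<otimes> C = C \<otimes> B [^] (- j * alpha_pow (- 1))"
    using B_pow_C_pow[of "- j" 1] by simp
  then show "\<iota> (B [^] j) C = C \<otimes> B [^] (2 * s * (l * j * (1 - 2 * h)))"
    by (simp add: inner_aut_apply i m_assoc int_pow_mult')
      (simp add: alpha_pow_minus_1 h_def algebra_simps power2_eq_square)
qed

text \<open>The assumptions describe \<open>\<Delta>\<^sub>1\<close> and \<open>\<Delta>\<^sub>2\<close>. As \<open>l\<close> is odd, the three values generate the target of \<open>\<psi>\<close>.\<close>

lemma \<psi>_values:
  assumes "d1 \<in> auto G" "d1 A = A \<otimes> B [^] (2 * s)" "d1 B = B [^] (1 - 4 * s) \<otimes> A [^] (2 * s)"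
    and "d2 \<in> auto G" "d2 A = A" "d2 B = B \<otimes> A [^] (s ^ 2)"
  shows "d1 \<in> Aut_ker G 3" "\<psi> d1 = (0, 1 mod s, 0)"
    and "d2 \<in> Aut_ker G 3" "\<psi> d2 = (0, 0, 1)"
    and "\<iota> C \<in> Aut_ker G 3" "\<psi> (\<iota> C) = (l mod s, 0, 0)"
proof -
  have d1: "d1 A = A \<otimes> W 0 1 0" "d1 B = B \<otimes> W (1 + s div 2 * 0) (- 2) 0"
    using assms by (simp_all add: B_A_W W_def)
  have "W (0 + s div 2 * 1) 0 0 = A [^] (s ^ 2)"
    by (simp add: W_def half_s)
  then have d2: "d2 A = A \<otimes> W 0 0 0" "d2 B = B \<otimes> W (0 + s div 2 * 1) 0 0"
    using assms by simp_all
  have "\<iota> C A = A [^] (1 + 2 * s * l)"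
    using inner_aut_values(4)[of 1] by (simp add: h_def mult.assoc)
  then have iA: "\<iota> C A = A \<otimes> W l 0 0" by (simp add: int_pow_mult W_def)
  have "\<iota> C B = B [^] (1 + 2 * s * (- l + 2 * h * l))"
    using inner_aut_values(5)[of 1] by (simp add: alpha_pow_minus_1 h_def algebra_simps power2_eq_square)
  then have iB: "\<iota> C B = B \<otimes> W (0 + s div 2 * 0) (- l + 2 * h * l) 0" by (simp add: int_pow_mult W_def)
  have i: "\<iota> C \<in> auto G" by (simp add: inner_aut_auto)
  show "d1 \<in> Aut_ker G 3" "d2 \<in> Aut_ker G 3" "\<iota> C \<in> Aut_ker G 3"
    unfolding Aut_ker3_iff using assms(1,4) d1 d2 i iA iB by blast+
  show "\<psi> d1 = (0, 1 mod s, 0)" using \<psi>_perturbation[OF assms(1) d1] by simp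
  show "\<psi> d2 = (0, 0, 1)" using \<psi>_perturbation[OF assms(4) d2] by simp
  show "\<psi> (\<iota> C) = (l mod s, 0, 0)" using \<psi>_perturbation[OF i iA iB] by simp
qed

lemma Aut3_pow: "f \<in> Aut_ker G 3 \<Longrightarrow> f \<up> (n::int) = f [^]\<^bsub>Aut3\<^esub> n"
  using group.int_pow_consistent[OF AutoGroup Aut_ker_subgroup[OF finite_carrier]] by simp

lemma \<psi>_pow:
  assumes "f \<in> Aut_ker G 3" "\<psi> f = (a, b, c)"
  shows "\<psi> (f \<up> (n::int)) = ((n * a) mod s, (n * b) mod s, (n * c) mod 2)"
proof -
  have abc: "(a, b, c) \<in> carrier P"
    using group_hom.hom_closed[OF group_hom_\<psi>, of f] assms by (simp del: carrier_DirProd)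
  then have "a \<in> carrier (integer_mod_group (2 ^ (m - 1)))" "b \<in> carrier (integer_mod_group (2 ^ (m - 1)))"
    "c \<in> carrier (integer_mod_group 2)" by simp_all
  moreover have "\<psi> (f \<up> n) = (a, b, c) [^]\<^bsub>P\<^esub> n"
    using group_hom.hom_int_pow[OF group_hom_\<psi>, of f n] assms by (simp add: Aut3_pow)
  ultimately show ?thesis
    by (simp add: int_pow_DirProd DirProd_group int_pow_integer_mod_group int_s[simplified])
qed

lemma odd_inverse_mod_s: "\<exists>x. (x * l) mod s = a mod s"
proof -
  obtain y where y: "[l * y = 1] (mod s)"
    using cong_solve_coprime_int[of l s] odd_l by (auto simp: s_def)
  have "[a * y * l = a * 1] (mod s)"
    using cong_scalar_left[OF y, of a] by (simp add: mult_ac)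
  then show ?thesis by (auto simp: cong_def)
qed

text \<open>The exponents are read off from \<open>\<psi> f\<close>, and the rest lies in the kernel of \<open>\<psi>\<close>. The power of
  the inner automorphism stands next to \<open>k\<close> so that \<open>InnAut3_generated\<close> can absorb it.\<close>

lemma Aut3_word:
  assumes d: "d1 \<in> auto G" "d1 A = A \<otimes> B [^] (2 * s)" "d1 B = B [^] (1 - 4 * s) \<otimes> A [^] (2 * s)"
    "d2 \<in> auto G" "d2 A = A" "d2 B = B \<otimes> A [^] (s ^ 2)"
    and f: "f \<in> Aut_ker G 3"
  obtains x y z :: int and k where "k \<in> Aut_ker G 2"
    "f = d2 \<up> z \<star> d1 \<up> y \<star> \<iota> C \<up> x \<star> k"
proof -
  interpret Aut: group AutG by (rule AutoGroup)
  interpret A3: group Aut3 by (rule group_Aut3)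
  note v = \<psi>_values[OF d]
  note sub = Aut_ker_subgroup[OF finite_carrier, of 3]
  interpret \<psi>: group_hom Aut3 P \<psi> by (rule group_hom_\<psi>)
  obtain a b t where p: "\<psi> f = (a mod s, b mod s, t mod 2)" by (rule Aut3_elim[OF f]) blast
  obtain x where x: "(x * l) mod s = a mod s" using odd_inverse_mod_s by blast
  define w where "w = d2 \<up> t \<star> d1 \<up> b \<star> \<iota> C \<up> x"
  have pw: "d2 \<up> t \<in> Aut_ker G 3" "d1 \<up> b \<in> Aut_ker G 3" "\<iota> C \<up> x \<in> Aut_ker G 3"
    using v Aut.subgroup_int_pow_closed[OF sub] by blast+
  have w: "w \<in> Aut_ker G 3" unfolding w_def using pw subgroup.m_closed[OF sub] by blast
  have "\<psi> w = \<psi> (d2 \<up> t) \<otimes>\<^bsub>P\<^esub> \<psi> (d1 \<up> b) \<otimes>\<^bsub>P\<^esub> \<psi> (\<iota> C \<up> x)"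
    using \<psi>.hom_mult[of "d2 \<up> t" "d1 \<up> b"]
      \<psi>.hom_mult[of "d2 \<up> t \<star> d1 \<up> b" "\<iota> C \<up> x"]
      pw subgroup.m_closed[OF sub pw(1,2)] by (simp add: w_def)
  also have "\<dots> = (a mod s, b mod s, t mod 2)"
    unfolding \<psi>_pow[OF v(1,2)] \<psi>_pow[OF v(3,4)] \<psi>_pow[OF v(5,6)] mult_DirProd mult_integer_mod_group
    using x by (simp add: int_s[simplified] mod_mult_right_eq)
  finally have "\<psi> w = \<psi> f" using p by simp
  moreover have "inv\<^bsub>Aut3\<^esub> w \<otimes>\<^bsub>Aut3\<^esub> f \<in> carrier Aut3" using w f by (intro A3.m_closed A3.inv_closed) simp_all
  ultimately have "inv\<^bsub>Aut3\<^esub> w \<otimes>\<^bsub>Aut3\<^esub> f \<in> kernel Aut3 P \<psi>"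
    unfolding kernel_def using w f \<psi>.hom_mult[of "inv\<^bsub>Aut3\<^esub> w" f] \<psi>.hom_inv[of w] \<psi>.hom_closed[of f] A3.inv_closed[of w]
      \<psi>.H.l_inv[of "\<psi> f"]
    by (simp del: carrier_DirProd one_DirProd mult_DirProd)
  then have k: "inv\<^bsub>Aut3\<^esub> w \<otimes>\<^bsub>Aut3\<^esub> f \<in> Aut_ker G 2" unfolding \<psi>_kernel .
  have "w \<otimes>\<^bsub>Aut3\<^esub> (inv\<^bsub>Aut3\<^esub> w \<otimes>\<^bsub>Aut3\<^esub> f) = f"
    using w f A3.m_assoc[of w "inv\<^bsub>Aut3\<^esub> w" f] A3.r_inv[of w] A3.l_one[of f] A3.inv_closed[of w] by simp
  then have "f = d2 \<up> t \<star> d1 \<up> b \<star> \<iota> C \<up> x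
      \<star> (inv\<^bsub>Aut3\<^esub> w \<otimes>\<^bsub>Aut3\<^esub> f)"
    by (simp flip: w_def)
  then show ?thesis by (rule that[OF k])
qed

lemma Aut2_subset_Aut3: "Aut_ker G 2 \<subseteq> Aut_ker G 3"
  unfolding Aut_ker2_iff Aut_ker3_iff subset_iff by blast

lemma Aut3_generated:
  assumes d: "d1 \<in> auto G" "d1 A = A \<otimes> B [^] (2 * s)" "d1 B = B [^] (1 - 4 * s) \<otimes> A [^] (2 * s)"
    "d2 \<in> auto G" "d2 A = A" "d2 B = B \<otimes> A [^] (s ^ 2)"
  shows "Aut_ker G 3 = generate AutG {d1, d2, \<iota> C} <#>\<^bsub>AutG\<^esub> Aut_ker G 2"
proof -
  interpret Aut: group AutG by (rule AutoGroup)
  note v = \<psi>_values[OF d]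
  note sub = Aut_ker_subgroup[OF finite_carrier, of 3]
  let ?S = "{d1, d2, \<iota> C}"
  have S: "?S \<subseteq> carrier AutG" using d by (simp add: inner_aut_auto)
  note gen = Aut.generate_is_subgroup[OF S]
  show ?thesis
  proof (intro equalityI subsetI)
    fix f assume "f \<in> Aut_ker G 3"
    then obtain x y z :: int and k where k: "k \<in> Aut_ker G 2"
      "f = d2 \<up> z \<star> d1 \<up> y \<star> \<iota> C \<up> x \<star> k"
      by (rule Aut3_word[OF d])
    have "d2 \<up> z \<star> d1 \<up> y \<star> \<iota> C \<up> x \<in> generate AutG ?S"
      by (intro subgroup.m_closed[OF gen] Aut.subgroup_int_pow_closed[OF gen] generate.incl) simp_all
    then show "f \<in> generate AutG ?S <#>\<^bsub>AutG\<^esub> Aut_ker G 2"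
      unfolding set_mult_def k(2) using k(1) by blast
  next
    fix f assume "f \<in> generate AutG ?S <#>\<^bsub>AutG\<^esub> Aut_ker G 2"
    then obtain g k where gk: "g \<in> generate AutG ?S" "k \<in> Aut_ker G 2" "f = g \<star> k"
      unfolding set_mult_def by blast
    have "generate AutG ?S \<subseteq> Aut_ker G 3"
      using v by (intro Aut.generate_subgroup_incl[OF _ sub]) simp
    then show "f \<in> Aut_ker G 3"
      using gk Aut2_subset_Aut3 subgroup.m_closed[OF sub] by blast
  qed
qed

abbreviation "InnAut3 \<equiv> Inn G <#>\<^bsub>AutG\<^esub> Aut_ker G 3"

lemma InnAut3_subgroup: "subgroup InnAut3 AutG"
  by (rule second_isomorphism_grp.normal_set_mult_subgroup)
    (simp add: second_isomorphism_grp_def second_isomorphism_grp_axioms_def Inn_normal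
      Aut_ker_subgroup finite_carrier)

text \<open>Normality of the inner automorphisms lets them move past the word in \<open>\<Delta>\<^sub>1\<close> and \<open>\<Delta>\<^sub>2\<close>, where they
  absorb the power of \<open>C\<delta>\<close>.\<close>

lemma InnAut3_generated:
  assumes d: "d1 \<in> auto G" "d1 A = A \<otimes> B [^] (2 * s)" "d1 B = B [^] (1 - 4 * s) \<otimes> A [^] (2 * s)"
    "d2 \<in> auto G" "d2 A = A" "d2 B = B \<otimes> A [^] (s ^ 2)"
  shows "InnAut3 = generate AutG {d1, d2} <#>\<^bsub>AutG\<^esub> Inn G <#>\<^bsub>AutG\<^esub> Aut_ker G 2"
proof -
  interpret Aut: group AutG by (rule AutoGroup)
  note v = \<psi>_values[OF d]
  note sub = Aut_ker_subgroup[OF finite_carrier, of 3]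
  note Inn_sub = normal_imp_subgroup[OF Inn_normal]
  let ?S = "{d1, d2}"
  have S: "?S \<subseteq> carrier AutG" using d by simp
  note gen = Aut.generate_is_subgroup[OF S]
  show ?thesis
  proof (intro equalityI subsetI)
    fix f assume "f \<in> InnAut3"
    then obtain i g where ig: "i \<in> Inn G" "g \<in> Aut_ker G 3" "f = i \<star> g"
      unfolding set_mult_def by blast
    obtain x y z :: int and k where k: "k \<in> Aut_ker G 2"
      "g = d2 \<up> z \<star> d1 \<up> y \<star> \<iota> C \<up> x \<star> k"
      by (rule Aut3_word[OF d ig(2)])
    define w where "w = d2 \<up> z \<star> d1 \<up> y"
    have w: "w \<in> generate AutG ?S"
      unfolding w_def
      by (intro subgroup.m_closed[OF gen] Aut.subgroup_int_pow_closed[OF gen] generate.incl) simp_all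
    have wc: "w \<in> carrier AutG" using w subgroup.mem_carrier[OF gen] by blast
    have ic: "i \<in> carrier AutG" using ig(1) subgroup.mem_carrier[OF Inn_sub] by blast
    have kc: "k \<in> carrier AutG" using k(1) by (simp add: Aut_ker2_iff)
    have cI: "\<iota> C \<up> x \<in> Inn G"
      by (rule Aut.subgroup_int_pow_closed[OF Inn_sub]) (simp add: Inn_def)
    then have cc: "\<iota> C \<up> x \<in> carrier AutG" using subgroup.mem_carrier[OF Inn_sub] by blast
    have j: "inv\<^bsub>AutG\<^esub> w \<star> i \<star> w \<star> \<iota> C \<up> x \<in> Inn G"
      using normal.inv_op_closed1[OF Inn_normal wc ig(1)] cI by (rule subgroup.m_closed[OF Inn_sub])
    have "f = i \<star> (w \<star> \<iota> C \<up> x \<star> k)"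
      unfolding ig(3) k(2) w_def ..
    also have "\<dots> = w \<star> (inv\<^bsub>AutG\<^esub> w \<star> i \<star> w \<star> \<iota> C \<up> x) \<star> k"
      using wc ic kc cc Aut.inv_closed[OF wc] Aut.r_inv[OF wc]
      by (simp del: carrier_AutoGroup add: Aut.m_assoc) (simp del: carrier_AutoGroup flip: Aut.m_assoc)
    finally show "f \<in> generate AutG ?S <#>\<^bsub>AutG\<^esub> Inn G <#>\<^bsub>AutG\<^esub> Aut_ker G 2"
      unfolding set_mult_def using w j k(1) by blast
  next
    fix f assume "f \<in> generate AutG ?S <#>\<^bsub>AutG\<^esub> Inn G <#>\<^bsub>AutG\<^esub> Aut_ker G 2"
    then obtain w i k where wik: "w \<in> generate AutG ?S" "i \<in> Inn G" "k \<in> Aut_ker G 2"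
      "f = w \<star> i \<star> k"
      unfolding set_mult_def by blast
    have "generate AutG ?S \<subseteq> Aut_ker G 3"
      using v by (intro Aut.generate_subgroup_incl[OF _ sub]) simp
    then have "w \<star> k \<in> Aut_ker G 3"
      using wik Aut2_subset_Aut3 subgroup.m_closed[OF sub] by blast
    moreover have wc: "w \<in> carrier AutG" using wik subgroup.mem_carrier[OF gen] by blast
    have ic: "i \<in> carrier AutG" using wik subgroup.mem_carrier[OF Inn_sub] by blast
    have kc: "k \<in> carrier AutG" using wik by (simp add: Aut_ker2_iff)
    have "w \<star> i \<star> inv\<^bsub>AutG\<^esub> w \<in> Inn G"
      by (rule normal.inv_op_closed2[OF Inn_normal wc wik(2)])
    moreover have "f = w \<star> i \<star> inv\<^bsub>AutG\<^esub> w \<star> (w \<star> k)"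
      unfolding wik(4) using wc ic kc Aut.inv_closed[OF wc] Aut.l_inv[OF wc]
      by (simp del: carrier_AutoGroup add: Aut.m_assoc) (simp del: carrier_AutoGroup flip: Aut.m_assoc)
    ultimately show "f \<in> InnAut3" unfolding set_mult_def by blast
  qed
qed

abbreviation "V \<equiv> Z (Suc (Suc (Suc 0)))"

lemma V_normal: "V \<lhd> G" and V_sub: "subgroup V G"
  by (simp_all add: upper_central_normal Z_subgroup)

lemma C_pow_in_V_iff: "C [^] n \<in> V \<longleftrightarrow> s dvd n"
proof
  assume "C [^] n \<in> V"
  then obtain x y z where "C [^] n = W x y z" unfolding Z3_eq by blast
  then have "E n 0 0 = E (s * z) (2 * s * y) (2 * s * x)" unfolding W_E[symmetric] by (simp add: E_def)
  then have "same_point (n, 0, 0) (s * z, 2 * s * y, 2 * s * x)" by (rule E_unique)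
  then have "[n = s * z] (mod N)" by simp
  then show "s dvd n" using s_dvd_N by (metis cong_dvd_iff cong_dvd_modulus dvd_triv_left)
next
  assume "s dvd n"
  then obtain z where "n = s * z" by blast
  then show "C [^] n \<in> V" unfolding Z3_eq by (auto simp: W_powers)
qed

lemma V_coset_absorb: "g \<in> carrier G \<Longrightarrow> v \<in> V \<Longrightarrow> V #> (g \<otimes> v) = V #> g"
  using coset_generator_iff[of g "g \<otimes> v"] subgroup.mem_carrier[OF V_sub] by auto

lemma V_coset_C_pow_eq_iff: "V #> C [^] x = V #> C [^] y \<longleftrightarrow> s dvd x - y"
proof -
  have "V #> C [^] x = V #> C [^] y \<longleftrightarrow> C [^] x \<otimes> inv (C [^] y) \<in> V"
    using coset_eq_iff[OF V_sub, of "C [^] x" "C [^] y"] subgroup.rcos_module[OF V_sub is_group, of "C [^] y" "C [^] x"]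
    by simp
  also have "C [^] x \<otimes> inv (C [^] y) = C [^] (x - y)" by (simp add: int_pow_diff)
  finally show ?thesis by (simp add: C_pow_in_V_iff)
qed

text \<open>The exponent is determined modulo \<open>s\<close>, since \<open>C\<close> has order \<open>s\<close> modulo \<open>V\<close>.\<close>

definition C_exponent :: "'a \<Rightarrow> int" where "C_exponent g = (SOME n. \<exists>x. V #> g = V #> C [^] x \<and> n = x mod s)"

lemma C_exponent_eqI: assumes "V #> g = V #> C [^] x" shows "C_exponent g = x mod s"
proof -
  have "\<exists>n. \<exists>x. V #> g = V #> C [^] (x::int) \<and> n = x mod s" using assms by blast
  from someI_ex[OF this] obtain y where "V #> g = V #> C [^] y" "C_exponent g = y mod s"
    unfolding C_exponent_def by blast
  then show ?thesis using assms V_coset_C_pow_eq_iff by (metis mod_eq_dvd_iff)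
qed

definition \<kappa> :: "('a \<Rightarrow> 'a) \<Rightarrow> int \<times> int" where
  "\<kappa> f = (C_exponent (inv A \<otimes> f A), C_exponent (inv B \<otimes> f B))"

text \<open>Modulo \<open>V\<close>, the automorphisms in question multiply \<open>A\<close> and \<open>B\<close> by powers of \<open>C\<close>. The last two
  conditions make this property stable under composition, with exponents adding up.\<close>

definition shifts :: "('a \<Rightarrow> 'a) \<Rightarrow> int \<Rightarrow> int \<Rightarrow> bool" where
  "shifts f x y \<longleftrightarrow> f \<in> auto G \<and> V #> f A = V #> (A \<otimes> C [^] x) \<and> V #> f B = V #> (B \<otimes> C [^] y) \<and>
    V #> f C = V #> C \<and> (\<forall>v\<in>V. f v \<in> V)"

lemma shifts_\<kappa>: assumes "shifts f x y" shows "\<kappa> f = (x mod s, y mod s)"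
proof -
  have f: "f \<in> auto G" using assms by (simp add: shifts_def)
  have "V #> (inv A \<otimes> f A) = V #> (inv A \<otimes> (A \<otimes> C [^] x))"
    using assms auto_closed[OF f] by (intro normal_coset_cong_left[OF V_normal]) (simp_all add: shifts_def)
  moreover have "V #> (inv B \<otimes> f B) = V #> (inv B \<otimes> (B \<otimes> C [^] y))"
    using assms auto_closed[OF f] by (intro normal_coset_cong_left[OF V_normal]) (simp_all add: shifts_def)
  ultimately show ?thesis unfolding \<kappa>_def by (simp add: C_exponent_eqI flip: m_assoc)
qed

lemma V_coset_pow_cong:
  assumes "V #> g = V #> k" "g \<in> carrier G" "k \<in> carrier G"
  shows "V #> g [^] (n::int) = V #> k [^] n"
proof -
  have "V #> x [^] n = (V #> x) [^]\<^bsub>G Mod V\<^esub> n" if "x \<in> carrier G" for x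
    using hom_int_pow[OF normal.r_coset_hom_Mod[OF V_normal] that is_group normal.factorgroup_is_group[OF V_normal]] .
  then show ?thesis using assms by simp
qed

lemma shifts_generator:
  fixes x' z :: int
  assumes f: "shifts f x y" and g: "V #> g = V #> (k \<otimes> C [^] x')" "g \<in> carrier G" "k \<in> carrier G"
    and fk: "V #> f k = V #> (k \<otimes> C [^] z)"
  shows "V #> f g = V #> (k \<otimes> C [^] (z + x'))"
proof -
  have fa: "f \<in> auto G" using f by (simp add: shifts_def)
  interpret f: group_hom G G f by (rule auto_group_hom[OF fa])
  have "\<exists>v\<in>V. g = k \<otimes> C [^] x' \<otimes> v"
    using iffD1[OF coset_generator_iff g(1)] g(2,3) by simp
  then obtain v where v: "v \<in> V" "g = k \<otimes> C [^] x' \<otimes> v" by blast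
  have vc: "v \<in> carrier G" using v(1) subgroup.mem_carrier[OF V_sub] by blast
  have "V #> f g = V #> (f k \<otimes> f C [^] x' \<otimes> f v)"
    using g(3) vc by (simp add: v(2) f.hom_int_pow)
  also have "\<dots> = V #> (f k \<otimes> f C [^] x')"
    using f v(1) g(3) by (intro V_coset_absorb) (auto simp: shifts_def)
  also have "\<dots> = V #> (k \<otimes> C [^] z \<otimes> C [^] x')"
    using g(3) fk f by (intro normal_coset_mult_cong[OF V_normal] V_coset_pow_cong) (auto simp: shifts_def)
  finally show ?thesis using g(3) by (simp add: m_assoc int_pow_mult')
qed

lemma shifts_mult:
  assumes f: "shifts f x y" and g: "shifts g x' y'"
  shows "shifts (f \<star> g) (x + x') (y + y')"
proof -
  have fa: "f \<in> auto G" and ga: "g \<in> auto G" using f g by (simp_all add: shifts_def)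
  note gc = auto_closed[OF ga]
  have fv: "V #> f A = V #> (A \<otimes> C [^] x)" "V #> f B = V #> (B \<otimes> C [^] y)"
    "V #> f C = V #> (C \<otimes> C [^] (0::int))"
    and gv: "V #> g A = V #> (A \<otimes> C [^] x')" "V #> g B = V #> (B \<otimes> C [^] y')"
    "V #> g C = V #> (C \<otimes> C [^] (0::int))"
    using f g by (simp_all add: shifts_def)
  have "V #> f (g A) = V #> (A \<otimes> C [^] (x + x'))"
    by (rule shifts_generator[OF f gv(1) gc[OF A_closed] A_closed fv(1)])
  moreover have "V #> f (g B) = V #> (B \<otimes> C [^] (y + y'))"
    by (rule shifts_generator[OF f gv(2) gc[OF B_closed] B_closed fv(2)])
  moreover have "V #> f (g C) = V #> (C \<otimes> C [^] (0 + 0 :: int))"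
    by (rule shifts_generator[OF f gv(3) gc[OF C_closed] C_closed fv(3)])
  moreover have "(f \<star> g) v \<in> V" if "v \<in> V" for v
    using f g that subgroup.mem_carrier[OF V_sub that] by (simp add: AutoGroup_mult_apply[OF fa ga] shifts_def)
  ultimately show ?thesis
    unfolding shifts_def by (simp add: AutoGroup_mult_apply[OF fa ga] auto_mult_closed fa ga)
qed

lemma shifts_Aut3:
  assumes "f \<in> Aut_ker G 3" shows "shifts f 0 0"
proof -
  have f: "f \<in> auto G" "\<And>x. x \<in> carrier G \<Longrightarrow> V #> f x = V #> x"
    using assms unfolding Aut_ker_iff[OF finite_carrier] by (simp_all add: numeral_3_eq_3)
  have "f v \<in> V" if v: "v \<in> V" for v
  proof -
    have vc: "v \<in> carrier G" using v subgroup.mem_carrier[OF V_sub] by blast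
    have "V #> f v = V #> v" by (rule f(2)[OF vc])
    also have "\<dots> = V" by (rule coset_join2[OF vc V_sub v])
    finally show ?thesis using rcos_self[OF auto_closed[OF f(1) vc] V_sub] by simp
  qed
  then show ?thesis using f by (simp add: shifts_def)
qed

lemma alpha_sum_2s_dvd: "2 * s dvd alpha_sum (- i) + i"
proof -
  have "alpha_sum (- i) + i = 2 * s * (l * tri (- i) + 2 * l * h * tet (- i))"
    by (simp add: alpha_sum_def h_def algebra_simps power2_eq_square)
  then show ?thesis by simp
qed

lemma A_pow_in_V: "2 * s dvd n \<Longrightarrow> A [^] n \<in> V" and B_pow_in_V: "2 * s dvd n \<Longrightarrow> B [^] n \<in> V"
  by (auto simp: W_powers W_in_Z3 elim!: dvdE)

lemma inner_preserves_V: "g \<in> carrier G \<Longrightarrow> v \<in> V \<Longrightarrow> \<iota> g v \<in> V"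
  using normal.inv_op_closed1[OF V_normal] subgroup.mem_carrier[OF V_sub] by (simp add: inner_aut_apply)

text \<open>Conjugation by a power of \<open>A\<close> multiplies \<open>B\<close> by a power of \<open>C\<close>, up to a power of \<open>A\<^sup>2\<^sup>s\<close>, which lies in \<open>V\<close>.\<close>

lemma shifts_inner_A: "shifts (\<iota> (A [^] i)) 0 (- i)"
proof -
  have "2 * s dvd - 2 * h * i" by (simp add: h_def)
  then have "V #> (C \<otimes> A [^] (- 2 * h * i)) = V #> C" by (intro V_coset_absorb A_pow_in_V) simp_all
  moreover have "V #> (B \<otimes> C [^] (- i) \<otimes> A [^] (alpha_sum (- i) + i)) = V #> (B \<otimes> C [^] (- i))"
    by (intro V_coset_absorb A_pow_in_V alpha_sum_2s_dvd) simp
  ultimately show ?thesis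
    unfolding shifts_def inner_aut_values by (simp add: inner_aut_auto inner_preserves_V m_assoc)
qed

lemma shifts_inner_B: "shifts (\<iota> (B [^] j)) j 0"
proof -
  have "V #> (C \<otimes> B [^] (2 * s * (l * j * (1 - 2 * h)))) = V #> C"
    by (intro V_coset_absorb B_pow_in_V) simp_all
  moreover have "V #> (A \<otimes> C [^] j \<otimes> B [^] (alpha_sum (- j) + j)) = V #> (A \<otimes> C [^] j)"
    by (intro V_coset_absorb B_pow_in_V alpha_sum_2s_dvd) simp
  ultimately show ?thesis
    unfolding shifts_def inner_aut_values_B by (simp add: inner_aut_auto inner_preserves_V m_assoc)
qed

lemma shifts_inner_C: "shifts (\<iota> (C [^] (k::int))) 0 0"
proof -
  have a: "2 * s dvd alpha_pow k - 1" for k :: int using alpha_pow_mod_2s by (simp add: cong_iff_dvd_diff)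
  have "V #> (A \<otimes> A [^] (alpha_pow k - 1)) = V #> A" "V #> (B \<otimes> B [^] (alpha_pow (- k) - 1)) = V #> B"
    by (intro V_coset_absorb A_pow_in_V B_pow_in_V a; simp)+
  moreover have "A \<otimes> A [^] (alpha_pow k - 1) = A [^] alpha_pow k" "B \<otimes> B [^] (alpha_pow (- k) - 1) = B [^] alpha_pow (- k)"
    using int_pow_mult'[of A 1 "alpha_pow k - 1"] int_pow_mult'[of B 1 "alpha_pow (- k) - 1"] by simp_all
  ultimately show ?thesis
    unfolding shifts_def inner_aut_values by (simp add: inner_aut_auto inner_preserves_V)
qed

lemma shifts_inner: assumes "g \<in> carrier G" shows "\<exists>x y. shifts (\<iota> g) x y"
proof -
  obtain k j i where g: "g = E k j i" using assms by (rule normal_form)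
  have "\<iota> g = \<iota> (A [^] i) \<star> (\<iota> (B [^] j) \<star> \<iota> (C [^] k))"
    unfolding g E_def by (simp add: inner_aut_mult m_assoc)
  then show ?thesis
    using shifts_mult[OF shifts_inner_A shifts_mult[OF shifts_inner_B shifts_inner_C]] by metis
qed

lemma InnAut3_shifts: assumes "f \<in> InnAut3" obtains x y where "shifts f x y"
proof -
  obtain i g where ig: "i \<in> Inn G" "g \<in> Aut_ker G 3" "f = i \<star> g"
    using assms unfolding set_mult_def by blast
  then obtain x y where "shifts i x y" using shifts_inner unfolding Inn_def by blast
  then show ?thesis using that shifts_mult[OF _ shifts_Aut3[OF ig(2)]] ig(3) by blast
qed

abbreviation "IA3 \<equiv> AutG\<lparr>carrier := InnAut3\<rparr>"
abbreviation "P2 \<equiv> integer_mod_group (2 ^ (m - 1)) \<times>\<times> integer_mod_group (2 ^ (m - 1))"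

lemma group_hom_\<kappa>: "group_hom IA3 P2 \<kappa>"
proof -
  have "\<kappa> \<in> hom IA3 P2"
  proof (rule homI)
    fix f assume "f \<in> carrier IA3"
    then have "f \<in> InnAut3" by simp
    then obtain x y where "shifts f x y" by (rule InnAut3_shifts)
    then show "\<kappa> f \<in> carrier P2"
      using s_pos by (simp add: shifts_\<kappa> carrier_Zs carrier_Zs[unfolded One_nat_def])
  next
    fix f g assume "f \<in> carrier IA3" "g \<in> carrier IA3"
    then have "f \<in> InnAut3" "g \<in> InnAut3" by simp_all
    then obtain x y x' y' where fg: "shifts f x y" "shifts g x' y'"
      by (elim InnAut3_shifts) blast
    have "\<kappa> (f \<star> g) = ((x + x') mod s, (y + y') mod s)"
      by (rule shifts_\<kappa>[OF shifts_mult[OF fg]])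
    then show "\<kappa> (f \<otimes>\<^bsub>IA3\<^esub> g) = \<kappa> f \<otimes>\<^bsub>P2\<^esub> \<kappa> g"
      unfolding fg[THEN shifts_\<kappa>] mult_DirProd mult_integer_mod_group
      by (simp add: int_s[simplified] mod_add_eq)
  qed
  then show ?thesis
    using subgroup.subgroup_is_group[OF InnAut3_subgroup AutoGroup]
    by (simp add: group_hom_def group_hom_axioms_def DirProd_group)
qed

lemma Aut3_subset_InnAut3: "Aut_ker G 3 \<subseteq> InnAut3"
proof
  fix f assume f: "f \<in> Aut_ker G 3"
  interpret Aut: group AutG by (rule AutoGroup)
  have "\<one>\<^bsub>AutG\<^esub> \<in> Inn G" by (rule subgroup.one_closed[OF normal_imp_subgroup[OF Inn_normal]])
  moreover have "f = \<one>\<^bsub>AutG\<^esub> \<star> f" using f by (simp add: Aut_ker3_iff)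
  ultimately show "f \<in> InnAut3" unfolding set_mult_def using f by blast
qed

lemma \<kappa>_kernel: "kernel IA3 P2 \<kappa> = Aut_ker G 3"
proof (intro equalityI subsetI)
  fix f assume "f \<in> kernel IA3 P2 \<kappa>"
  then have f: "f \<in> InnAut3" "\<kappa> f = (0, 0)" by (simp_all add: kernel_def)
  obtain x y where sh: "shifts f x y" using InnAut3_shifts[OF f(1)] .
  then have xy: "s dvd x" "s dvd y" using f(2) shifts_\<kappa>[OF sh] by auto
  have "V #> f A = V #> A" "V #> f B = V #> B"
    using sh V_coset_absorb[of A "C [^] x"] V_coset_absorb[of B "C [^] y"] xy
    by (simp_all add: shifts_def C_pow_in_V_iff)
  then show "f \<in> Aut_ker G 3"
    unfolding Aut_ker_generators_iff[OF finite_carrier generated]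
    using sh by (simp add: shifts_def numeral_3_eq_3)
next
  fix f assume f: "f \<in> Aut_ker G 3"
  then show "f \<in> kernel IA3 P2 \<kappa>"
    using shifts_\<kappa>[OF shifts_Aut3[OF f]] Aut3_subset_InnAut3 by (auto simp: kernel_def)
qed

text \<open>Conjugation by \<open>B\<^sup>x\<close> realizes \<open>(x, 0)\<close>, and conjugation by \<open>A\<^sup>-\<^sup>y\<close> realizes \<open>(0, y)\<close>.\<close>

lemma \<kappa>_surj: "\<kappa> ` carrier IA3 = carrier P2"
proof (intro equalityI subsetI)
  fix p assume "p \<in> carrier P2"
  then obtain x y where p: "p = (x, y)" "0 \<le> x" "x < s" "0 \<le> y" "y < s"
    by (auto simp: carrier_Zs carrier_Zs[unfolded One_nat_def])
  have "shifts (\<iota> (B [^] x) \<star> \<iota> (A [^] (- y))) (x + 0) (0 + - (- y))"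
    by (rule shifts_mult[OF shifts_inner_B shifts_inner_A])
  then have "\<kappa> (\<iota> (B [^] x) \<star> \<iota> (A [^] (- y))) = p"
    using p by (simp add: shifts_\<kappa>)
  moreover have "\<iota> (B [^] x) \<star> \<iota> (A [^] (- y)) \<in> InnAut3"
  proof -
    interpret Aut: group AutG by (rule AutoGroup)
    have i: "\<iota> (B [^] x) \<star> \<iota> (A [^] (- y)) \<in> Inn G"
      by (intro subgroup.m_closed[OF normal_imp_subgroup[OF Inn_normal]]) (simp_all add: Inn_def)
    have one: "\<one>\<^bsub>AutG\<^esub> \<in> Aut_ker G 3" by (rule subgroup.one_closed[OF Aut_ker_subgroup[OF finite_carrier]])
    have "\<iota> (B [^] x) \<star> \<iota> (A [^] (- y)) = \<iota> (B [^] x) \<star> \<iota> (A [^] (- y)) \<star> \<one>\<^bsub>AutG\<^esub>"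
      by (simp add: inner_aut_auto auto_mult_closed)
    then show ?thesis unfolding set_mult_def using i one by blast
  qed
  moreover have "carrier IA3 = InnAut3" by simp
  ultimately show "p \<in> \<kappa> ` carrier IA3" by blast
qed (use group_hom.hom_closed[OF group_hom_\<kappa>] in blast)

lemma InnAut3_mod_Aut3: "IA3 Mod Aut_ker G 3 \<cong> P2"
  using group_hom.FactGroup_iso[OF group_hom_\<kappa> \<kappa>_surj] unfolding \<kappa>_kernel .

lemma card_InnAut3: "card InnAut3 = 2 ^ (8 * m - 3)"
proof -
  have sub: "subgroup (Aut_ker G 3) IA3"
    using group_hom.subgroup_kernel[OF group_hom_\<kappa>] unfolding \<kappa>_kernel .
  have gr: "group IA3" using group_hom_\<kappa> by (simp add: group_hom_def)
  have "card InnAut3 = card (rcosets\<^bsub>IA3\<^esub> (Aut_ker G 3)) * card (Aut_ker G 3)"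
    using group.lagrange[OF gr sub] by (simp add: order_def)
  also have "card (rcosets\<^bsub>IA3\<^esub> (Aut_ker G 3)) = card (carrier P2)"
    using iso_same_order InnAut3_mod_Aut3 by (fastforce simp: is_iso_def order_def FactGroup_def)
  also have "\<dots> = 2 ^ (m - 1) * 2 ^ (m - 1)"
    by (simp add: carrier_Zs carrier_Zs[unfolded One_nat_def] card_cartesian_product s_def nat_power_eq)
  also have "\<dots> * card (Aut_ker G 3) = 2 ^ ((m - 1) + (m - 1) + (6 * m - 1))"
    by (simp only: card_Aut3 power_add)
  also have "(m - 1) + (m - 1) + (6 * m - 1) = 8 * m - 3" using m_gt_1 by simp
  finally show ?thesis .
qed

end

section \<open>The presented group \<open>J\<close>\<close>

lemma group_hom_J_relations:
  assumes h: "group_hom F H h" and F: "F = free_group"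
    and x: "h (free_gen gen_A) = x" and y: "h (free_gen gen_B) = y"
  shows "(\<forall>r\<in>J_relators m l. h r = \<one>\<^bsub>H\<^esub>) \<longleftrightarrow>
    gconj H x (gcomm H x y) = x [^]\<^bsub>H\<^esub> (1 + 2 ^ m * l) \<and> gconj H y (gcomm H y x) = y [^]\<^bsub>H\<^esub> (1 + 2 ^ m * l) \<and>
    x [^]\<^bsub>H\<^esub> ((2::nat) ^ (3 * m - 1)) = \<one>\<^bsub>H\<^esub> \<and> y [^]\<^bsub>H\<^esub> ((2::nat) ^ (3 * m - 1)) = \<one>\<^bsub>H\<^esub>"
proof -
  interpret group_hom free_group H h using h F by simp
  have cl: "x \<in> carrier H" "y \<in> carrier H"
    using x y hom_closed[OF free_gen_closed] by auto
  have conj: "h (gconj free_group a b) = gconj H (h a) (h b)" and comm: "h (gcomm free_group a b) = gcomm H (h a) (h b)"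
    if "a \<in> carrier free_group" "b \<in> carrier free_group" for a b
    using that by (simp_all add: gconj_def gcomm_def)
  have gc: "gcomm free_group a b \<in> carrier free_group" "gconj free_group a b \<in> carrier free_group"
    if "a \<in> carrier free_group" "b \<in> carrier free_group" for a b :: "gen word set"
    using that by (simp_all add: gconj_def gcomm_def)
  have eq: "a \<otimes>\<^bsub>H\<^esub> inv\<^bsub>H\<^esub> b = \<one>\<^bsub>H\<^esub> \<longleftrightarrow> a = b" if "a \<in> carrier H" "b \<in> carrier H" for a b
  proof
    assume "a \<otimes>\<^bsub>H\<^esub> inv\<^bsub>H\<^esub> b = \<one>\<^bsub>H\<^esub>"
    then have "a \<otimes>\<^bsub>H\<^esub> inv\<^bsub>H\<^esub> b \<otimes>\<^bsub>H\<^esub> b = \<one>\<^bsub>H\<^esub> \<otimes>\<^bsub>H\<^esub> b" by simp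
    then show "a = b" using that by (simp add: H.m_assoc)
  qed (use that in simp)
  have gcH: "gcomm H a b \<in> carrier H" "gconj H a b \<in> carrier H" if "a \<in> carrier H" "b \<in> carrier H" for a b
    using that by (simp_all add: gconj_def gcomm_def)
  show ?thesis
    by (simp add: J_relators_def Let_def free_gen_closed gc conj comm x y hom_int_pow hom_nat_pow
        eq cl gcH del: One_nat_def)
qed

lemma J_group_universal:
  assumes "J_rel H m l x y"
  shows "\<exists>k\<in>hom (J_group m l) H. k (J_A m l) = x \<and> k (J_B m l) = y"
proof -
  interpret H: J_rel H m l x y by fact
  have "(case g of gen_A \<Rightarrow> x | gen_B \<Rightarrow> y) \<in> carrier H" for g by (cases g) simp_all
  then obtain h where h: "h \<in> hom free_group H" "\<And>g. h (free_gen g) = (case g of gen_A \<Rightarrow> x | gen_B \<Rightarrow> y)"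
    using free_group_universal[OF H.is_group, of "\<lambda>g. case g of gen_A \<Rightarrow> x | gen_B \<Rightarrow> y"] by blast
  have gh: "group_hom free_group H h"
    using h group_free_group by (simp add: group_hom_def group_hom_axioms_def H.is_group)
  have "\<forall>r\<in>J_relators m l. h r = \<one>\<^bsub>H\<^esub>"
    using group_hom_J_relations[OF gh HOL.refl, of x y] h(2) H.A_rel H.B_rel H.A_ord H.B_ord by simp
  then obtain k where k: "k \<in> hom (presented_group (J_relators m l)) H"
    "\<forall>x. k (presented_gen (J_relators m l) x) = h (free_gen x)"
    using presented_group_universal[OF H.is_group J_relators_closed h(1)] by blast
  then show ?thesis
    unfolding J_group_def J_A_def J_B_def using h(2) by (intro bexI[OF _ k(1)]) simp
qed

lemma presented_group_projection:
  assumes "R \<subseteq> carrier free_group"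
  shows "group_hom free_group (presented_group R) ((#>\<^bsub>free_group\<^esub>) (normal_closure free_group R))"
    and "\<And>r. r \<in> R \<Longrightarrow> normal_closure free_group R #>\<^bsub>free_group\<^esub> r = \<one>\<^bsub>presented_group R\<^esub>"
proof -
  interpret F: group free_group by (rule group_free_group)
  note N = normal_normal_closure[OF group_free_group assms]
  show "group_hom free_group (presented_group R) ((#>\<^bsub>free_group\<^esub>) (normal_closure free_group R))"
    using normal.r_coset_hom_Mod[OF N] group_presented_group[OF assms] group_free_group
    by (simp add: presented_group_def group_hom_def group_hom_axioms_def)
  fix r assume r: "r \<in> R"
  then have rc: "r \<in> carrier free_group" using assms by blast
  have "gconj free_group r \<one>\<^bsub>free_group\<^esub> = r" using rc by (simp add: gconj_def)
  then have "r \<in> {gconj free_group r g |r g. r \<in> R \<and> g \<in> carrier free_group}"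
    using r F.one_closed by force
  then have "r \<in> normal_closure free_group R"
    unfolding normal_closure_def by (rule generate.incl)
  then show "normal_closure free_group R #>\<^bsub>free_group\<^esub> r = \<one>\<^bsub>presented_group R\<^esub>"
    using F.coset_join2[OF rc normal_imp_subgroup[OF N]] by (simp add: presented_group_def)
qed

text \<open>Every element is the image of a word, and words are built letter by letter.\<close>

lemma presented_group_generated:
  assumes "R \<subseteq> carrier free_group"
  shows "carrier (presented_group R) = generate (presented_group R) (range (presented_gen R))"
proof -
  let ?\<pi> = "(#>\<^bsub>free_group\<^esub>) (normal_closure free_group R)"
  interpret \<pi>: group_hom free_group "presented_group R" ?\<pi>
    by (rule presented_group_projection[OF assms])
  have gens: "range (presented_gen R) \<subseteq> carrier (presented_group R)"
    by (rule image_subsetI) (rule presented_gen_closed)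
  note sub = \<pi>.H.generate_is_subgroup[OF gens]
  have "?\<pi> (free_rel `` {w}) \<in> generate (presented_group R) (range (presented_gen R))" for w
  proof (induction w)
    case Nil
    then show ?case
      using \<pi>.hom_one subgroup.one_closed[OF sub] by (simp add: one_free_group)
  next
    case (Cons p w)
    obtain e x where p: "p = (e, x)" by force
    have g: "?\<pi> (free_gen x) \<in> generate (presented_group R) (range (presented_gen R))"
      unfolding presented_gen_def[symmetric] by (intro generate.incl) blast
    have w: "free_rel `` {w} \<in> carrier free_group" by (simp add: carrier_free_group)
    have "?\<pi> (if e then free_gen x else inv\<^bsub>free_group\<^esub> free_gen x) \<in> generate (presented_group R) (range (presented_gen R))"
      using g subgroup.m_inv_closed[OF sub g] by (simp add: free_gen_closed)
    then show ?case
      using Cons w unfolding p free_class_Cons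
      by (subst \<pi>.hom_mult) (auto simp: free_gen_closed intro: subgroup.m_closed[OF sub])
  qed
  then have "carrier (presented_group R) \<subseteq> generate (presented_group R) (range (presented_gen R))"
    by (auto simp: presented_group_def carrier_FactGroup carrier_free_group)
  then show ?thesis using \<pi>.H.generate_incl[OF gens] by blast
qed

text \<open>Equal normal forms in \<open>J\<close> remain equal after mapping \<open>J\<close> to the permutation group, where the
  exponents can be recovered.\<close>

lemma J_full_J_group:
  assumes "m > 1" "odd l"
  shows "J_full (J_group m l) m l (J_A m l) (J_B m l)"
proof -
  interpret scale m l using assms by unfold_locales
  interpret J: group "J_group m l" by (rule group_J_group)
  note proj = presented_group_projection[OF J_relators_closed[of m l]]
  interpret J: J_rel "J_group m l" m l "J_A m l" "J_B m l"
  proof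
    show "J_A m l \<in> carrier (J_group m l)" "J_B m l \<in> carrier (J_group m l)"
      by (rule J_A_closed J_B_closed)+
    note rel = group_hom_J_relations[OF proj(1) HOL.refl HOL.refl HOL.refl, THEN iffD1, OF ballI, OF proj(2)]
    show "gconj (J_group m l) (J_A m l) (gcomm (J_group m l) (J_A m l) (J_B m l)) = J_A m l [^]\<^bsub>J_group m l\<^esub> (1 + 2 ^ m * l)"
      "gconj (J_group m l) (J_B m l) (gcomm (J_group m l) (J_B m l) (J_A m l)) = J_B m l [^]\<^bsub>J_group m l\<^esub> (1 + 2 ^ m * l)"
      "J_A m l [^]\<^bsub>J_group m l\<^esub> ((2::nat) ^ (3 * m - 1)) = \<one>\<^bsub>J_group m l\<^esub>"
      "J_B m l [^]\<^bsub>J_group m l\<^esub> ((2::nat) ^ (3 * m - 1)) = \<one>\<^bsub>J_group m l\<^esub>"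
      using rel unfolding J_A_def J_B_def J_group_def presented_gen_def by blast+
  qed
  show ?thesis
  proof
    fix k j i k' j' i' assume e: "J.E k j i = J.E k' j' i'"
    obtain f where f: "f \<in> hom (J_group m l) (BijGroup S)" "f (J_A m l) = inv\<^bsub>BijGroup S\<^esub> pA" "f (J_B m l) = inv\<^bsub>BijGroup S\<^esub> pB"
      using J_group_universal[OF perm_J_rel] by blast
    interpret H: J_rel "BijGroup S" m l "inv\<^bsub>BijGroup S\<^esub> pA" "inv\<^bsub>BijGroup S\<^esub> pB" by (rule perm_J_rel)
    interpret f: group_hom "J_group m l" "BijGroup S" f
      using f(1) by (simp add: group_hom_def group_hom_axioms_def J.is_group H.is_group)
    have "f (J.E k j i) = H.E k j i" for k j i
      by (simp add: J.E_def H.E_def f.hom_int_pow f(2,3) J.C_def H.C_def gcomm_def)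
    then show "same_point (k, j, i) (k', j', i')" using e perm_E_unique by metis
  next
    have "range (presented_gen (J_relators m l)) = {J_A m l, J_B m l}"
    proof -
      have UNIV: "(UNIV :: gen set) = {gen_A, gen_B}" using gen.exhaust by auto
      show ?thesis unfolding UNIV J_A_def J_B_def by simp
    qed
    then show "carrier (J_group m l) = generate (J_group m l) {J_A m l, J_B m l}"
      using presented_group_generated[OF J_relators_closed[of m l]] by (simp add: J_group_def)
  next
    fix x y assume "J_rel (J_group m l) m l x y"
    then show "\<exists>f\<in>hom (J_group m l) (J_group m l). f (J_A m l) = x \<and> f (J_B m l) = y"
      by (rule J_group_universal)
  qed
qed

theorem theorem7p3:
  fixes m :: nat and l :: int
  assumes "m > 1" and "odd l"
  shows "let J = J_group m l; A = J_A m l; B = J_B m l; C = gcomm J A B;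
             s = (2::int) ^ (m - 1); u = s ^ 2;
             AutJ = AutoGroup J; Aut2 = Aut_ker J 2; Aut3 = Aut_ker J 3;
             InnAut3 = Inn J <#>\<^bsub>AutJ\<^esub> Aut3
         in \<exists>\<Delta>1 \<in> carrier AutJ. \<exists>\<Delta>2 \<in> carrier AutJ.
              \<Delta>1 A = A \<otimes>\<^bsub>J\<^esub> B [^]\<^bsub>J\<^esub> (2 * s) \<and>
              \<Delta>1 B = B [^]\<^bsub>J\<^esub> (1 - 4 * s) \<otimes>\<^bsub>J\<^esub> A [^]\<^bsub>J\<^esub> (2 * s) \<and>
              \<Delta>2 A = A \<and>
              \<Delta>2 B = B \<otimes>\<^bsub>J\<^esub> A [^]\<^bsub>J\<^esub> u \<and>
              InnAut3 = generate AutJ {\<Delta>1, \<Delta>2} <#>\<^bsub>AutJ\<^esub> Inn J <#>\<^bsub>AutJ\<^esub> Aut2 \<and>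
              Aut3 = generate AutJ {\<Delta>1, \<Delta>2, inner_aut J C} <#>\<^bsub>AutJ\<^esub> Aut2 \<and>
              (AutJ\<lparr>carrier := Aut3\<rparr>) Mod Aut2 \<cong>
                integer_mod_group (2 ^ (m - 1)) \<times>\<times> integer_mod_group (2 ^ (m - 1)) \<times>\<times> integer_mod_group 2 \<and>
              (AutJ\<lparr>carrier := InnAut3\<rparr>) Mod Aut3 \<cong>
                integer_mod_group (2 ^ (m - 1)) \<times>\<times> integer_mod_group (2 ^ (m - 1)) \<and>
              card Aut3 = 2 ^ (6 * m - 1) \<and>
              card InnAut3 = 2 ^ (8 * m - 3)"
proof -
  interpret J: J_full "J_group m l" m l "J_A m l" "J_B m l"
    by (rule J_full_J_group[OF assms])
  have s: "2 ^ (m - 1) = J.s" by (simp add: J.s_def)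
  obtain d1 d2 where d: "d1 \<in> auto (J_group m l)"
    "d1 (J_A m l) = J_A m l \<otimes>\<^bsub>J_group m l\<^esub> J_B m l [^]\<^bsub>J_group m l\<^esub> (2 * J.s)"
    "d1 (J_B m l) = J_B m l [^]\<^bsub>J_group m l\<^esub> (1 - 4 * J.s) \<otimes>\<^bsub>J_group m l\<^esub> J_A m l [^]\<^bsub>J_group m l\<^esub> (2 * J.s)"
    "d2 \<in> auto (J_group m l)" "d2 (J_A m l) = J_A m l"
    "d2 (J_B m l) = J_B m l \<otimes>\<^bsub>J_group m l\<^esub> J_A m l [^]\<^bsub>J_group m l\<^esub> (J.s ^ 2)"
    by (rule J.\<Delta>_exist)
  show ?thesis
    unfolding Let_def s
    using d J.InnAut3_generated[OF d] J.Aut3_generated[OF d] J.Aut3_mod_Aut2 J.InnAut3_mod_Aut3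
      J.card_Aut3 J.card_InnAut3
    unfolding J.C_def J.carrier_AutoGroup by blast
qed

end
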